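(* Let $(R,\mathfrak{m},k)$ be a reduced F-finite Gorenstein Noetherian local ring of prime characteristic $p$ with infinite perfect residue field. Let $e$ denote the Hilbert-Samuel multiplicity of $R$ and let $s$ denote the F-signature of $R$. Choose a minimal reduction $\boldsymbol{x}=(x_1,\dots,x_d)$ of $\mathfrak{m}$. For any ideal $I$ of $R$ with $I\supseteq(\boldsymbol{x})$, let $\mu=\mu(I/(\boldsymbol{x}))$ be the minimal number of generators of $I/(\boldsymbol{x})$. Then $$e_{HK}(R)\geq \frac{e-s\mu}{e-\mu}=1+\frac{\mu}{e-\mu}(1-s).$$
   Context: For an $\mathfrak{m}$-primary ideal $I$ of a $d$-dimensional Noetherian local ring $R$ of characteristic $p$, and $q=p^e$, $I^{[q]}$ is the ideal generated by $q$-th powers of elements of $I$; the Hilbert-Kunz multiplicity is $e_{HK}(I)=\lim_{q\to\infty}\ell(R/I^{[q]})/q^d$, and $e_{HK}(R)=e_{HK}(\mathfrak{m})$. $R$ is F-finite if $R$ is a finitely generated module over itself via Frobenius. For $R$ F-finite and reduced, write $R^{1/q}\cong R^{a_q}\oplus M$ with $M$ having no free summands, and let $\alpha(R)=\log_p[k:k^p]$; the F-signature is $s(R)=\lim_{q\to\infty} a_q/q^{d+\alpha(R)}$ (this limit exists in the Gorenstein case). A minimal reduction of $\mathfrak{m}$ is an ideal $(\boldsymbol{x})\subseteq\mathfrak{m}$ generated by $d=\dim R$ elements over which $\mathfrak{m}$ is integral. *)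

theory Defs
  imports Complex_Main "HOL-Computational_Algebra.Primes"
begin

definition ideal :: "'a::comm_ring_1 set \<Rightarrow> bool" where
  "ideal I \<longleftrightarrow> 0 \<in> I \<and> (\<forall>x\<in>I. \<forall>y\<in>I. x + y \<in> I) \<and> (\<forall>r x. x \<in> I \<longrightarrow> r * x \<in> I)"

definition gen_ideal :: "'a::comm_ring_1 set \<Rightarrow> 'a set" where
  "gen_ideal S = \<Inter>{I. ideal I \<and> S \<subseteq> I}"

definition ideal_mult :: "'a::comm_ring_1 set \<Rightarrow> 'a set \<Rightarrow> 'a set" where
  "ideal_mult I J = gen_ideal {a * b | a b. a \<in> I \<and> b \<in> J}"

fun ideal_pow :: "'a::comm_ring_1 set \<Rightarrow> nat \<Rightarrow> 'a set" where
  "ideal_pow I 0 = UNIV"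
| "ideal_pow I (Suc n) = ideal_mult I (ideal_pow I n)"

definition frob_pow :: "'a::comm_ring_1 set \<Rightarrow> nat \<Rightarrow> 'a set" where
  "frob_pow I q = gen_ideal ((\<lambda>x. x ^ q) ` I)"

definition prime_ideal :: "'a::comm_ring_1 set \<Rightarrow> bool" where
  "prime_ideal P \<longleftrightarrow> ideal P \<and> P \<noteq> UNIV \<and> (\<forall>a b. a * b \<in> P \<longrightarrow> a \<in> P \<or> b \<in> P)"

definition maximal_ideal :: "'a::comm_ring_1 set \<Rightarrow> bool" where
  "maximal_ideal M \<longleftrightarrow> ideal M \<and> M \<noteq> UNIV \<and>
     (\<forall>J. ideal J \<and> M \<subseteq> J \<longrightarrow> J = M \<or> J = UNIV)"

definition local_ring :: "'a::comm_ring_1 set \<Rightarrow> bool" where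
  "local_ring m \<longleftrightarrow> maximal_ideal m \<and> (\<forall>M. maximal_ideal M \<longrightarrow> M = m)"

definition noetherian_ring :: "'a::comm_ring_1 itself \<Rightarrow> bool" where
  "noetherian_ring _ \<longleftrightarrow> (\<forall>f :: nat \<Rightarrow> 'a set. (\<forall>n. ideal (f n)) \<and> incseq f \<longrightarrow>
      (\<exists>N. \<forall>n\<ge>N. f n = f N))"

definition reduced_ring :: "'a::comm_ring_1 itself \<Rightarrow> bool" where
  "reduced_ring _ \<longleftrightarrow> (\<forall>(x::'a) n. x ^ n = 0 \<longrightarrow> x = 0)"

definition prime_chain_of_length :: "'a::comm_ring_1 itself \<Rightarrow> nat \<Rightarrow> bool" where
  "prime_chain_of_length _ n \<longleftrightarrow> (\<exists>P :: nat \<Rightarrow> 'a set.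
      (\<forall>i\<le>n. prime_ideal (P i)) \<and> (\<forall>i<n. P i \<subset> P (Suc i)))"

definition krull_dim_eq :: "'a::comm_ring_1 itself \<Rightarrow> nat \<Rightarrow> bool" where
  "krull_dim_eq T d \<longleftrightarrow> prime_chain_of_length T d \<and> \<not> prime_chain_of_length T (Suc d)"

text \<open>Length of the R-module R/J: supremum of lengths of strict chains of
  submodules of R/J, i.e. of ideals between J and R.\<close>
definition len_quot :: "'a::comm_ring_1 set \<Rightarrow> nat" where
  "len_quot J = Sup {n. \<exists>C :: nat \<Rightarrow> 'a set. C 0 = J \<and> C n = UNIV \<and>
      (\<forall>i\<le>n. ideal (C i)) \<and> (\<forall>i<n. C i \<subset> C (Suc i))}"

definition hs_mult :: "'a::comm_ring_1 set \<Rightarrow> nat \<Rightarrow> real" where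
  "hs_mult m d = lim (\<lambda>n. fact d * real (len_quot (ideal_pow m n)) / real n ^ d)"

definition hk_mult :: "nat \<Rightarrow> 'a::comm_ring_1 set \<Rightarrow> nat \<Rightarrow> real" where
  "hk_mult p I d = lim (\<lambda>e. real (len_quot (frob_pow I (p ^ e))) / real (p ^ e) ^ d)"

definition F_finite :: "nat \<Rightarrow> 'a::comm_ring_1 itself \<Rightarrow> bool" where
  "F_finite p _ \<longleftrightarrow> (\<exists>S :: 'a set. finite S \<and> (\<forall>r. \<exists>c. r = (\<Sum>s\<in>S. c s ^ p * s)))"

text \<open>Free rank a_q of R^{1/q}: identifying R^{1/q} with R carrying the action
  r . x = r^q x, a_q is the largest n such that R^n is a direct summand, i.e.
  there are R-linear maps phi_i : R^{1/q} \<rightarrow> R and elements y_j with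
  phi_i(y_j) = delta_ij (i, j < n).\<close>
definition free_rank_frob :: "nat \<Rightarrow> 'a::comm_ring_1 itself \<Rightarrow> nat" where
  "free_rank_frob q _ = Sup {n. \<exists>(\<phi> :: nat \<Rightarrow> 'a \<Rightarrow> 'a) (y :: nat \<Rightarrow> 'a).
      (\<forall>i<n. (\<forall>a b. \<phi> i (a + b) = \<phi> i a + \<phi> i b) \<and> (\<forall>r x. \<phi> i (r ^ q * x) = r * \<phi> i x)) \<and>
      (\<forall>i<n. \<forall>j<n. \<phi> i (y j) = (if i = j then 1 else 0))}"

text \<open>[k : k^p] for the residue field k = R/m: the maximal number of elements of k
  linearly independent over k^p; alpha(R) = log_p of it.\<close>
definition residue_frob_degree :: "nat \<Rightarrow> 'a::comm_ring_1 set \<Rightarrow> nat" where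
  "residue_frob_degree p m = Sup {n. \<exists>y :: nat \<Rightarrow> 'a. \<forall>c :: nat \<Rightarrow> 'a.
      (\<Sum>i<n. c i ^ p * y i) \<in> m \<longrightarrow> (\<forall>i<n. c i \<in> m)}"

definition alpha_F :: "nat \<Rightarrow> 'a::comm_ring_1 set \<Rightarrow> real" where
  "alpha_F p m = log (real p) (real (residue_frob_degree p m))"

definition F_signature :: "nat \<Rightarrow> 'a::comm_ring_1 set \<Rightarrow> nat \<Rightarrow> real" where
  "F_signature p m d = lim (\<lambda>e. real (free_rank_frob (p ^ e) TYPE('a)) /
      real (p ^ e) powr (real d + alpha_F p m))"

definition sop :: "'a::comm_ring_1 set \<Rightarrow> nat \<Rightarrow> (nat \<Rightarrow> 'a) \<Rightarrow> bool" where
  "sop m d x \<longleftrightarrow> (\<forall>i<d. x i \<in> m) \<and> (\<exists>n. ideal_pow m n \<subseteq> gen_ideal (x ` {..<d}))"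

definition regular_sequence :: "nat \<Rightarrow> (nat \<Rightarrow> 'a::comm_ring_1) \<Rightarrow> bool" where
  "regular_sequence d x \<longleftrightarrow> (\<forall>i<d. \<forall>r. x i * r \<in> gen_ideal (x ` {..<i}) \<longrightarrow>
      r \<in> gen_ideal (x ` {..<i})) \<and> gen_ideal (x ` {..<d}) \<noteq> UNIV"

definition irreducible_ideal :: "'a::comm_ring_1 set \<Rightarrow> bool" where
  "irreducible_ideal Q \<longleftrightarrow> (\<forall>J K. ideal J \<and> ideal K \<and> Q = J \<inter> K \<longrightarrow> J = Q \<or> K = Q)"

text \<open>Gorenstein local ring (of dimension d): Cohen-Macaulay (some system of parameters is a
  regular sequence) with an irreducible parameter ideal; this is the standard
  characterization (R/(x) Artinian Gorenstein, i.e. 1-dimensional socle).\<close>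
definition gorenstein_local :: "'a::comm_ring_1 set \<Rightarrow> nat \<Rightarrow> bool" where
  "gorenstein_local m d \<longleftrightarrow> (\<exists>x. sop m d x \<and> regular_sequence d x \<and>
      irreducible_ideal (gen_ideal (x ` {..<d})))"

definition integral_over_ideal :: "'a::comm_ring_1 set \<Rightarrow> 'a \<Rightarrow> bool" where
  "integral_over_ideal J a \<longleftrightarrow> (\<exists>n\<ge>1. \<exists>c :: nat \<Rightarrow> 'a. (\<forall>i\<in>{1..n}. c i \<in> ideal_pow J i) \<and>
      a ^ n + (\<Sum>i=1..n. c i * a ^ (n - i)) = 0)"

definition minimal_reduction :: "'a::comm_ring_1 set \<Rightarrow> nat \<Rightarrow> (nat \<Rightarrow> 'a) \<Rightarrow> bool" where
  "minimal_reduction m d x \<longleftrightarrow> (\<forall>i<d. x i \<in> m) \<and>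
      (\<forall>a\<in>m. integral_over_ideal (gen_ideal (x ` {..<d})) a)"

definition mu_quot :: "'a::comm_ring_1 set \<Rightarrow> 'a set \<Rightarrow> nat" where
  "mu_quot I J = (LEAST n. \<exists>y :: nat \<Rightarrow> 'a. I = gen_ideal (J \<union> y ` {..<n}))"

definition residue_field_infinite :: "'a::comm_ring_1 set \<Rightarrow> bool" where
  "residue_field_infinite m \<longleftrightarrow> infinite ((\<lambda>r. {s. r - s \<in> m}) ` (UNIV :: 'a set))"

definition residue_field_perfect :: "nat \<Rightarrow> 'a::comm_ring_1 set \<Rightarrow> bool" where
  "residue_field_perfect p m \<longleftrightarrow> (\<forall>a :: 'a. \<exists>b. a - b ^ p \<in> m)"

end

theory Submission
  imports Defs "HOL-Library.Set_Algebras" "HOL-Library.Extended_Nat" "HOL-Library.Function_Algebras"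
begin

text \<open>
  Write \<open>J = (x)\<close>, \<open>e = \<ell>(R/J)\<close>, and let \<open>u\<close> generate the socle of \<open>R/J\<close>. Put
  \<open>I\<^sub>q = (J\<^bsup>[q]\<^esup> : u\<^sup>q)\<close>, \<open>h = \<ell>(R/m\<^bsup>[q]\<^esup>)\<close> and \<open>a = \<ell>(R/I\<^sub>q)\<close>. As \<open>k\<close> is perfect, \<open>F\<^sub>*R\<close> is generated
  by \<open>h\<close> elements, of which all but \<open>a\<close> can be chosen in \<open>I\<^sub>q\<close>. Modulo \<open>J\<^bsup>[q]\<^esup> : I\<^bsup>[q]\<^esup>\<close> every
  generator is killed by \<open>J : I\<close>, and those in \<open>I\<^sub>q\<close> even by \<open>J : mI\<close>. Since \<open>R/J\<close> and \<open>R/J\<^bsup>[q]\<^esup>\<close>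
  are Gorenstein, duality turns this into \<open>\<ell>(I\<^bsup>[q]\<^esup>/J\<^bsup>[q]\<^esup>) \<le> a \<ell>(I/J) + (h - a) \<ell>((J + mI)/J)\<close>;
  together with \<open>\<ell>(R/I\<^bsup>[q]\<^esup>) \<le> h \<ell>(R/I)\<close> and \<open>\<ell>(R/J\<^bsup>[q]\<^esup>) = e q\<^sup>d\<close> this gives
  \<open>e q\<^sup>d \<le> (e - \<mu>) h + \<mu> a\<close>. Now divide by \<open>q\<^sup>d\<close> and let \<open>q\<close> tend to infinity.

  That \<open>a\<close> is the free rank of \<open>F\<^sub>*R\<close> amounts to finding, for every \<open>r \<notin> I\<^sub>q\<close>, an \<open>R\<close>-linear map
  \<open>F\<^sub>*R \<rightarrow> R\<close> taking the value \<open>1\<close> at \<open>r\<close>. Let \<open>J\<^sub>n\<close> be generated by the \<open>n\<close>-th powers of regular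
  generators of \<open>J\<close>, and \<open>u\<^sub>n\<close> the socle of \<open>R/J\<^sub>n\<close>. Then \<open>u\<^sub>n\<^sup>q r \<notin> J\<^sub>n\<^bsup>[q]\<^esup>\<close>, so by
  duality over \<open>R/J\<^sub>n\<close> some linear form on generators of \<open>F\<^sub>*R\<close> kills their relations modulo \<open>J\<^sub>n\<close> and is a
  unit at \<open>r\<close>. By Artin-Rees, for large \<open>n\<close> it is congruent modulo \<open>m\<close> to one killing the relations exactly.

  The limits exist because \<open>F\<^sub>*R\<close> has rank at most \<open>p\<^sup>d\<close> at every minimal prime, whence
  \<open>\<ell>(R/K\<^bsup>[pq]\<^esup>) \<le> p\<^sup>d \<ell>(R/K\<^bsup>[q]\<^esup>) + O(q\<^bsup>d-1\<^esup>)\<close> for every \<open>m\<close>-primary ideal \<open>K\<close>.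
\<close>

section \<open>Submodules and products with ideals\<close>

(* The locale module is globally interpreted by the real vector spaces; a copy keeps the notions
   below out of these interpretations. *)
locale ring_module = module scale
  for scale :: "'a::comm_ring_1 \<Rightarrow> 'b::ab_group_add \<Rightarrow> 'b" (infixr \<open>*s\<close> 75)
begin

lemma span_Un_eq_set_plus: "span (S \<union> T) = span S + span T"
  by (auto simp: span_Un set_plus_def)

lemma span_insert_eq_set_plus: "span (insert a S) = span {a} + span S"
  using span_Un_eq_set_plus[of "{a}" S] by simp

lemma subspace_set_plus:
  assumes "subspace A" "subspace B"
  shows "subspace (A + B)"
  using subspace_span[of "A \<union> B"] assms by (simp only: span_Un_eq_set_plus span_eq_iff[THEN iffD2])

lemma set_plus_least: "subspace C \<Longrightarrow> A \<subseteq> C \<Longrightarrow> B \<subseteq> C \<Longrightarrow> A + B \<subseteq> C"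
  by (auto elim!: set_plus_elim intro: subspace_add)

lemma set_plus_upper_left: "subspace B \<Longrightarrow> A \<subseteq> A + B"
  using set_zero_plus2[of B A] by (simp add: subspace_0 add.commute)

lemma set_plus_upper_right: "subspace A \<Longrightarrow> B \<subseteq> A + B"
  by (simp add: set_zero_plus2 subspace_0)

lemma set_plus_absorb: "subspace A \<Longrightarrow> subspace B \<Longrightarrow> B \<subseteq> A \<Longrightarrow> A + B = A"
  by (simp add: set_plus_least set_plus_upper_left subset_antisym)

lemma set_plus_UNIV [simp]: "subspace A \<Longrightarrow> A + UNIV = UNIV"
  using set_plus_upper_right[of A UNIV] by auto

lemma mem_span_singleton [simp]: "r *s a \<in> span {a}" "a \<in> span {a}"
  by (simp_all add: span_base span_scale)

lemma span_singleton_subset_iff: "subspace C \<Longrightarrow> span {a} \<subseteq> C \<longleftrightarrow> a \<in> C"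
  using span_minimal[of "{a}" C] span_base[of a "{a}"] by auto

lemma mem_plus_span_singleton: "x \<in> B + span {a} \<longleftrightarrow> (\<exists>r. x - r *s a \<in> B)"
proof
  assume "\<exists>r. x - r *s a \<in> B"
  then obtain r where "x - r *s a \<in> B" ..
  then have "(x - r *s a) + r *s a \<in> B + span {a}"
    by (intro set_plus_intro) simp_all
  then show "x \<in> B + span {a}"
    by simp
next
  assume "x \<in> B + span {a}"
  then obtain b r where "x = b + r *s a" "b \<in> B"
    by (auto elim: set_plus_elim simp: span_singleton)
  then show "\<exists>r. x - r *s a \<in> B"
    by (intro exI[of _ r]) simp
qed

lemma psubset_plus_span_singleton:
  assumes "subspace B" "a \<notin> B"
  shows "B \<subset> B + span {a}"
proof
  show "B \<subseteq> B + span {a}"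
    by (rule set_plus_upper_left) simp
  have "a \<in> B + span {a}"
    using set_plus_upper_right[OF assms(1)] mem_span_singleton(2) by blast
  then show "B \<noteq> B + span {a}"
    using assms(2) by blast
qed

lemma plus_span_singleton_subset:
  "subspace C \<Longrightarrow> B \<subseteq> C \<Longrightarrow> a \<in> C \<Longrightarrow> B + span {a} \<subseteq> C"
  by (simp add: set_plus_least span_singleton_subset_iff)

lemma subspace_diff_mem_iff: "subspace A \<Longrightarrow> x - y \<in> A \<Longrightarrow> x \<in> A \<longleftrightarrow> y \<in> A"
  using subspace_add[of A "x - y" y] subspace_diff[of A x "x - y"] by auto

lemma subspace_lincomb:
  "subspace A \<Longrightarrow> x \<in> A \<Longrightarrow> y \<in> A \<Longrightarrow> z = a *s x + b *s y \<Longrightarrow> z \<in> A"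
  by (simp add: subspace_add subspace_scale)

lemma subspace_lincomb3:
  "subspace A \<Longrightarrow> x \<in> A \<Longrightarrow> y \<in> A \<Longrightarrow> w \<in> A \<Longrightarrow> z = a *s x + b *s y + c *s w \<Longrightarrow> z \<in> A"
  by (simp add: subspace_add subspace_scale)

lemma modular_cancel:
  assumes "subspace D" "subspace D'" "D \<subseteq> D'" "0 \<in> C" "D \<inter> C = D' \<inter> C" "D + C = D' + C"
  shows "D = D'"
proof
  show "D' \<subseteq> D"
  proof
    fix x assume x: "x \<in> D'"
    then have "x + 0 \<in> D + C"
      unfolding assms(6) using assms(4) by (rule set_plus_intro)
    then obtain a c where ac: "x = a + c" "a \<in> D" "c \<in> C"
      by (auto elim: set_plus_elim)
    then have "c \<in> D' \<inter> C"
      using subspace_diff[OF assms(2) x, of a] assms(3) by auto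
    then show "x \<in> D"
      using ac assms(1,5) by (auto intro: subspace_add)
  qed
qed (rule assms(3))

definition ideal_scale :: "'a set \<Rightarrow> 'b set \<Rightarrow> 'b set" where
  "ideal_scale I A = span {r *s x | r x. r \<in> I \<and> x \<in> A}"

lemma subspace_ideal_scale [simp]: "subspace (ideal_scale I A)"
  by (simp add: ideal_scale_def)

lemma ideal_scale_mem: "r \<in> I \<Longrightarrow> x \<in> A \<Longrightarrow> r *s x \<in> ideal_scale I A"
  unfolding ideal_scale_def by (rule span_base) blast

lemma ideal_scale_least:
  "subspace C \<Longrightarrow> (\<And>r x. r \<in> I \<Longrightarrow> x \<in> A \<Longrightarrow> r *s x \<in> C) \<Longrightarrow> ideal_scale I A \<subseteq> C"
  unfolding ideal_scale_def by (rule span_minimal) auto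

lemma ideal_scale_subset: "subspace A \<Longrightarrow> ideal_scale I A \<subseteq> A"
  by (rule ideal_scale_least) (auto intro: subspace_scale)

lemma ideal_scale_span_finite:
  assumes I: "ideal I" and S: "finite S" and v: "v \<in> ideal_scale I (span S)"
  obtains c where "\<forall>y\<in>S. c y \<in> I" "v = (\<Sum>y\<in>S. c y *s y)"
proof -
  let ?L = "{\<Sum>y\<in>S. c y *s y | c. \<forall>y\<in>S. c y \<in> I}"
  have "subspace ?L"
  proof (rule subspaceI)
    show "0 \<in> ?L"
      using I by (intro CollectI exI[of _ "\<lambda>_. 0"]) (auto simp: ideal_def)
  next
    fix v w assume "v \<in> ?L" "w \<in> ?L"
    then obtain b c where "v = (\<Sum>y\<in>S. b y *s y)" "\<forall>y\<in>S. b y \<in> I" "w = (\<Sum>y\<in>S. c y *s y)" "\<forall>y\<in>S. c y \<in> I"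
      by blast
    then show "v + w \<in> ?L"
      using I
      by (intro CollectI exI[of _ "\<lambda>y. b y + c y"]) (auto simp: ideal_def scale_left_distrib sum.distrib)
  next
    fix r v assume "v \<in> ?L"
    then obtain c where "v = (\<Sum>y\<in>S. c y *s y)" "\<forall>y\<in>S. c y \<in> I"
      by blast
    then show "r *s v \<in> ?L"
      using I by (intro CollectI exI[of _ "\<lambda>y. r * c y"]) (auto simp: ideal_def scale_sum_right)
  qed
  moreover have "r *s x \<in> ?L" if r: "r \<in> I" and x: "x \<in> span S" for r x
  proof -
    obtain c where "x = (\<Sum>y\<in>S. c y *s y)"
      using x unfolding span_finite[OF S] by blast
    moreover have "\<forall>y\<in>S. r * c y \<in> I"
      using I r by (simp add: ideal_def mult.commute[of r])
    ultimately show ?thesis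
      by (intro CollectI exI[of _ "\<lambda>y. r * c y"]) (simp add: scale_sum_right)
  qed
  ultimately have "ideal_scale I (span S) \<subseteq> ?L"
    by (rule ideal_scale_least)
  then show thesis
    using v that by blast
qed

definition noetherian :: "'b set \<Rightarrow> bool" where
  "noetherian T \<longleftrightarrow> wf {(B, A). subspace A \<and> subspace B \<and> A \<subset> B \<and> B \<subseteq> T}"

lemma noetherian_maximal:
  assumes T: "noetherian T" and "A \<in> F" and F: "\<And>A. A \<in> F \<Longrightarrow> subspace A \<and> A \<subseteq> T"
  obtains M where "M \<in> F" "\<And>B. B \<in> F \<Longrightarrow> \<not> M \<subset> B"
proof (rule wfE_min[OF T[unfolded noetherian_def] assms(2)])
  fix M assume "M \<in> F" "\<And>B. (B, M) \<in> {(B, A). subspace A \<and> subspace B \<and> A \<subset> B \<and> B \<subseteq> T} \<Longrightarrow> B \<notin> F"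
  then show thesis
    using F by (intro that) blast+
qed

lemma noetherian_finitely_generated:
  assumes T: "noetherian T" and N: "subspace N" "N \<subseteq> T"
  obtains S where "finite S" "N = span S"
proof -
  define F where "F = {span S | S. finite S \<and> S \<subseteq> N}"
  have F: "subspace A \<and> A \<subseteq> N" if "A \<in> F" for A
    using that span_minimal[OF _ N(1)] unfolding F_def by blast
  have "span {} \<in> F"
    unfolding F_def by blast
  then obtain M where M: "M \<in> F" "\<And>B. B \<in> F \<Longrightarrow> \<not> M \<subset> B"
    by (rule noetherian_maximal[OF T]) (use F N(2) in blast)+
  then obtain S where S: "finite S" "S \<subseteq> N" "M = span S"
    unfolding F_def by blast
  have "N \<subseteq> span S"
  proof
    fix a assume "a \<in> N"
    then have "span (insert a S) \<in> F"
      using S by (auto simp: F_def)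
    then have "span (insert a S) \<subseteq> span S"
      using M(2) span_mono[of S "insert a S"] unfolding S(3) by blast
    then show "a \<in> span S"
      using span_base[of a "insert a S"] by blast
  qed
  then show thesis
    using S F[OF M(1)] by (intro that[of S]) auto
qed

section \<open>Length\<close>

definition submodule_chain :: "(nat \<Rightarrow> 'b set) \<Rightarrow> nat \<Rightarrow> 'b set \<Rightarrow> 'b set \<Rightarrow> bool" where
  "submodule_chain C n B A \<longleftrightarrow>
    C 0 = B \<and> C n = A \<and> (\<forall>i\<le>n. subspace (C i)) \<and> (\<forall>i<n. C i \<subset> C (Suc i))"

definition len_between :: "'b set \<Rightarrow> 'b set \<Rightarrow> enat" where
  "len_between B A = Sup (enat ` {n. \<exists>C. submodule_chain C n B A})"

lemma submodule_chain_mono: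
  assumes "submodule_chain C n B A" "i \<le> j" "j \<le> n"
  shows "C i \<subseteq> C j"
  using assms(2,3)
proof (induction j rule: dec_induct)
  case (step j)
  have "C j \<subset> C (Suc j)"
    using assms(1) step by (auto simp: submodule_chain_def)
  then show ?case
    using step by auto
qed simp

lemma submodule_chain_bounds: "submodule_chain C n B A \<Longrightarrow> i \<le> n \<Longrightarrow> B \<subseteq> C i \<and> C i \<subseteq> A"
  using submodule_chain_mono[of C n B A 0 i] submodule_chain_mono[of C n B A i n]
  by (auto simp: submodule_chain_def)

lemma submodule_chain_refl: "subspace A \<Longrightarrow> submodule_chain (\<lambda>_. A) 0 A A"
  by (simp add: submodule_chain_def)

lemma submodule_chain_pair:
  "subspace A \<Longrightarrow> subspace B \<Longrightarrow> B \<subset> A \<Longrightarrow> submodule_chain (\<lambda>i. if i = 0 then B else A) 1 B A"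
  by (auto simp: submodule_chain_def)

lemma submodule_chain_exists:
  "subspace A \<Longrightarrow> subspace B \<Longrightarrow> B \<subseteq> A \<Longrightarrow> \<exists>n C. submodule_chain C n B A"
  using submodule_chain_refl[of A] submodule_chain_pair[of A B] by (cases "B = A") fastforce+

lemma submodule_chain_append:
  assumes C: "submodule_chain C n B A" and D: "submodule_chain D k A A'"
  shows "submodule_chain (\<lambda>i. if i \<le> n then C i else D (i - n)) (n + k) B A'"
  unfolding submodule_chain_def
proof (intro conjI allI impI)
  fix i assume i: "i < n + k"
  consider "i < n" | "i = n" | "n < i" by linarith
  then show "(if i \<le> n then C i else D (i - n)) \<subset> (if Suc i \<le> n then C (Suc i) else D (Suc i - n))"
  proof cases
    case 2
    then have "0 < k"
      using i by simp
    then have "D 0 \<subset> D (Suc 0)" "D 0 = C n"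
      using C D unfolding submodule_chain_def by blast+
    then show ?thesis
      using 2 by simp
  next
    case 3
    then show ?thesis
      using D i by (simp add: submodule_chain_def Suc_diff_le)
  qed (use C in \<open>simp add: submodule_chain_def\<close>)
qed (use assms in \<open>auto simp: submodule_chain_def\<close>)

lemma len_between_ge: "submodule_chain C n B A \<Longrightarrow> enat n \<le> len_between B A"
  unfolding len_between_def by (rule Sup_upper) auto

lemma len_between_leI: "(\<And>n C. submodule_chain C n B A \<Longrightarrow> enat n \<le> l) \<Longrightarrow> len_between B A \<le> l"
  unfolding len_between_def by (rule Sup_least) auto

lemma len_between_geE:
  assumes "subspace A" "subspace B" "B \<subseteq> A" "enat n \<le> len_between B A"
  obtains k C where "n \<le> k" "submodule_chain C k B A"
proof (cases n)
  case 0
  then show thesis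
    using submodule_chain_exists[OF assms(1-3)] that by blast
next
  case (Suc m)
  then have "enat m < len_between B A"
    using assms(4) by (simp add: Suc_ile_eq)
  then show thesis
    unfolding len_between_def less_Sup_iff using Suc that by (auto simp: Suc_le_eq)
qed

lemma len_between_attained:
  assumes "subspace A" "subspace B" "B \<subseteq> A" "len_between B A = enat n"
  obtains C where "submodule_chain C n B A"
proof -
  obtain k C where "n \<le> k" and C: "submodule_chain C k B A"
    using len_between_geE[OF assms(1-3), of n] assms(4) by auto
  moreover have "k \<le> n"
    using len_between_ge[OF C] assms(4) by simp
  ultimately show thesis
    using that by simp
qed

lemma len_between_ge_1: "subspace A \<Longrightarrow> subspace B \<Longrightarrow> B \<subset> A \<Longrightarrow> 1 \<le> len_between B A"
  using len_between_ge[OF submodule_chain_pair] by (simp add: one_enat_def)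

lemma len_between_refl: "len_between A A = 0"
proof -
  have "n = 0" if C: "submodule_chain C n A A" for n C
  proof (rule ccontr)
    assume "n \<noteq> 0"
    then have "C 0 \<subset> C (Suc 0)" "C (Suc 0) \<subseteq> A" "C 0 = A"
      using C submodule_chain_bounds[OF C, of "Suc 0"] by (auto simp: submodule_chain_def)
    then show False by auto
  qed
  then have "len_between A A \<le> 0"
    by (intro len_between_leI) (simp add: zero_enat_def)
  then show ?thesis by simp
qed

lemma len_between_eq_0: "subspace A \<Longrightarrow> subspace B \<Longrightarrow> B \<subseteq> A \<Longrightarrow> len_between B A = 0 \<Longrightarrow> B = A"
  using len_between_ge_1[of A B] by auto

lemma (in -) enat_le_addE:
  assumes "enat n \<le> a + b"
  obtains i j where "n \<le> i + j" "enat i \<le> a" "enat j \<le> b"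
proof -
  consider i j where "a = enat i" "b = enat j" | "a = \<infinity>" | "b = \<infinity>"
    by (cases a; cases b)
  then show thesis
  proof cases
    case 1
    then show thesis
      using assms that[of i j] by simp
  next
    case 2
    then show thesis
      using that[of n 0] by (simp add: zero_enat_def[symmetric])
  next
    case 3
    then show thesis
      using that[of 0 n] by (simp add: zero_enat_def[symmetric])
  qed
qed

lemma len_between_superadd:
  assumes sub: "subspace A" "subspace B" "subspace C" and "B \<subseteq> C" "C \<subseteq> A"
  shows "len_between B C + len_between C A \<le> len_between B A"
proof (rule ccontr)
  assume not_le: "\<not> len_between B C + len_between C A \<le> len_between B A"
  then obtain n where n: "len_between B A = enat n"
    by (cases "len_between B A") auto
  then have "enat (Suc n) \<le> len_between B C + len_between C A"
    using not_le by (simp add: Suc_ile_eq)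
  then obtain i j where ij: "Suc n \<le> i + j" "enat i \<le> len_between B C" "enat j \<le> len_between C A"
    by (rule enat_le_addE)
  obtain i' D where D: "i \<le> i'" "submodule_chain D i' B C"
    using len_between_geE[OF _ _ _ ij(2)] assms by blast
  obtain j' E where E: "j \<le> j'" "submodule_chain E j' C A"
    using len_between_geE[OF _ _ _ ij(3)] assms by blast
  have "enat (i' + j') \<le> enat n"
    using len_between_ge[OF submodule_chain_append[OF D(2) E(2)]] n by simp
  then show False
    using ij(1) D(1) E(1) by simp
qed

lemma weak_chain_length_le:
  assumes "\<And>i. i \<le> n \<Longrightarrow> subspace (E i)" "\<And>i. i < n \<Longrightarrow> E i \<subseteq> E (Suc i)"
  shows "enat (card {i. i < n \<and> E i \<noteq> E (Suc i)}) \<le> len_between (E 0) (E n) \<and> E 0 \<subseteq> E n"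
  using assms
proof (induction n)
  case 0
  then show ?case by (simp add: zero_enat_def[symmetric])
next
  case (Suc n)
  let ?jumps = "\<lambda>n. {i. i < n \<and> E i \<noteq> E (Suc i)}"
  have IH: "enat (card (?jumps n)) \<le> len_between (E 0) (E n)" "E 0 \<subseteq> E n"
    using Suc by auto
  have sub: "subspace (E 0)" "subspace (E n)" "subspace (E (Suc n))" "E n \<subseteq> E (Suc n)"
    using Suc.prems by auto
  have "enat (card (?jumps (Suc n))) \<le> enat (card (?jumps n)) + len_between (E n) (E (Suc n))"
  proof (cases "E n = E (Suc n)")
    case True
    then have "?jumps (Suc n) = ?jumps n"
      by (auto simp: less_Suc_eq)
    then show ?thesis by simp
  next
    case False
    then have "?jumps (Suc n) = insert n (?jumps n)"
      by (auto simp: less_Suc_eq)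
    then have "enat (card (?jumps (Suc n))) = enat (card (?jumps n)) + 1"
      by (simp add: one_enat_def)
    then show ?thesis
      using len_between_ge_1[of "E (Suc n)" "E n"] False sub by (auto intro: add_left_mono)
  qed
  also have "\<dots> \<le> len_between (E 0) (E n) + len_between (E n) (E (Suc n))"
    using IH by (simp add: add_right_mono)
  also have "\<dots> \<le> len_between (E 0) (E (Suc n))"
    using sub IH by (intro len_between_superadd)
  finally show ?case
    using IH sub by auto
qed

theorem len_between_add:
  assumes sub: "subspace A" "subspace B" "subspace C" and BC: "B \<subseteq> C" and CA: "C \<subseteq> A"
  shows "len_between B A = len_between B C + len_between C A"
proof (rule antisym)
  show "len_between B A \<le> len_between B C + len_between C A"
  proof (rule len_between_leI)
    fix n D assume D: "submodule_chain D n B A"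
    let ?E = "\<lambda>i. D i \<inter> C" and ?F = "\<lambda>i. D i + C"
    have Dsub: "subspace (D i)" if "i \<le> n" for i
      using D that by (auto simp: submodule_chain_def)
    have Dmono: "D i \<subset> D (Suc i)" if "i < n" for i
      using D that by (auto simp: submodule_chain_def)
    have ends: "?E 0 = B" "?E n = C" "?F 0 = C" "?F n = A"
      using D BC CA sub set_plus_absorb[of C B] set_plus_absorb[of A C]
      by (auto simp: submodule_chain_def add.commute)
    have E: "enat (card {i. i < n \<and> ?E i \<noteq> ?E (Suc i)}) \<le> len_between (?E 0) (?E n)"
      using Dsub Dmono sub by (intro conjunct1[OF weak_chain_length_le]) (auto intro: subspace_inter)
    have F: "enat (card {i. i < n \<and> ?F i \<noteq> ?F (Suc i)}) \<le> len_between (?F 0) (?F n)"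
      using Dsub sub psubset_imp_subset[OF Dmono]
      by (intro conjunct1[OF weak_chain_length_le] subspace_set_plus set_plus_mono2) auto
    have "n \<le> card {i. i < n \<and> ?E i \<noteq> ?E (Suc i)} + card {i. i < n \<and> ?F i \<noteq> ?F (Suc i)}"
    proof -
      have "{..<n} \<subseteq> {i. i < n \<and> ?E i \<noteq> ?E (Suc i)} \<union> {i. i < n \<and> ?F i \<noteq> ?F (Suc i)}"
      proof
        fix i assume "i \<in> {..<n}"
        then have "D i \<noteq> D (Suc i)" "subspace (D i)" "subspace (D (Suc i))" "D i \<subseteq> D (Suc i)" "i < n"
          using Dsub[of i] Dsub[of "Suc i"] Dmono[of i] by auto
        then show "i \<in> {i. i < n \<and> ?E i \<noteq> ?E (Suc i)} \<union> {i. i < n \<and> ?F i \<noteq> ?F (Suc i)}"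
          using modular_cancel[of "D i" "D (Suc i)" C] subspace_0[OF sub(3)] by blast
      qed
      then have "card {..<n} \<le> card ({i. i < n \<and> ?E i \<noteq> ?E (Suc i)} \<union> {i. i < n \<and> ?F i \<noteq> ?F (Suc i)})"
        by (intro card_mono) auto
      then show ?thesis
        using order_trans[OF _ card_Un_le] by simp
    qed
    then have "enat n \<le> enat (card {i. i < n \<and> ?E i \<noteq> ?E (Suc i)}) + enat (card {i. i < n \<and> ?F i \<noteq> ?F (Suc i)})"
      by simp
    also have "\<dots> \<le> len_between B C + len_between C A"
      using add_mono[OF E F] unfolding ends .
    finally show "enat n \<le> len_between B C + len_between C A" .
  qed
qed (rule len_between_superadd[OF assms])

lemma len_between_mono:
  assumes "subspace A" "subspace B" "subspace A'" "subspace B'" "B \<subseteq> B'" "B' \<subseteq> A'" "A' \<subseteq> A"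
  shows "len_between B' A' \<le> len_between B A"
proof -
  have "len_between B A = len_between B B' + (len_between B' A' + len_between A' A)"
    using len_between_add[of A B B'] len_between_add[of A B' A'] assms by auto
  then show ?thesis
    by (simp add: add_increasing add_increasing2)
qed

lemma len_between_cancel:
  assumes "subspace A" "subspace B" "subspace C" "A \<subseteq> B" "B \<subseteq> C"
    and "len_between A C = len_between B C" "len_between B C \<noteq> \<infinity>"
  shows "A = B"
proof (rule len_between_eq_0)
  have "len_between A B + len_between B C = len_between B C"
    using len_between_add[of C A B] assms by simp
  then show "len_between A B = 0"
    using assms(7) by (cases "len_between A B"; cases "len_between B C") (auto simp: zero_enat_def)
qed (rule assms)+

lemma finite_length_dcc:
  assumes "subspace T" "subspace Q" "len_between Q T \<noteq> \<infinity>"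
    and D: "\<And>n. subspace (D n)" "\<And>n. Q \<subseteq> D n" "\<And>n. D n \<subseteq> T" "\<And>n. D (Suc n) \<subseteq> D n"
  shows "\<exists>n. D (Suc n) = D n"
proof (rule ccontr)
  assume "\<nexists>n. D (Suc n) = D n"
  then have strict: "D (Suc n) \<subset> D n" for n
    using D(4)[of n] by auto
  obtain k where k: "len_between Q T = enat k"
    using assms(3) by auto
  have "submodule_chain (\<lambda>i. D (Suc k - i)) (Suc k) (D (Suc k)) (D 0)"
    unfolding submodule_chain_def using strict D(1) by (auto simp: Suc_diff_le)
  then have "enat (Suc k) \<le> len_between (D (Suc k)) (D 0)"
    by (rule len_between_ge)
  also have "\<dots> \<le> len_between Q T"
    using lift_Suc_antimono_le[of D, OF D(4), of 0 "Suc k"] by (intro len_between_mono assms D) simp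
  finally show False
    using k by simp
qed

end

locale ring_module_pair = m1: ring_module s1 + m2: ring_module s2
  for s1 :: "'a::comm_ring_1 \<Rightarrow> 'b::ab_group_add \<Rightarrow> 'b" and s2 :: "'c::comm_ring_1 \<Rightarrow> 'd::ab_group_add \<Rightarrow> 'd"
begin

lemma len_between_map_le:
  assumes sub: "\<And>D. m1.subspace D \<Longrightarrow> B \<subseteq> D \<Longrightarrow> D \<subseteq> A \<Longrightarrow> m2.subspace (f D)"
    and strict: "\<And>D E. m1.subspace D \<Longrightarrow> m1.subspace E \<Longrightarrow> B \<subseteq> D \<Longrightarrow> E \<subseteq> A \<Longrightarrow> D \<subset> E \<Longrightarrow> f D \<subset> f E"
  shows "m1.len_between B A \<le> m2.len_between (f B) (f A)"
proof (rule m1.len_between_leI)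
  fix n C assume C: "m1.submodule_chain C n B A"
  have "m2.submodule_chain (\<lambda>i. f (C i)) n (f B) (f A)"
    unfolding m2.submodule_chain_def
  proof (intro conjI allI impI)
    fix i assume "i \<le> n"
    then show "m2.subspace (f (C i))"
      using m1.submodule_chain_bounds[OF C] C by (intro sub) (auto simp: m1.submodule_chain_def)
  next
    fix i assume "i < n"
    then show "f (C i) \<subset> f (C (Suc i))"
      using m1.submodule_chain_bounds[OF C, of i] m1.submodule_chain_bounds[OF C, of "Suc i"] C
      by (intro strict) (auto simp: m1.submodule_chain_def)
  qed (use C in \<open>auto simp: m1.submodule_chain_def\<close>)
  then show "enat n \<le> m2.len_between (f B) (f A)"
    by (rule m2.len_between_ge)
qed

end

section \<open>Ideals\<close>

lemma ring_module_times: "ring_module ((*) :: 'a::comm_ring_1 \<Rightarrow> 'a \<Rightarrow> 'a)"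
  by standard (simp_all add: algebra_simps)

lemma subspace_times_eq_ideal: "module.subspace (*) = (ideal :: 'a::comm_ring_1 set \<Rightarrow> bool)"
  by (auto simp: fun_eq_iff module.subspace_def[OF ring_module.axioms[OF ring_module_times]] ideal_def)

lemma span_times_eq_gen_ideal: "module.span (*) = (gen_ideal :: 'a::comm_ring_1 set \<Rightarrow> 'a set)"
  by (simp add: fun_eq_iff module.span_def[OF ring_module.axioms[OF ring_module_times]] hull_def
      gen_ideal_def subspace_times_eq_ideal conj_commute)

lemma ideal_scale_times_eq_ideal_mult:
  "ring_module.ideal_scale (*) = (ideal_mult :: 'a::comm_ring_1 set \<Rightarrow> 'a set \<Rightarrow> 'a set)"
  by (simp add: fun_eq_iff ring_module.ideal_scale_def[OF ring_module_times] ideal_mult_def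
      span_times_eq_gen_ideal)

lemmas regular_module_eqs =
  subspace_times_eq_ideal span_times_eq_gen_ideal ideal_scale_times_eq_ideal_mult

interpretation R: ring_module "(*) :: 'a::comm_ring_1 \<Rightarrow> 'a \<Rightarrow> 'a"
  rewrites "module.subspace (*) = (ideal :: 'a set \<Rightarrow> bool)"
    and "module.span (*) = (gen_ideal :: 'a set \<Rightarrow> 'a set)"
    and "ring_module.ideal_scale (*) = (ideal_mult :: 'a set \<Rightarrow> 'a set \<Rightarrow> 'a set)"
  by (fact ring_module_times regular_module_eqs)+

declare R.scale_scale [simp del]

abbreviation colength :: "'a::comm_ring_1 set \<Rightarrow> enat" where
  "colength Q \<equiv> R.len_between Q UNIV"

lemma ideal_mult_right: "ideal I \<Longrightarrow> a \<in> I \<Longrightarrow> a * r \<in> I"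
  using R.subspace_scale[of I a r] by (simp add: mult.commute)

lemma finite_eq_image_lessThan_card: "finite S \<Longrightarrow> \<exists>f. f ` {..<card S} = S"
  using ex_bij_betw_nat_finite[of S] by (auto simp: lessThan_atLeast0 bij_betw_def)

lemma ideal_eq_UNIV_iff: "ideal I \<Longrightarrow> I = UNIV \<longleftrightarrow> 1 \<in> I"
  using R.subspace_scale[of I 1] by auto

lemma prime_idealD:
  assumes "prime_ideal P"
  shows "ideal P" "1 \<notin> P" "a * b \<in> P \<Longrightarrow> a \<in> P \<or> b \<in> P"
  using assms ideal_eq_UNIV_iff[of P] unfolding prime_ideal_def by blast+

lemma prime_ideal_prod_notin:
  assumes "prime_ideal P" "\<And>s. s \<in> A \<Longrightarrow> c s \<notin> P"
  shows "prod c A \<notin> P"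
  using assms(2)
proof (induction A rule: infinite_finite_induct)
  case (insert s A)
  then show ?case
    using prime_idealD(3)[OF assms(1), of "c s" "prod c A"] by auto
qed (simp_all add: prime_idealD(2)[OF assms(1)])

lemma ideal_power_mono: "ideal I \<Longrightarrow> a ^ n \<in> I \<Longrightarrow> n \<le> k \<Longrightarrow> a ^ k \<in> I"
  using R.subspace_scale[of I "a ^ n" "a ^ (k - n)"] by (simp add: power_add[symmetric])

lemma ideal_power_diff:
  assumes "ideal I" "a - b \<in> I"
  shows "a ^ k - b ^ k \<in> I"
proof (induction k)
  case 0
  then show ?case using assms(1) by (simp add: R.subspace_0)
next
  case (Suc k)
  have "a ^ Suc k - b ^ Suc k = a * (a ^ k - b ^ k) + b ^ k * (a - b)"
    by (simp add: algebra_simps)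
  then show ?case
    using R.subspace_lincomb[OF assms(1) Suc assms(2)] by blast
qed

lemma finite_common_power:
  assumes "ideal I" "finite S" "\<And>x. x \<in> S \<Longrightarrow> \<exists>n. x ^ n \<in> I"
  obtains n where "\<And>x. x \<in> S \<Longrightarrow> x ^ n \<in> I"
proof -
  obtain k where k: "\<And>x. x \<in> S \<Longrightarrow> x ^ k x \<in> I"
    using assms(3) by metis
  show thesis
  proof
    show "x ^ sum k S \<in> I" if "x \<in> S" for x
      using ideal_power_mono[OF assms(1) k[OF that]] member_le_sum[of x S k] that assms(2) by simp
  qed
qed

lemma gen_ideal_1 [simp]: "gen_ideal {1} = UNIV"
  by (simp add: ideal_eq_UNIV_iff)

lemma gen_ideal_eq_UNIV_if_unit: "s * c = 1 \<Longrightarrow> gen_ideal {c} = UNIV"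
  using R.mem_span_singleton(1)[of s c] by (simp add: ideal_eq_UNIV_iff)

lemma gen_ideal_singleton_mono: "gen_ideal {r * a} \<subseteq> gen_ideal {a}"
  by (simp add: R.span_singleton_subset_iff)

lemma len_quot_eq_colength:
  assumes "ideal J" "colength J \<noteq> \<infinity>"
  shows "enat (len_quot J) = colength J"
proof -
  obtain n where n: "colength J = enat n"
    using assms(2) by auto
  obtain C where C: "R.submodule_chain C n J UNIV"
    using R.len_between_attained[OF _ assms(1) _ n] by auto
  have "len_quot J = Sup {n. \<exists>C. R.submodule_chain C n J UNIV}"
    by (simp add: len_quot_def R.submodule_chain_def)
  also have "\<dots> = n"
    using C R.len_between_ge[of _ _ J UNIV] n by (intro cSup_eq_maximum) auto
  finally show ?thesis
    using n by simp
qed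

context ring_module
begin

lemma ideal_colon: "subspace B \<Longrightarrow> ideal {r. r *s a \<in> B}"
  unfolding ideal_def
  by (auto simp: subspace_0 subspace_add subspace_scale scale_left_distrib simp flip: scale_scale)

lemma subspace_image_scale: "ideal I \<Longrightarrow> subspace ((\<lambda>r. r *s a) ` I)"
proof (rule subspaceI)
  assume I: "ideal I"
  show "0 \<in> (\<lambda>r. r *s a) ` I"
    using R.subspace_0[OF I] by (intro image_eqI[of _ _ 0]) auto
  show "x + y \<in> (\<lambda>r. r *s a) ` I" if "x \<in> (\<lambda>r. r *s a) ` I" "y \<in> (\<lambda>r. r *s a) ` I" for x y
    using that R.subspace_add[OF I] by (auto simp flip: scale_left_distrib)
  show "c *s x \<in> (\<lambda>r. r *s a) ` I" if "x \<in> (\<lambda>r. r *s a) ` I" for c x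
    using that R.subspace_scale[OF I] by auto
qed

lemma len_between_plus_span_singleton_le:
  assumes B: "subspace B"
  shows "len_between B (B + span {a}) \<le> colength {r. r *s a \<in> B}"
proof -
  interpret to_ring: ring_module_pair scale "(*)"
    by (intro ring_module_pair.intro ring_module_axioms ring_module_times)
  let ?f = "\<lambda>D. {r. r *s a \<in> D}"
  have "len_between B (B + span {a}) \<le> R.len_between (?f B) (?f (B + span {a}))"
  proof (rule to_ring.len_between_map_le, unfold subspace_times_eq_ideal)
    fix D E assume DE: "subspace D" "subspace E" "B \<subseteq> D" "E \<subseteq> B + span {a}" "D \<subset> E"
    then obtain x where x: "x \<in> E" "x \<notin> D"
      by blast
    then obtain r where r: "x - r *s a \<in> B"
      using DE(4) mem_plus_span_singleton by blast
    then have "r *s a \<in> E \<and> r *s a \<notin> D"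
      using x DE subspace_diff_mem_iff[of E x "r *s a"] subspace_diff_mem_iff[of D x "r *s a"] by blast
    then show "?f D \<subset> ?f E"
      using DE(5) by blast
  qed (rule ideal_colon)
  moreover have "r *s a \<in> B + span {a}" for r
    using set_plus_upper_right[OF B] mem_span_singleton(1) by blast
  ultimately show ?thesis
    by simp
qed

lemma len_between_plus_span_singleton_ge:
  assumes B: "subspace B"
  shows "colength {r. r *s a \<in> B} \<le> len_between B (B + span {a})"
proof -
  interpret from_ring: ring_module_pair "(*)" scale
    by (intro ring_module_pair.intro ring_module_axioms ring_module_times)
  let ?C = "{r. r *s a \<in> B}" and ?g = "\<lambda>I. B + (\<lambda>r. r *s a) ` I"
  have "colength ?C \<le> len_between (?g ?C) (?g UNIV)"
  proof (rule from_ring.len_between_map_le, unfold subspace_times_eq_ideal)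
    fix D E assume DE: "ideal D" "ideal E" "?C \<subseteq> D" "D \<subset> E"
    then obtain r where r: "r \<in> E" "r \<notin> D"
      by blast
    have "0 + r *s a \<in> ?g E"
      using subspace_0[OF B] r(1) by (intro set_plus_intro) auto
    moreover have "r *s a \<notin> ?g D"
    proof
      assume "r *s a \<in> ?g D"
      then obtain b t where "r *s a = b + t *s a" "b \<in> B" "t \<in> D"
        by (auto elim!: set_plus_elim)
      then have "(r - t) *s a \<in> B"
        by (simp add: scale_left_diff_distrib)
      then show False
        using DE(1,3) r(2) \<open>t \<in> D\<close> R.subspace_diff_mem_iff[of D r t] by blast
    qed
    moreover have "?g D \<subseteq> ?g E"
      using DE(4) by (intro set_plus_mono2) auto
    ultimately show "?g D \<subset> ?g E"
      by auto
  qed (intro subspace_set_plus B subspace_image_scale)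
  moreover have "?g ?C = B"
    using B by (intro set_plus_absorb subspace_image_scale ideal_colon) auto
  ultimately show ?thesis
    by (simp add: span_singleton)
qed

theorem len_between_plus_span_singleton:
  "subspace B \<Longrightarrow> len_between B (B + span {a}) = colength {r. r *s a \<in> B}"
  by (intro antisym len_between_plus_span_singleton_le len_between_plus_span_singleton_ge)

corollary len_between_plus_span_le:
  assumes S: "finite S" and B: "subspace B" and Q: "ideal Q"
    and kill: "\<And>a r. a \<in> S \<Longrightarrow> r \<in> Q \<Longrightarrow> r *s a \<in> B"
  shows "len_between B (B + span S) \<le> enat (card S) * colength Q"
  using S B kill
proof (induction S arbitrary: B rule: finite_induct)
  case empty
  then show ?case
    by (simp add: len_between_refl zero_enat_def[symmetric])
next
  case (insert a S)
  let ?B = "B + span {a}"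
  have B': "subspace ?B" "B \<subseteq> ?B" "?B \<subseteq> ?B + span S"
    using insert.prems(1) by (simp_all add: subspace_set_plus set_plus_upper_left)
  have "len_between B (?B + span S) = len_between B ?B + len_between ?B (?B + span S)"
    using insert.prems(1) B' by (intro len_between_add subspace_set_plus) auto
  moreover have "len_between B ?B \<le> colength Q"
    unfolding len_between_plus_span_singleton[OF insert.prems(1)]
    using insert.prems Q by (intro R.len_between_mono ideal_colon) auto
  moreover have "len_between ?B (?B + span S) \<le> enat (card S) * colength Q"
    using insert.prems B' by (intro insert.IH) auto
  moreover have "enat (card (insert a S)) * colength Q = colength Q + enat (card S) * colength Q"
    using insert.hyps by (simp add: eSuc_enat[symmetric] mult_eSuc)
  moreover have "B + span (insert a S) = ?B + span S"
    using span_insert_eq_set_plus[of a S] by (simp only: add.assoc)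
  ultimately show ?case
    by (simp only: add_mono)
qed

end

section \<open>Powers and products of ideals\<close>

lemma ideal_mult_mono: "I \<subseteq> I' \<Longrightarrow> J \<subseteq> J' \<Longrightarrow> ideal_mult I J \<subseteq> ideal_mult I' J'"
  by (intro R.ideal_scale_least R.subspace_ideal_scale) (auto intro: R.ideal_scale_mem)

lemma ideal_ideal_pow [simp]: "ideal (ideal_pow I n)"
  by (cases n) simp_all

lemma ideal_pow_mono: "I \<subseteq> J \<Longrightarrow> ideal_pow I n \<subseteq> ideal_pow J n"
  by (induction n) (simp_all add: ideal_mult_mono)

lemma ideal_pow_antimono: "k \<le> n \<Longrightarrow> ideal_pow I n \<subseteq> ideal_pow I k"
  by (rule lift_Suc_antimono_le[of "ideal_pow I"]) (simp_all add: R.ideal_scale_subset)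

lemma ideal_pow_1: "ideal J \<Longrightarrow> ideal_pow J (Suc 0) = J"
proof -
  assume J: "ideal J"
  have "ideal_mult J UNIV \<subseteq> J"
    using J by (intro R.ideal_scale_least) (simp_all add: ideal_mult_right)
  moreover have "J \<subseteq> ideal_mult J UNIV"
    using R.ideal_scale_mem[of _ J 1 UNIV] by auto
  ultimately show ?thesis
    by simp
qed

lemma ideal_pow_zero: "ideal_pow {0} (Suc n) = {0}"
proof -
  have "ideal_mult {0} (ideal_pow {0} n) \<subseteq> {0}"
    by (rule R.ideal_scale_least) auto
  then show ?thesis
    using R.subspace_0[OF R.subspace_ideal_scale] by auto
qed

lemma power_mem_ideal_pow: "a \<in> I \<Longrightarrow> a ^ n \<in> ideal_pow I n"
  by (induction n) (simp_all add: R.ideal_scale_mem)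

lemma mult_mem_ideal_pow_Suc: "a \<in> I \<Longrightarrow> b \<in> ideal_pow I n \<Longrightarrow> a * b \<in> ideal_pow I (Suc n)"
  by (simp add: R.ideal_scale_mem)

lemma mult_mem_ideal_pow_add:
  "a \<in> ideal_pow I i \<Longrightarrow> b \<in> ideal_pow I j \<Longrightarrow> a * b \<in> ideal_pow I (i + j)"
proof (induction i arbitrary: a)
  case 0
  then show ?case
    by (simp add: R.subspace_scale)
next
  case (Suc i)
  have "ideal_mult I (ideal_pow I i) \<subseteq> {r. r * b \<in> ideal_pow I (Suc i + j)}"
  proof (rule R.ideal_scale_least)
    fix r x assume "r \<in> I" "x \<in> ideal_pow I i"
    then have "r * (x * b) \<in> ideal_pow I (Suc (i + j))"
      by (intro mult_mem_ideal_pow_Suc Suc.IH Suc.prems(2))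
    then show "r * x \<in> {r. r * b \<in> ideal_pow I (Suc i + j)}"
      by (simp add: mult.assoc)
  qed (intro R.ideal_colon ideal_ideal_pow)
  then show ?case
    using Suc.prems(1) by auto
qed

section \<open>Noetherian local rings\<close>

locale noetherian_local =
  fixes m :: "'a::comm_ring_1 set"
  assumes local_ring: "local_ring m" and noetherian_ring: "noetherian_ring TYPE('a)"
begin

lemma noetherian_UNIV: "R.noetherian (UNIV :: 'a set)"
  unfolding R.noetherian_def wf_iff_no_infinite_down_chain
proof
  assume "\<exists>f. \<forall>i. (f (Suc i), f i) \<in> {(B, A). ideal A \<and> ideal B \<and> A \<subset> B \<and> B \<subseteq> (UNIV :: 'a set)}"
  then obtain f :: "nat \<Rightarrow> 'a set"
    where "\<forall>i. (f (Suc i), f i) \<in> {(B, A). ideal A \<and> ideal B \<and> A \<subset> B \<and> B \<subseteq> UNIV}" ..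
  then have f: "ideal (f i)" "f i \<subset> f (Suc i)" for i
    by simp_all
  then have "incseq f"
    by (intro incseq_SucI psubset_imp_subset)
  moreover have "(\<forall>n. ideal (f n)) \<and> incseq f \<longrightarrow> (\<exists>N. \<forall>n\<ge>N. f n = f N)"
    using noetherian_ring unfolding noetherian_ring_def by (rule spec)
  ultimately obtain N where "\<forall>n\<ge>N. f n = f N"
    using f(1) by auto
  then have "f (Suc N) = f N"
    by (metis le_SucI order_refl)
  then show False
    using f(2)[of N] by simp
qed

lemmas ideal_family_maximal = R.noetherian_maximal[OF noetherian_UNIV]

lemma ideal_finitely_generated:
  fixes I :: "'a set"
  assumes "ideal I"
  obtains S where "finite S" "I = gen_ideal S"
  using R.noetherian_finitely_generated[OF noetherian_UNIV assms] by blast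

lemma ideal_noetherian_induct [consumes 1, case_names larger]:
  fixes Y :: "'a set"
  assumes "ideal Y" and "\<And>Y. ideal Y \<Longrightarrow> (\<And>Z. ideal Z \<Longrightarrow> Y \<subset> Z \<Longrightarrow> P Z) \<Longrightarrow> P Y"
  shows "P Y"
  using assms(1)
  by (induction Y rule: wf_induct_rule[OF noetherian_UNIV[unfolded R.noetherian_def]]) (use assms(2) in auto)

lemma maximal_m: "maximal_ideal m"
  using local_ring by (simp add: local_ring_def)

lemma ideal_m [simp]: "ideal m"
  using maximal_m by (simp add: maximal_ideal_def)

lemma one_notin_m [simp]: "1 \<notin> m"
  using maximal_m ideal_eq_UNIV_iff[OF ideal_m] by (simp add: maximal_ideal_def)

lemma proper_ideal_subset_m:
  assumes "ideal I" "I \<noteq> UNIV"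
  shows "I \<subseteq> m"
proof -
  let ?F = "{A. ideal A \<and> A \<noteq> UNIV \<and> I \<subseteq> A}"
  have "I \<in> ?F"
    using assms by simp
  then obtain M where M: "M \<in> ?F" "\<And>B. B \<in> ?F \<Longrightarrow> \<not> M \<subset> B"
    by (rule ideal_family_maximal) auto
  then have "maximal_ideal M"
    unfolding maximal_ideal_def by blast
  then show ?thesis
    using local_ring M(1) unfolding local_ring_def by blast
qed

lemma unit_inverse:
  assumes "r \<notin> m"
  obtains s where "s * r = 1"
proof -
  have "gen_ideal {r} = UNIV"
    using assms proper_ideal_subset_m[of "gen_ideal {r}"] by (auto simp: R.span_singleton_subset_iff)
  then have "1 \<in> range (\<lambda>s. s * r)"
    by (simp add: R.span_singleton)
  then show thesis
    using that by (metis imageE)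
qed

lemma unit_mult_mem:
  assumes "ideal I" "r \<notin> m" "r * a \<in> I"
  shows "a \<in> I"
proof -
  obtain s where "s * r = 1"
    using unit_inverse[OF assms(2)] .
  then have "a = s * (r * a)"
    by (simp add: mult.assoc[symmetric])
  then show ?thesis
    using R.subspace_scale[OF assms(1,3), of s] by simp
qed

lemma one_minus_notin_m: "r \<in> m \<Longrightarrow> 1 - r \<notin> m"
  using R.subspace_add[OF ideal_m, of "1 - r" r] by auto

lemma prime_m: "a * b \<in> m \<Longrightarrow> a \<in> m \<or> b \<in> m"
  using unit_mult_mem[OF ideal_m] by blast

lemma power_mem_mD: "a ^ n \<in> m \<Longrightarrow> a \<in> m"
  by (induction n) (use prime_m in auto)

lemma power_mem_m: "a \<in> m \<Longrightarrow> 0 < n \<Longrightarrow> a ^ n \<in> m"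
  using ideal_power_mono[OF ideal_m, of a 1 n] by simp

lemma colength_m: "colength m = 1"
proof (rule antisym)
  show "colength m \<le> 1"
  proof (rule R.len_between_leI, rule ccontr)
    fix n C assume C: "R.submodule_chain C n m UNIV" and "\<not> enat n \<le> 1"
    then have "1 < n"
      by (simp add: one_enat_def)
    then have "m \<subset> C 1" "C 1 \<subset> C (Suc 1)" "ideal (C 1)"
      using C by (auto simp: R.submodule_chain_def)
    then show False
      using maximal_m unfolding maximal_ideal_def by auto
  qed
  show "1 \<le> colength m"
    using ideal_eq_UNIV_iff[OF ideal_m] by (intro R.len_between_ge_1) auto
qed

lemma colength_le_1_imp_m_subset:
  assumes "ideal Q" "colength Q \<le> 1"
  shows "m \<subseteq> Q"
proof (cases "Q = UNIV")
  case False
  then have Qm: "Q \<subseteq> m"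
    using proper_ideal_subset_m assms(1) by blast
  then have "colength Q = R.len_between Q m + 1"
    using R.len_between_add[of UNIV Q m] assms(1) by (simp add: colength_m)
  then have "R.len_between Q m = 0"
    using assms(2) by (cases "R.len_between Q m") (auto simp: one_enat_def zero_enat_def)
  then show ?thesis
    using R.len_between_eq_0[OF ideal_m assms(1) Qm] by simp
qed simp

end

locale local_module = noetherian_local m + ring_module scale
  for m :: "'a::comm_ring_1 set" and scale :: "'a \<Rightarrow> 'b::ab_group_add \<Rightarrow> 'b" (infixr "*s" 75)
begin

lemma mem_if_diff_scale_mem:
  assumes N: "subspace N" and t: "t \<in> m" and z: "z - t *s z \<in> N"
  shows "z \<in> N"
proof -
  obtain w where "w * (1 - t) = 1"
    using one_minus_notin_m[OF t] by (rule unit_inverse)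
  then have "w *s (1 - t) *s z = z"
    by simp
  moreover have "(1 - t) *s z = z - t *s z"
    by (simp add: scale_left_diff_distrib)
  ultimately show ?thesis
    using subspace_scale[OF N z, of w] by simp
qed

lemma nakayama_finite:
  assumes "finite S" "subspace N"
    and "\<forall>x\<in>S. \<exists>c. (\<forall>y\<in>S. c y \<in> m) \<and> x - (\<Sum>y\<in>S. c y *s y) \<in> N"
  shows "S \<subseteq> N"
  using assms
proof (induction S arbitrary: N rule: finite_induct)
  case (insert z S)
  let ?N = "N + span {z}"
  have "S \<subseteq> ?N"
  proof (rule insert.IH)
    show "subspace ?N"
      using insert.prems(1) by (simp add: subspace_set_plus)
    show "\<forall>x\<in>S. \<exists>c. (\<forall>y\<in>S. c y \<in> m) \<and> x - (\<Sum>y\<in>S. c y *s y) \<in> ?N"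
    proof
      fix x assume "x \<in> S"
      then obtain c where c: "\<forall>y\<in>insert z S. c y \<in> m" "x - (\<Sum>y\<in>insert z S. c y *s y) \<in> N"
        using insert.prems(2) by blast
      then have "(x - (\<Sum>y\<in>S. c y *s y)) - c z *s z \<in> N"
        using insert.hyps by (simp add: algebra_simps)
      then show "\<exists>c. (\<forall>y\<in>S. c y \<in> m) \<and> x - (\<Sum>y\<in>S. c y *s y) \<in> ?N"
        using c(1) mem_plus_span_singleton by blast
    qed
  qed
  then have "\<forall>y\<in>S. \<exists>b. y - b *s z \<in> N"
    using mem_plus_span_singleton by blast
  then obtain b where b: "\<And>y. y \<in> S \<Longrightarrow> y - b y *s z \<in> N"
    by metis
  obtain c where c: "\<forall>y\<in>insert z S. c y \<in> m" "z - (\<Sum>y\<in>insert z S. c y *s y) \<in> N"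
    using insert.prems(2) by blast
  define t where "t = c z + (\<Sum>y\<in>S. c y * b y)"
  have "z - t *s z = (z - (\<Sum>y\<in>insert z S. c y *s y)) + (\<Sum>y\<in>S. c y *s (y - b y *s z))"
    using insert.hyps
    by (simp add: t_def scale_left_distrib scale_sum_left scale_right_diff_distrib sum_subtractf)
  also have "\<dots> \<in> N"
    using insert.prems(1) c(2) b by (intro subspace_add subspace_sum subspace_scale)
  finally have "z - t *s z \<in> N" .
  moreover have "t \<in> m"
    unfolding t_def using c(1) by (intro R.subspace_add R.subspace_sum ideal_mult_right ideal_m) auto
  ultimately have "z \<in> N"
    using mem_if_diff_scale_mem[OF insert.prems(1)] by blast
  then have "?N = N"
    using insert.prems(1) by (intro set_plus_absorb) (simp_all add: span_singleton_subset_iff)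
  then show ?case
    using \<open>z \<in> N\<close> \<open>S \<subseteq> ?N\<close> by simp
qed simp

theorem nakayama:
  assumes S: "finite S" and N: "subspace N" and "span S \<subseteq> N + ideal_scale m (span S)"
  shows "span S \<subseteq> N"
proof -
  have "\<exists>c. (\<forall>y\<in>S. c y \<in> m) \<and> x - (\<Sum>y\<in>S. c y *s y) \<in> N" if x: "x \<in> S" for x
  proof -
    have "x \<in> N + ideal_scale m (span S)"
      using assms(3) span_base[OF x] by blast
    then obtain n v where nv: "x = n + v" "n \<in> N" "v \<in> ideal_scale m (span S)"
      by (rule set_plus_elim)
    then obtain c where "\<forall>y\<in>S. c y \<in> m" "v = (\<Sum>y\<in>S. c y *s y)"
      by (auto elim: ideal_scale_span_finite[OF ideal_m S])
    then show ?thesis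
      using nv by (intro exI[of _ c]) simp
  qed
  then show ?thesis
    using nakayama_finite[OF S N] span_minimal[OF _ N] by blast
qed

lemma len_between_plus_span_le_1:
  assumes "subspace B" "\<And>r. r \<in> m \<Longrightarrow> r *s a \<in> B"
  shows "len_between B (B + span {a}) \<le> 1"
  using len_between_plus_span_le[of "{a}" B m] assms by (simp add: colength_m one_enat_def)

lemma simple_extension_exists:
  assumes sub: "subspace A" "subspace B" "B \<subseteq> A" and len: "len_between B A = enat (Suc n)"
  obtains a where "a \<in> A" "a \<notin> B" "\<And>r. r \<in> m \<Longrightarrow> r *s a \<in> B" "len_between (B + span {a}) A = enat n"
proof -
  obtain C where C: "submodule_chain C (Suc n) B A"
    using len_between_attained[OF assms] .
  have C1: "subspace (C 1)" "B \<subset> C 1" "C 1 \<subseteq> A"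
    using C submodule_chain_bounds[OF C, of 1] by (auto simp: submodule_chain_def)
  then obtain a where a: "a \<in> C 1" "a \<notin> B"
    by auto
  let ?B = "B + span {a}"
  have B': "subspace ?B" "B \<subset> ?B" "?B \<subseteq> C 1"
    using sub a C1 psubset_plus_span_singleton[of B a] plus_span_singleton_subset[of "C 1" B a]
    by (auto intro: subspace_set_plus)
  have "submodule_chain (\<lambda>i. C (Suc i)) n (C 1) A"
    using C by (auto simp: submodule_chain_def)
  then have "enat n \<le> len_between (C 1) A"
    by (rule len_between_ge)
  also have "\<dots> \<le> len_between ?B A"
    using B' C1 sub by (intro len_between_mono) auto
  finally have upper: "enat n \<le> len_between ?B A" .
  have lower: "1 \<le> len_between B ?B"
    using B' sub by (intro len_between_ge_1) auto
  have "enat (Suc n) = len_between B ?B + len_between ?B A"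
    using len_between_add[of A B ?B] B' C1 sub len by auto
  then have lengths: "len_between ?B A = enat n \<and> len_between B ?B = 1"
    using upper lower
    by (cases "len_between B ?B"; cases "len_between ?B A") (auto simp: one_enat_def)
  then have "m \<subseteq> {r. r *s a \<in> B}"
    using len_between_plus_span_singleton[OF sub(2)] sub(2)
    by (intro colength_le_1_imp_m_subset ideal_colon) auto
  then show thesis
    using that[of a] a C1 lengths by blast
qed

lemma generators_of_finite_length:
  assumes "subspace A" "subspace B" "B \<subseteq> A" "len_between B A = enat n"
  obtains S where "finite S" "card S \<le> n" "S \<subseteq> A" "A = B + span S"
proof -
  have "\<exists>S. finite S \<and> card S \<le> n \<and> S \<subseteq> A \<and> A = B + span S"
    using assms
  proof (induction n arbitrary: B)
    case 0
    then have "A = B + span {}"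
      using len_between_eq_0[of A B] by (simp add: zero_enat_def)
    then show ?case
      by (intro exI[of _ "{}"]) simp
  next
    case (Suc n)
    obtain a where a: "a \<in> A" "len_between (B + span {a}) A = enat n"
      using simple_extension_exists[OF Suc.prems] .
    obtain S where S: "finite S" "card S \<le> n" "S \<subseteq> A" "A = B + span {a} + span S"
      using Suc.IH[of "B + span {a}"] Suc.prems a plus_span_singleton_subset[of A B a]
      by (auto simp: subspace_set_plus)
    then have "A = B + span (insert a S)"
      using span_insert_eq_set_plus[of a S] by (simp only: add.assoc)
    then show ?case
      using S a(1) by (intro exI[of _ "insert a S"]) (auto simp: card_insert_if)
  qed
  then show thesis
    using that by blast
qed

end

sublocale noetherian_local \<subseteq> R: local_module m "(*)"
  rewrites "module.subspace (*) = (ideal :: 'a set \<Rightarrow> bool)"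
    and "module.span (*) = (gen_ideal :: 'a set \<Rightarrow> 'a set)"
    and "ring_module.ideal_scale (*) = (ideal_mult :: 'a set \<Rightarrow> 'a set \<Rightarrow> 'a set)"
  by (unfold_locales) (fact regular_module_eqs)+

declare (in noetherian_local) R.scale_scale [simp del]

section \<open>Nonzerodivisors and regular sequences\<close>

definition nzd_mod :: "'a::comm_ring_1 set \<Rightarrow> 'a \<Rightarrow> bool" where
  "nzd_mod Y x \<longleftrightarrow> (\<forall>r. x * r \<in> Y \<longrightarrow> r \<in> Y)"

lemma nzd_modD: "nzd_mod Y x \<Longrightarrow> x * r \<in> Y \<Longrightarrow> r \<in> Y"
  unfolding nzd_mod_def by blast

lemma nzd_modI: "(\<And>r. x * r \<in> Y \<Longrightarrow> r \<in> Y) \<Longrightarrow> nzd_mod Y x"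
  unfolding nzd_mod_def by blast

lemma nzd_mod_UNIV [simp]: "nzd_mod UNIV x"
  by (simp add: nzd_mod_def)

lemma nzd_mod_power: "nzd_mod Y x \<Longrightarrow> nzd_mod Y (x ^ n)"
proof (induction n)
  case (Suc n)
  then show ?case
    unfolding nzd_mod_def power_Suc mult.assoc by blast
qed (simp add: nzd_mod_def)

lemma nzd_mod_cong:
  assumes "ideal Y" "x - z \<in> Y"
  shows "nzd_mod Y x \<longleftrightarrow> nzd_mod Y z"
proof -
  have "x * r \<in> Y \<longleftrightarrow> z * r \<in> Y" for r
    using ideal_mult_right[OF assms, of r] R.subspace_diff_mem_iff[OF assms(1), of "x * r" "z * r"]
    by (simp add: left_diff_distrib)
  then show ?thesis
    by (simp add: nzd_mod_def)
qed

lemma plus_gen_ideal_insert: "Y + gen_ideal (insert x S) = Y + gen_ideal {x} + gen_ideal S"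
  by (simp only: R.span_insert_eq_set_plus[of x S] add.assoc)

lemma plus_gen_ideal_power_Suc:
  "Y + gen_ideal {x ^ Suc n} + gen_ideal {x ^ n} = Y + gen_ideal {x ^ n}"
proof -
  have "gen_ideal {x ^ n} + gen_ideal {x ^ Suc n} = gen_ideal {x ^ n}"
    by (intro R.set_plus_absorb) (simp_all add: gen_ideal_singleton_mono)
  then show ?thesis
    by (simp only: ac_simps)
qed

lemma colength_plus_power_Suc:
  assumes Y: "ideal Y"
  shows "colength (Y + gen_ideal {x ^ Suc n})
    = colength {r. r * x ^ n \<in> Y + gen_ideal {x ^ Suc n}} + colength (Y + gen_ideal {x ^ n})"
proof -
  let ?A = "Y + gen_ideal {x ^ Suc n}" and ?B = "Y + gen_ideal {x ^ n}"
  have "ideal ?A" "ideal ?B"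
    using Y by (simp_all add: R.subspace_set_plus)
  moreover have "?A \<subseteq> ?B"
    using gen_ideal_singleton_mono[of x "x ^ n"] by (intro set_plus_mono2) simp_all
  ultimately
  have "colength ?A = R.len_between ?A ?B + colength ?B"
    by (intro R.len_between_add) auto
  then show ?thesis
    using R.len_between_plus_span_singleton[OF \<open>ideal ?A\<close>, of "x ^ n"]
    by (simp only: plus_gen_ideal_power_Suc)
qed

lemma plus_subset_colon_power:
  assumes Y: "ideal Y"
  shows "Y + gen_ideal {x} \<subseteq> {r. r * x ^ n \<in> Y + gen_ideal {x ^ Suc n}}"
proof -
  have "ideal (Y + gen_ideal {x ^ Suc n})"
    using Y by (simp add: R.subspace_set_plus)
  moreover have "y * x ^ n \<in> Y + gen_ideal {x ^ Suc n}" if "y \<in> Y" for y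
    using ideal_mult_right[OF Y that] R.set_plus_upper_left[of "gen_ideal {x ^ Suc n}" Y] by blast
  moreover have "x * x ^ n \<in> Y + gen_ideal {x ^ Suc n}"
    using R.set_plus_upper_right[OF Y, of "gen_ideal {x ^ Suc n}"] R.mem_span_singleton(2)[of "x ^ Suc n"]
    by auto
  ultimately show ?thesis
    by (intro R.plus_span_singleton_subset R.ideal_colon) auto
qed

lemma colon_power_eq_plus:
  assumes Y: "ideal Y" and x: "nzd_mod Y x"
  shows "{r. r * x ^ n \<in> Y + gen_ideal {x ^ Suc n}} = Y + gen_ideal {x}"
proof
  show "{r. r * x ^ n \<in> Y + gen_ideal {x ^ Suc n}} \<subseteq> Y + gen_ideal {x}"
  proof
    fix r assume "r \<in> {r. r * x ^ n \<in> Y + gen_ideal {x ^ Suc n}}"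
    then obtain t where "r * x ^ n - t * x ^ Suc n \<in> Y"
      using R.mem_plus_span_singleton by blast
    then have "x ^ n * (r - t * x) \<in> Y"
      by (simp add: algebra_simps)
    then have "r - t * x \<in> Y"
      by (rule nzd_modD[OF nzd_mod_power[OF x]])
    then show "r \<in> Y + gen_ideal {x}"
      using R.mem_plus_span_singleton by blast
  qed
qed (rule plus_subset_colon_power[OF Y])

lemma enat_Suc_times: "enat (Suc n) * a = a + enat n * a"
  by (simp add: eSuc_enat[symmetric] mult_eSuc)

lemma colength_plus_power_le:
  assumes Y: "ideal Y"
  shows "colength (Y + gen_ideal {x ^ n}) \<le> enat n * colength (Y + gen_ideal {x})"
proof (induction n)
  case 0
  then show ?case
    using Y by (simp add: R.len_between_refl zero_enat_def[symmetric])
next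
  case (Suc n)
  have "colength {r. r * x ^ n \<in> Y + gen_ideal {x ^ Suc n}} \<le> colength (Y + gen_ideal {x})"
    using Y by (intro R.len_between_mono plus_subset_colon_power R.ideal_colon R.subspace_set_plus) auto
  then show ?case
    unfolding colength_plus_power_Suc[OF Y] enat_Suc_times using Suc by (rule add_mono)
qed

lemma colength_plus_power:
  assumes Y: "ideal Y" and x: "nzd_mod Y x"
  shows "colength (Y + gen_ideal {x ^ n}) = enat n * colength (Y + gen_ideal {x})"
proof (induction n)
  case 0
  then show ?case
    using Y by (simp add: R.len_between_refl zero_enat_def[symmetric])
next
  case (Suc n)
  then show ?case
    by (simp only: colength_plus_power_Suc[OF Y] colon_power_eq_plus[OF assms] enat_Suc_times)
qed

lemma colength_plus_powers_le:
  assumes "finite S" "ideal Y"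
  shows "colength (Y + gen_ideal ((\<lambda>x. x ^ n) ` S)) \<le> enat (n ^ card S) * colength (Y + gen_ideal S)"
  using assms
proof (induction S arbitrary: Y rule: finite_induct)
  case empty
  then show ?case
    by (simp add: one_enat_def[symmetric] flip: One_nat_def)
next
  case (insert x S)
  let ?F = "gen_ideal ((\<lambda>x. x ^ n) ` S)" and ?Y = "Y + gen_ideal {x ^ n}" and ?Z = "Y + gen_ideal S"
  have "colength (Y + gen_ideal ((\<lambda>x. x ^ n) ` insert x S)) = colength (?Y + ?F)"
    by (simp only: image_insert plus_gen_ideal_insert[of Y "x ^ n" "(\<lambda>x. x ^ n) ` S"])
  also have "\<dots> \<le> enat (n ^ card S) * colength (?Y + gen_ideal S)"
    using insert.prems by (intro insert.IH R.subspace_set_plus) auto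
  also have "?Y + gen_ideal S = ?Z + gen_ideal {x ^ n}"
    by (simp only: ac_simps)
  also have "enat (n ^ card S) * colength \<dots> \<le> enat (n ^ card S) * (enat n * colength (?Z + gen_ideal {x}))"
    using insert.prems by (intro mult_left_mono colength_plus_power_le R.subspace_set_plus) auto
  also have "\<dots> = enat (n ^ card (insert x S)) * colength (?Z + gen_ideal {x})"
    using insert.hyps by (simp add: mult.assoc[symmetric] mult.commute)
  also have "?Z + gen_ideal {x} = Y + gen_ideal (insert x S)"
    by (simp only: plus_gen_ideal_insert[of Y x S] ac_simps)
  finally show ?case .
qed

fun regular_seq :: "'a::comm_ring_1 set \<Rightarrow> 'a list \<Rightarrow> bool" where
  "regular_seq Y [] \<longleftrightarrow> True"
| "regular_seq Y (x # xs) \<longleftrightarrow> nzd_mod Y x \<and> regular_seq (Y + gen_ideal {x}) xs"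

lemma plus_gen_ideal_Cons: "Y + gen_ideal (set (x # xs)) = Y + gen_ideal {x} + gen_ideal (set xs)"
  by (simp only: list.set plus_gen_ideal_insert[of Y x "set xs"])

lemma regular_seq_snoc:
  "regular_seq Y (xs @ [a]) \<longleftrightarrow> regular_seq Y xs \<and> nzd_mod (Y + gen_ideal (set xs)) a"
proof (induction xs arbitrary: Y)
  case (Cons x xs)
  then show ?case
    by (simp only: append_Cons regular_seq.simps plus_gen_ideal_Cons conj_assoc)
qed simp

context noetherian_local
begin

lemma nakayama_times_element:
  assumes "ideal N" "ideal A" "x \<in> m" "\<And>a. a \<in> A \<Longrightarrow> \<exists>b\<in>A. a - x * b \<in> N"
  shows "A \<subseteq> N"
proof -
  obtain S where S: "finite S" "A = gen_ideal S"
    using ideal_finitely_generated[OF assms(2)] .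
  have "A \<subseteq> N + ideal_mult m A"
  proof
    fix a assume "a \<in> A"
    then obtain b where "b \<in> A" "a - x * b \<in> N"
      using assms(4) by blast
    then have "(a - x * b) + x * b \<in> N + ideal_mult m A"
      using assms(3) by (intro set_plus_intro R.ideal_scale_mem)
    then show "a \<in> N + ideal_mult m A"
      by simp
  qed
  then show ?thesis
    using R.nakayama[OF S(1) assms(1)] S(2) by simp
qed

lemma nzd_mod_swap:
  assumes Y: "ideal Y" and a: "a \<in> m" and na: "nzd_mod Y a" and nb: "nzd_mod (Y + gen_ideal {a}) b"
  shows "nzd_mod Y b" "nzd_mod (Y + gen_ideal {b}) a"
proof -
  let ?D = "{r. r * b \<in> Y}"
  have "?D \<subseteq> Y"
  proof (rule nakayama_times_element[OF Y R.ideal_colon[OF Y] a])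
    fix r assume "r \<in> ?D"
    then have br: "b * r \<in> Y"
      by (simp add: mult.commute)
    then have "b * r \<in> Y + gen_ideal {a}"
      using R.set_plus_upper_left[of "gen_ideal {a}" Y] by auto
    then obtain t where t: "r - t * a \<in> Y"
      using nzd_modD[OF nb] R.mem_plus_span_singleton by blast
    have "a * (t * b) \<in> Y"
      by (rule R.subspace_lincomb[OF Y br t, where a = 1 and b = "- b"]) (simp add: algebra_simps)
    then have "t * b \<in> Y"
      by (rule nzd_modD[OF na])
    then show "\<exists>t\<in>?D. r - a * t \<in> Y"
      using t by (intro bexI[of _ t]) (simp_all add: mult.commute)
  qed
  then show "nzd_mod Y b"
    by (intro nzd_modI) (auto simp: mult.commute)
  show "nzd_mod (Y + gen_ideal {b}) a"
  proof (rule nzd_modI)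
    fix r assume "a * r \<in> Y + gen_ideal {b}"
    then obtain s where s: "a * r - s * b \<in> Y"
      using R.mem_plus_span_singleton by blast
    have "b * s - r * a \<in> Y"
      using R.subspace_neg[OF Y s] by (simp add: algebra_simps)
    then have "s \<in> Y + gen_ideal {a}"
      using nzd_modD[OF nb] R.mem_plus_span_singleton by blast
    then obtain t where t: "s - t * a \<in> Y"
      using R.mem_plus_span_singleton by blast
    have "a * (r - t * b) \<in> Y"
      by (rule R.subspace_lincomb[OF Y s t, where a = 1 and b = b]) (simp add: algebra_simps)
    then have "r - t * b \<in> Y"
      by (rule nzd_modD[OF na])
    then show "r \<in> Y + gen_ideal {b}"
      using R.mem_plus_span_singleton by blast
  qed
qed

lemma regular_seq_rotate:
  assumes "ideal Y" "set (a # xs) \<subseteq> m"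
  shows "regular_seq Y (a # xs) \<longleftrightarrow> regular_seq Y (xs @ [a])"
  using assms
proof (induction xs arbitrary: Y)
  case (Cons b xs)
  have "regular_seq (Y + gen_ideal {b}) (a # xs) \<longleftrightarrow> regular_seq (Y + gen_ideal {b}) (xs @ [a])"
    using Cons.prems by (intro Cons.IH) (auto intro: R.subspace_set_plus)
  moreover have "Y + gen_ideal {b} + gen_ideal {a} = Y + gen_ideal {a} + gen_ideal {b}"
    by (simp only: ac_simps)
  moreover have "nzd_mod Y a \<and> nzd_mod (Y + gen_ideal {a}) b \<longleftrightarrow> nzd_mod Y b \<and> nzd_mod (Y + gen_ideal {b}) a"
  proof -
    have "a \<in> m" "b \<in> m"
      using Cons.prems(2) by simp_all
    then show ?thesis
      using nzd_mod_swap[OF Cons.prems(1), of a b] nzd_mod_swap[OF Cons.prems(1), of b a] by blast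
  qed
  ultimately show ?case
    by (simp only: append_Cons regular_seq.simps) blast
qed simp

lemma regular_seq_rotateD:
  assumes "ideal Y" "set (a # xs) \<subseteq> m" "regular_seq Y (a # xs)"
  shows "regular_seq Y xs" "nzd_mod (Y + gen_ideal (set xs)) a"
  using regular_seq_rotate[OF assms(1,2)] assms(3) unfolding regular_seq_snoc by blast+

lemma regular_seq_replace_hd:
  assumes "ideal Y" "set (a # xs) \<subseteq> m" "b \<in> m" "regular_seq Y (a # xs)"
    and "nzd_mod (Y + gen_ideal (set xs)) a \<Longrightarrow> nzd_mod (Y + gen_ideal (set xs)) b"
  shows "regular_seq Y (b # xs)"
  using regular_seq_rotateD[OF assms(1,2,4)] assms(5) regular_seq_rotate[of Y b xs] assms(1-3)
  unfolding regular_seq_snoc by simp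

lemma regular_seq_power_hd:
  "ideal Y \<Longrightarrow> set (a # xs) \<subseteq> m \<Longrightarrow> regular_seq Y (a # xs) \<Longrightarrow> 0 < n \<Longrightarrow> regular_seq Y (a ^ n # xs)"
  by (rule regular_seq_replace_hd[of Y a xs]) (auto intro: nzd_mod_power power_mem_m)

lemma regular_seq_powers:
  "ideal Y \<Longrightarrow> set xs \<subseteq> m \<Longrightarrow> regular_seq Y xs \<Longrightarrow> 0 < n \<Longrightarrow> regular_seq Y (map (\<lambda>x. x ^ n) xs)"
proof (induction xs arbitrary: Y)
  case (Cons x xs)
  have "regular_seq Y (x ^ n # xs)"
    using Cons.prems by (intro regular_seq_power_hd)
  then show ?case
    using Cons.IH[of "Y + gen_ideal {x ^ n}"] Cons.prems by (simp add: R.subspace_set_plus)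
qed simp

lemma colength_regular_seq_powers:
  "ideal Y \<Longrightarrow> set xs \<subseteq> m \<Longrightarrow> regular_seq Y xs \<Longrightarrow> 0 < n \<Longrightarrow>
    colength (Y + gen_ideal ((\<lambda>x. x ^ n) ` set xs)) = enat (n ^ length xs) * colength (Y + gen_ideal (set xs))"
proof (induction xs arbitrary: Y)
  case Nil
  then show ?case
    by (simp add: one_enat_def[symmetric] flip: One_nat_def)
next
  case (Cons x xs)
  let ?F = "gen_ideal ((\<lambda>x. x ^ n) ` set xs)" and ?Y = "Y + gen_ideal {x ^ n}" and ?Z = "Y + gen_ideal (set xs)"
  have "regular_seq Y (x ^ n # xs)"
    using Cons.prems by (intro regular_seq_power_hd)
  then have "colength (?Y + ?F) = enat (n ^ length xs) * colength (?Y + gen_ideal (set xs))"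
    using Cons.prems by (intro Cons.IH) (simp_all add: R.subspace_set_plus)
  also have "?Y + gen_ideal (set xs) = ?Z + gen_ideal {x ^ n}"
    by (simp only: ac_simps)
  also have "colength \<dots> = enat n * colength (?Z + gen_ideal {x})"
    using Cons.prems regular_seq_rotateD(2)[OF Cons.prems(1-3)]
    by (intro colength_plus_power R.subspace_set_plus) simp_all
  also have "?Z + gen_ideal {x} = Y + gen_ideal (set (x # xs))"
    by (simp only: plus_gen_ideal_Cons ac_simps)
  also have "?Y + ?F = Y + gen_ideal ((\<lambda>x. x ^ n) ` set (x # xs))"
    by (simp only: list.set image_insert plus_gen_ideal_insert[of Y "x ^ n" "(\<lambda>x. x ^ n) ` set xs"])
  finally show ?case
    by (simp add: mult.assoc[symmetric] mult.commute)
qed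

lemma regular_seq_colon_power:
  "ideal Y \<Longrightarrow> set xs \<subseteq> m \<Longrightarrow> regular_seq Y xs \<Longrightarrow>
    prod_list xs ^ n * r \<in> Y + gen_ideal ((\<lambda>x. x ^ Suc n) ` set xs) \<Longrightarrow> r \<in> Y + gen_ideal (set xs)"
proof (induction xs arbitrary: Y)
  case (Cons x xs)
  let ?F = "Y + gen_ideal ((\<lambda>x. x ^ Suc n) ` set xs)" and ?s = "prod_list xs ^ n * r"
  have F: "ideal ?F"
    using Cons.prems(1) by (simp add: R.subspace_set_plus)
  have mem: "x ^ n * ?s \<in> ?F + gen_ideal {x ^ Suc n}"
    using Cons.prems(4)
    unfolding list.set image_insert plus_gen_ideal_insert[of Y "x ^ Suc n" "(\<lambda>x. x ^ Suc n) ` set xs"]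
    by (simp add: power_mult_distrib ac_simps)
  have nx: "nzd_mod ?F x"
  proof -
    have "regular_seq Y (x # map (\<lambda>x. x ^ Suc n) xs)"
      using Cons.prems regular_seq_powers[of "Y + gen_ideal {x}" xs "Suc n"]
      by (simp add: R.subspace_set_plus del: power_Suc)
    moreover have "set (x # map (\<lambda>x. x ^ Suc n) xs) \<subseteq> m"
      using Cons.prems(2) by (auto simp del: power_Suc intro!: power_mem_m)
    ultimately show ?thesis
      using regular_seq_rotateD(2)[OF Cons.prems(1), of x "map (\<lambda>x. x ^ Suc n) xs"]
      by (simp del: power_Suc)
  qed
  have "?s \<in> ?F + gen_ideal {x}"
    using mem unfolding colon_power_eq_plus[OF F nx, of n, symmetric]
    by (simp only: mem_Collect_eq mult.commute)
  then have "?s \<in> Y + gen_ideal {x} + gen_ideal ((\<lambda>x. x ^ Suc n) ` set xs)"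
    by (simp only: ac_simps)
  then have "r \<in> Y + gen_ideal {x} + gen_ideal (set xs)"
    using Cons.prems by (intro Cons.IH) (simp_all add: R.subspace_set_plus)
  then show ?case
    by (simp only: plus_gen_ideal_Cons)
qed simp

end

section \<open>Primary ideals, socles and depth\<close>

definition saturation :: "'a::comm_ring_1 \<Rightarrow> 'a set \<Rightarrow> 'a set" where
  "saturation y Q = {a. \<exists>k. y ^ k * a \<in> Q}"

lemma ideal_saturation:
  assumes Q: "ideal Q"
  shows "ideal (saturation y Q)"
  unfolding ideal_def
proof (intro conjI ballI allI impI)
  show "0 \<in> saturation y Q"
    using R.subspace_0[OF Q] by (simp add: saturation_def)
next
  fix a b assume "a \<in> saturation y Q" "b \<in> saturation y Q"
  then obtain k l where k: "y ^ k * a \<in> Q" and l: "y ^ l * b \<in> Q"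
    unfolding saturation_def by blast
  have "y ^ (k + l) * (a + b) \<in> Q"
    by (rule R.subspace_lincomb[OF Q k l, where a = "y ^ l" and b = "y ^ k"])
      (simp add: algebra_simps power_add)
  then show "a + b \<in> saturation y Q"
    unfolding saturation_def by blast
next
  fix r a assume "a \<in> saturation y Q"
  then obtain k where k: "y ^ k * a \<in> Q"
    unfolding saturation_def by blast
  have "y ^ k * (r * a) \<in> Q"
    using R.subspace_scale[OF Q k, of r] by (simp add: mult.left_commute)
  then show "r * a \<in> saturation y Q"
    unfolding saturation_def by blast
qed

lemma saturation_upper: "Q \<subseteq> saturation y Q"
proof
  fix a assume "a \<in> Q"
  then have "y ^ 0 * a \<in> Q"
    by simp
  then show "a \<in> saturation y Q"
    unfolding saturation_def by blast
qed

lemma saturation_mono: "Q \<subseteq> Q' \<Longrightarrow> saturation y Q \<subseteq> saturation y Q'"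
  unfolding saturation_def by blast

lemma nzd_mod_saturation: "nzd_mod (saturation y Q) y"
proof (rule nzd_modI)
  fix r assume "y * r \<in> saturation y Q"
  then obtain k where "y ^ k * (y * r) \<in> Q"
    unfolding saturation_def by blast
  then have "y ^ Suc k * r \<in> Q"
    by (simp add: ac_simps)
  then show "r \<in> saturation y Q"
    unfolding saturation_def by blast
qed

context noetherian_local
begin

(* The unit ideal is m_primary, too. *)
definition m_primary :: "'a set \<Rightarrow> bool" where
  "m_primary Q \<longleftrightarrow> ideal Q \<and> (\<forall>a\<in>m. \<exists>n. a ^ n \<in> Q)"

lemma m_primary_ideal: "m_primary Q \<Longrightarrow> ideal Q"
  by (simp add: m_primary_def)

lemma m_primary_mono: "m_primary Q \<Longrightarrow> ideal Q' \<Longrightarrow> Q \<subseteq> Q' \<Longrightarrow> m_primary Q'"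
  unfolding m_primary_def by blast

lemma m_primary_UNIV: "m_primary UNIV"
  by (simp add: m_primary_def)

lemma m_primary_m: "m_primary m"
  unfolding m_primary_def by (auto intro: exI[of _ 1])

lemma colength_finite:
  assumes Q: "m_primary Q"
  shows "colength Q \<noteq> \<infinity>"
proof -
  obtain S where S: "finite S" "m = gen_ideal S"
    using ideal_finitely_generated[OF ideal_m] .
  have id: "ideal Q"
    using Q by (rule m_primary_ideal)
  have "\<exists>n. x ^ n \<in> Q" if "x \<in> S" for x
    using Q R.span_base[OF that] S(2) unfolding m_primary_def by blast
  then obtain n where "x ^ n \<in> Q" if "x \<in> S" for x
    using finite_common_power[OF id S(1)] by blast
  then have "(\<lambda>x. x ^ n) ` S \<subseteq> Q"
    by blast
  then have "Q + gen_ideal ((\<lambda>x. x ^ n) ` S) = Q"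
    using id by (intro R.set_plus_absorb R.span_minimal) simp_all
  then have "colength Q \<le> enat (n ^ card S) * colength (Q + m)"
    using colength_plus_powers_le[OF S(1) id, of n] S(2) by simp
  also have "\<dots> \<le> enat (n ^ card S) * colength m"
    using id
    by (intro mult_left_mono R.len_between_mono R.subspace_set_plus R.set_plus_upper_right) simp_all
  finally show ?thesis
    by (cases "colength Q") (simp_all add: colength_m)
qed

lemma len_quot_eq: "m_primary Q \<Longrightarrow> colength Q = enat (len_quot Q)"
  using len_quot_eq_colength[of Q] colength_finite[of Q] m_primary_ideal[of Q] by simp

lemma len_quot_UNIV: "len_quot (UNIV :: 'a set) = 0"
  using len_quot_eq[OF m_primary_UNIV] by (simp add: R.len_between_refl zero_enat_def)

lemma len_quot_antimono: "m_primary Q \<Longrightarrow> ideal Q' \<Longrightarrow> Q \<subseteq> Q' \<Longrightarrow> len_quot Q' \<le> len_quot Q"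
  using len_quot_eq[of Q] len_quot_eq[of Q'] m_primary_mono[of Q Q'] m_primary_ideal[of Q]
    R.len_between_mono[of UNIV Q UNIV Q']
  by simp

definition socle_generator :: "'a set \<Rightarrow> 'a \<Rightarrow> bool" where
  "socle_generator Q u \<longleftrightarrow>
    u \<notin> Q \<and> (\<forall>r\<in>m. r * u \<in> Q) \<and> (\<forall>v. (\<forall>r\<in>m. r * v \<in> Q) \<longrightarrow> v \<in> Q + gen_ideal {u})"

definition simple_socle :: "'a set \<Rightarrow> bool" where
  "simple_socle Q \<longleftrightarrow> (\<exists>u. socle_generator Q u)"

lemma socle_generatorD:
  assumes "socle_generator Q u"
  shows "u \<notin> Q" "\<And>r. r \<in> m \<Longrightarrow> r * u \<in> Q" "\<And>v. (\<And>r. r \<in> m \<Longrightarrow> r * v \<in> Q) \<Longrightarrow> \<exists>s. v - s * u \<in> Q"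
  using assms unfolding socle_generator_def R.mem_plus_span_singleton by blast+

lemma socle_generatorI:
  assumes "u \<notin> Q" "\<And>r. r \<in> m \<Longrightarrow> r * u \<in> Q" "\<And>v. (\<And>r. r \<in> m \<Longrightarrow> r * v \<in> Q) \<Longrightarrow> \<exists>s. v - s * u \<in> Q"
  shows "socle_generator Q u"
  using assms unfolding socle_generator_def R.mem_plus_span_singleton by blast

lemma socle_generator_multiple:
  assumes "ideal Q" "socle_generator Q u" "v \<notin> Q" "\<And>r. r \<in> m \<Longrightarrow> r * v \<in> Q"
  obtains s where "s * v - u \<in> Q"
proof -
  obtain t where t: "v - t * u \<in> Q"
    using socle_generatorD(3)[OF assms(2,4)] by blast
  then have "t \<notin> m"
    using assms(3) socle_generatorD(2)[OF assms(2)] R.subspace_diff_mem_iff[OF assms(1) t] by blast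
  then obtain s where "s * t = 1"
    using unit_inverse by blast
  then have "s * v - u = s * (v - t * u)"
    by (simp add: right_diff_distrib mult.assoc[symmetric])
  then show thesis
    using that[of s] R.subspace_scale[OF assms(1) t, of s] by simp
qed

(* Modulo Y, the socles of R/z and R/x are identified by u |-> x u / z. *)
lemma socle_generator_exchange:
  assumes Y: "ideal Y" and z: "nzd_mod Y z" "z \<in> m" and x: "nzd_mod Y x"
    and u: "socle_generator (Y + gen_ideal {z}) u" and b: "x * u - b * z \<in> Y"
  shows "socle_generator (Y + gen_ideal {x}) b"
proof (rule socle_generatorI)
  note [simp] = R.mem_plus_span_singleton
  show "b \<notin> Y + gen_ideal {x}"
  proof
    assume "b \<in> Y + gen_ideal {x}"
    then obtain t where t: "b - t * x \<in> Y"
      by auto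
    have "x * (u - t * z) \<in> Y"
      by (rule R.subspace_lincomb[OF Y b t, where a = 1 and b = z]) (simp add: algebra_simps)
    then show False
      using nzd_modD[OF x] socle_generatorD(1)[OF u] by auto
  qed
next
  fix r assume "r \<in> m"
  then obtain t where t: "r * u - t * z \<in> Y"
    using socle_generatorD(2)[OF u] R.mem_plus_span_singleton by blast
  have "z * (r * b - t * x) \<in> Y"
    by (rule R.subspace_lincomb[OF Y b t, where a = "- r" and b = x]) (simp add: algebra_simps)
  then show "r * b \<in> Y + gen_ideal {x}"
    using nzd_modD[OF z(1)] R.mem_plus_span_singleton by blast
next
  fix v assume v: "\<And>r. r \<in> m \<Longrightarrow> r * v \<in> Y + gen_ideal {x}"
  then obtain a where a: "z * v - a * x \<in> Y"
    using z(2) R.mem_plus_span_singleton by blast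
  have "r * a \<in> Y + gen_ideal {z}" if r: "r \<in> m" for r
  proof -
    obtain t where t: "r * v - t * x \<in> Y"
      using v[OF r] R.mem_plus_span_singleton by blast
    have "x * (r * a - t * z) \<in> Y"
      by (rule R.subspace_lincomb[OF Y a t, where a = "- r" and b = z]) (simp add: algebra_simps)
    then show ?thesis
      using nzd_modD[OF x] R.mem_plus_span_singleton by blast
  qed
  then obtain s where "a - s * u \<in> Y + gen_ideal {z}"
    using socle_generatorD(3)[OF u] by blast
  then obtain t where t: "a - s * u - t * z \<in> Y"
    using R.mem_plus_span_singleton by blast
  have "z * (v - s * b - t * x) \<in> Y"
    by (rule R.subspace_lincomb3[OF Y a t b, where a = 1 and b = x and c = s]) (simp add: algebra_simps)
  then show "\<exists>s. v - s * b \<in> Y + gen_ideal {x}"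
    using nzd_modD[OF z(1)] R.mem_plus_span_singleton by blast
qed

lemma simple_socle_exchange:
  assumes "ideal Y" "nzd_mod Y z" "z \<in> m" "nzd_mod Y x" "x \<in> m" "simple_socle (Y + gen_ideal {z})"
  shows "simple_socle (Y + gen_ideal {x})"
proof -
  obtain u where u: "socle_generator (Y + gen_ideal {z}) u"
    using assms(6) unfolding simple_socle_def by blast
  then obtain b where "x * u - b * z \<in> Y"
    using socle_generatorD(2)[OF u assms(5)] R.mem_plus_span_singleton by blast
  then show ?thesis
    unfolding simple_socle_def using socle_generator_exchange[OF assms(1-4) u] by blast
qed

lemma socle_generator_powers:
  "ideal Y \<Longrightarrow> set xs \<subseteq> m \<Longrightarrow> regular_seq Y xs \<Longrightarrow> socle_generator (Y + gen_ideal (set xs)) u \<Longrightarrow>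
    socle_generator (Y + gen_ideal ((\<lambda>x. x ^ Suc n) ` set xs)) (prod_list xs ^ n * u)"
proof (induction xs arbitrary: Y u)
  case (Cons x xs)
  let ?Z = "Y + gen_ideal (set xs)"
  have Z: "ideal ?Z" and x: "x \<in> m" "nzd_mod ?Z x"
    using Cons.prems regular_seq_rotateD(2)[OF Cons.prems(1-3)] by (simp_all add: R.subspace_set_plus)
  have "socle_generator (?Z + gen_ideal {x}) u"
    using Cons.prems(4) unfolding plus_gen_ideal_Cons by (simp only: ac_simps)
  then have "socle_generator (?Z + gen_ideal {x ^ Suc n}) (x ^ n * u)"
    by (rule socle_generator_exchange[OF Z x(2,1) nzd_mod_power[OF x(2)]])
      (simp add: R.subspace_0[OF Z] ac_simps)
  then have "socle_generator (Y + gen_ideal {x ^ Suc n} + gen_ideal (set xs)) (x ^ n * u)"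
    by (simp only: ac_simps)
  moreover have "regular_seq Y (x ^ Suc n # xs)"
    using Cons.prems(1-3) by (rule regular_seq_power_hd) simp
  ultimately have "socle_generator (Y + gen_ideal {x ^ Suc n} + gen_ideal ((\<lambda>x. x ^ Suc n) ` set xs))
      (prod_list xs ^ n * (x ^ n * u))"
    using Cons.prems(1,2) by (intro Cons.IH) (simp_all add: R.subspace_set_plus)
  then show ?case
    unfolding list.set image_insert plus_gen_ideal_insert[of Y "x ^ Suc n" "(\<lambda>x. x ^ Suc n) ` set xs"]
    by (simp add: power_mult_distrib ac_simps)
qed simp

definition positive_depth :: "'a set \<Rightarrow> bool" where
  "positive_depth Y \<longleftrightarrow> (\<forall>v. (\<forall>r\<in>m. r * v \<in> Y) \<longrightarrow> v \<in> Y)"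

lemma nzd_mod_positive_depth: "nzd_mod Y y \<Longrightarrow> y \<in> m \<Longrightarrow> positive_depth Y"
  unfolding positive_depth_def nzd_mod_def by blast

lemma regular_pair_positive_depth:
  assumes Y: "ideal Y" and y: "y1 \<in> m" "y2 \<in> m" "nzd_mod Y y1" "nzd_mod (Y + gen_ideal {y1}) y2"
    and c: "nzd_mod Y c"
  shows "positive_depth (Y + gen_ideal {c})"
  unfolding positive_depth_def
proof (intro allI impI)
  fix v assume v: "\<forall>r\<in>m. r * v \<in> Y + gen_ideal {c}"
  obtain s where s: "y1 * v - s * c \<in> Y"
    using v y(1) R.mem_plus_span_singleton by blast
  obtain t where t: "y2 * v - t * c \<in> Y"
    using v y(2) R.mem_plus_span_singleton by blast
  have "c * (y2 * s - t * y1) \<in> Y"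
    by (rule R.subspace_lincomb[OF Y s t, where a = "- y2" and b = y1]) (simp add: algebra_simps)
  then have "y2 * s \<in> Y + gen_ideal {y1}"
    using nzd_modD[OF c] R.mem_plus_span_singleton by blast
  then obtain w where w: "s - w * y1 \<in> Y"
    using nzd_modD[OF y(4)] R.mem_plus_span_singleton by blast
  have "y1 * (v - w * c) \<in> Y"
    by (rule R.subspace_lincomb[OF Y s w, where a = 1 and b = c]) (simp add: algebra_simps)
  then show "v \<in> Y + gen_ideal {c}"
    using nzd_modD[OF y(3)] R.mem_plus_span_singleton by blast
qed

section \<open>Associated primes\<close>

definition associated_primes :: "'a set \<Rightarrow> 'a set set" where
  "associated_primes Y = {P. prime_ideal P \<and> (\<exists>a. P = {r. r * a \<in> Y})}"

lemma associated_prime_exists: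
  assumes Y: "ideal Y" and A: "ideal A" "\<not> A \<subseteq> Y"
  obtains a where "a \<in> A" "a \<notin> Y" "{r. r * a \<in> Y} \<in> associated_primes Y"
proof -
  define F where "F = {{r. r * a \<in> Y} | a. a \<in> A \<and> a \<notin> Y}"
  obtain b where "b \<in> A" "b \<notin> Y"
    using A(2) by blast
  then have "{r. r * b \<in> Y} \<in> F"
    unfolding F_def by blast
  then obtain P where P: "P \<in> F" "\<And>B. B \<in> F \<Longrightarrow> \<not> P \<subset> B"
    by (rule ideal_family_maximal) (auto simp: F_def R.ideal_colon[OF Y])
  then obtain a where a: "P = {r. r * a \<in> Y}" "a \<in> A" "a \<notin> Y"
    unfolding F_def by blast
  have "s \<in> P \<or> t \<in> P" if st: "s * t \<in> P" for s t
  proof (rule disjCI)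
    assume "t \<notin> P"
    then have "{r. r * (t * a) \<in> Y} \<in> F"
      unfolding F_def using a R.subspace_scale[OF A(1) a(2)] by auto
    moreover have "P \<subseteq> {r. r * (t * a) \<in> Y}"
      using a(1) R.subspace_scale[OF Y, of _ t] by (auto simp: mult.left_commute[of _ t])
    ultimately have "P = {r. r * (t * a) \<in> Y}"
      using P(2) by blast
    moreover have "s * (t * a) \<in> Y"
      using st unfolding a(1) by (simp add: mult.assoc)
    ultimately show "s \<in> P"
      by blast
  qed
  moreover have "ideal P"
    unfolding a(1) by (rule R.ideal_colon[OF Y])
  moreover have "1 \<notin> P"
    using a by simp
  ultimately have "prime_ideal P"
    unfolding prime_ideal_def by blast
  then show thesis
    using that[OF a(2,3)] a(1) by (auto simp: associated_primes_def)
qed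

lemma zero_divisor_in_associated_prime:
  assumes Y: "ideal Y" and r: "r * b \<in> Y" "b \<notin> Y"
  shows "\<exists>P\<in>associated_primes Y. r \<in> P"
proof -
  have "\<not> {a. a * r \<in> Y} \<subseteq> Y"
    using r by (auto simp: mult.commute)
  with R.ideal_colon[OF Y] obtain a where "a * r \<in> Y" "{s. s * a \<in> Y} \<in> associated_primes Y"
    by (rule associated_prime_exists[OF Y]) simp
  then show ?thesis
    by (intro bexI[of _ "{s. s * a \<in> Y}"]) (simp_all add: mult.commute)
qed

lemma associated_primes_subset_insert:
  assumes Y: "ideal Y" and P: "prime_ideal P" "P = {r. r * a \<in> Y}"
  shows "associated_primes Y \<subseteq> insert P (associated_primes (Y + gen_ideal {a}))"
proof
  fix Q assume "Q \<in> associated_primes Y"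
  then obtain b where Q: "prime_ideal Q" "Q = {r. r * b \<in> Y}"
    unfolding associated_primes_def by blast
  show "Q \<in> insert P (associated_primes (Y + gen_ideal {a}))"
  proof (cases "\<exists>s t. s * b - t * a \<in> Y \<and> s \<notin> Q")
    case True
    then obtain s t where st: "s * b - t * a \<in> Y" "s \<notin> Q"
      by blast
    then have t: "t \<notin> P"
      using R.subspace_diff_mem_iff[OF Y st(1)] Q(2) P(2) by blast
    have "r * (s * b) \<in> Y \<longleftrightarrow> r * (t * a) \<in> Y" for r
      using R.subspace_diff_mem_iff[OF Y, of "r * (s * b)" "r * (t * a)"] R.subspace_scale[OF Y st(1), of r]
      by (simp add: right_diff_distrib)
    then have "r * s \<in> Q \<longleftrightarrow> r * t \<in> P" for r
      using Q(2) P(2) by (simp add: mult.assoc)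
    moreover have "r * s \<in> Q \<longleftrightarrow> r \<in> Q" "r * t \<in> P \<longleftrightarrow> r \<in> P" for r
      using prime_idealD[OF Q(1)] prime_idealD[OF P(1)] st(2) t ideal_mult_right by blast+
    ultimately show ?thesis
      by auto
  next
    case False
    then have "Q = {r. r * b \<in> Y + gen_ideal {a}}"
      using Q(2) R.set_plus_upper_left[of "gen_ideal {a}" Y]
      by (auto simp: R.mem_plus_span_singleton)
    then show ?thesis
      using Q(1) unfolding associated_primes_def by blast
  qed
qed

theorem finite_associated_primes:
  assumes "ideal Y"
  shows "finite (associated_primes Y)"
  using assms
proof (induction Y rule: ideal_noetherian_induct)
  case (larger Y)
  show ?case
  proof (cases "associated_primes Y = {}")
    case False
    then obtain P a where P: "prime_ideal P" "P = {r. r * a \<in> Y}"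
      unfolding associated_primes_def by blast
    then have "a \<notin> Y"
      using prime_idealD(2)[OF P(1)] by auto
    then have "finite (associated_primes (Y + gen_ideal {a}))"
      using larger.hyps R.psubset_plus_span_singleton
      by (intro larger.IH R.subspace_set_plus) simp_all
    then show ?thesis
      using finite_subset[OF associated_primes_subset_insert[OF larger.hyps P]] by simp
  qed simp
qed

lemma Inter_associated_primes_reduced:
  assumes "reduced_ring TYPE('a)"
  shows "\<Inter>(associated_primes {0}) = {0}"
proof -
  have "x = 0" if x: "x \<in> \<Inter>(associated_primes {0})" for x
  proof (rule ccontr)
    assume "x \<noteq> 0"
    then have "\<not> gen_ideal {x} \<subseteq> {0}"
      using R.mem_span_singleton(2)[of x] by blast
    then obtain a where a: "a \<in> gen_ideal {x}" "a \<notin> {0}" "{r. r * a \<in> {0}} \<in> associated_primes {0}"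
      by (rule associated_prime_exists[OF R.subspace_single_0 R.subspace_span])
    then obtain t where "a = t * x" "x * a = 0"
      using x by (auto simp: R.span_singleton)
    then have "a ^ 2 = 0"
      by (simp add: power2_eq_square mult.assoc)
    then have "a = 0"
      using assms unfolding reduced_ring_def by blast
    then show False
      using a(2) by simp
  qed
  moreover have "0 \<in> \<Inter>(associated_primes {0})"
    by (auto simp: associated_primes_def prime_ideal_def R.subspace_0)
  ultimately show ?thesis
    by blast
qed

lemma positive_depth_imp_m_not_associated:
  assumes "positive_depth Y" "P \<in> associated_primes Y"
  shows "P \<noteq> m"
proof
  assume "P = m"
  then obtain a where a: "m = {r. r * a \<in> Y}"
    using assms(2) unfolding associated_primes_def by blast
  then have "a \<in> Y"
    using assms(1) unfolding positive_depth_def by blast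
  then show False
    using a one_notin_m by auto
qed

lemma m_primary_prime_eq_m:
  assumes P: "prime_ideal P" "m_primary P"
  shows "P = m"
proof
  have "a \<in> P" if "a ^ n \<in> P" for a n
    using that by (induction n) (use prime_idealD[OF P(1)] in auto)
  then show "m \<subseteq> P"
    using P(2) unfolding m_primary_def by blast
  show "P \<subseteq> m"
    using P(1) proper_ideal_subset_m unfolding prime_ideal_def by blast
qed

section \<open>Exchange of regular parameters\<close>

lemma saturated_ideals_stabilize:
  assumes y: "y \<in> m" and fin: "colength (Y + gen_ideal {y}) \<noteq> \<infinity>" and Y: "ideal Y"
    and C: "\<And>n. ideal (C n)" "\<And>n. Y \<subseteq> C n" "\<And>n. C (Suc n) \<subseteq> C n" "\<And>n. nzd_mod (C n) y"
  shows "\<exists>n. C n \<subseteq> C (Suc n)"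
proof -
  have "\<exists>n. C (Suc n) + gen_ideal {y} = C n + gen_ideal {y}"
  proof (rule R.finite_length_dcc[OF _ _ fin])
    fix n
    show "Y + gen_ideal {y} \<subseteq> C n + gen_ideal {y}" "C (Suc n) + gen_ideal {y} \<subseteq> C n + gen_ideal {y}"
      by (intro set_plus_mono2 C subset_refl)+
  qed (simp_all add: Y C R.subspace_set_plus)
  then obtain n where n: "C (Suc n) + gen_ideal {y} = C n + gen_ideal {y}" ..
  have "C n \<subseteq> C (Suc n)"
  proof (rule nakayama_times_element[OF C(1) C(1) y])
    fix a assume a: "a \<in> C n"
    then have "a \<in> C (Suc n) + gen_ideal {y}"
      unfolding n using R.set_plus_upper_left[of "gen_ideal {y}" "C n"] by auto
    then obtain r where r: "a - r * y \<in> C (Suc n)"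
      using R.mem_plus_span_singleton by blast
    then have "r * y \<in> C n"
      using a C(3) R.subspace_diff_mem_iff[OF C(1), of a "r * y" n] by blast
    then have "r \<in> C n"
      using nzd_modD[OF C(4)] by (simp add: mult.commute)
    then show "\<exists>b\<in>C n. a - y * b \<in> C (Suc n)"
      using r by (auto simp: mult.commute)
  qed
  then show ?thesis ..
qed

(* Krull's principal ideal theorem in dimension one; the saturations replace symbolic powers. *)
lemma parameter_power_mem:
  assumes Y: "ideal Y" and y: "y \<in> m" "m_primary (Y + gen_ideal {y})" and c: "nzd_mod Y c"
  shows "\<exists>k. y ^ k \<in> Y + gen_ideal {c}"
proof -
  let ?C = "\<lambda>n. saturation y (Y + gen_ideal {c ^ n})"
  have "\<exists>n. ?C n \<subseteq> ?C (Suc n)"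
  proof (rule saturated_ideals_stabilize[OF y(1) colength_finite[OF y(2)] Y])
    fix n
    show "ideal (?C n)"
      using Y by (intro ideal_saturation R.subspace_set_plus) simp_all
    show "Y \<subseteq> ?C n"
      using R.set_plus_upper_left[of "gen_ideal {c ^ n}" Y] saturation_upper by blast
    show "?C (Suc n) \<subseteq> ?C n"
      using gen_ideal_singleton_mono[of c "c ^ n"] by (intro saturation_mono set_plus_mono2) simp_all
  qed (rule nzd_mod_saturation)
  then obtain n where n: "?C n \<subseteq> ?C (Suc n)" ..
  have "c ^ n \<in> Y + gen_ideal {c ^ n}"
    using R.set_plus_upper_right[OF Y] R.mem_span_singleton(2) by blast
  then have "c ^ n \<in> ?C (Suc n)"
    using n saturation_upper by blast
  then obtain k where "y ^ k * c ^ n \<in> Y + gen_ideal {c ^ Suc n}"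
    unfolding saturation_def by blast
  then have "y ^ k \<in> Y + gen_ideal {c}"
    using colon_power_eq_plus[OF Y c] by blast
  then show ?thesis ..
qed

lemma m_primary_exchange:
  assumes Y: "ideal Y" and y: "y \<in> m" "m_primary (Y + gen_ideal {y})" and c: "nzd_mod Y c"
  shows "m_primary (Y + gen_ideal {c})"
  unfolding m_primary_def
proof (intro conjI ballI)
  show W: "ideal (Y + gen_ideal {c})"
    using Y by (simp add: R.subspace_set_plus)
  obtain k where k: "y ^ k \<in> Y + gen_ideal {c}"
    using parameter_power_mem[OF assms] ..
  fix a assume "a \<in> m"
  then obtain j t where "a ^ j - t * y \<in> Y"
    using y(2) unfolding m_primary_def R.mem_plus_span_singleton by blast
  then have "a ^ j - t * y \<in> Y + gen_ideal {c}"
    using R.set_plus_upper_left[of "gen_ideal {c}" Y] by auto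
  then have "(a ^ j) ^ k - (t * y) ^ k \<in> Y + gen_ideal {c}"
    by (rule ideal_power_diff[OF W])
  moreover have "(t * y) ^ k \<in> Y + gen_ideal {c}"
    using R.subspace_scale[OF W k] by (simp add: power_mult_distrib)
  ultimately have "(a ^ j) ^ k \<in> Y + gen_ideal {c}"
    using R.subspace_diff_mem_iff[OF W] by blast
  then show "\<exists>n. a ^ n \<in> Y + gen_ideal {c}"
    by (metis power_mult)
qed

definition regular_sop :: "'a set \<Rightarrow> 'a list \<Rightarrow> bool" where
  "regular_sop Y xs \<longleftrightarrow> set xs \<subseteq> m \<and> regular_seq Y xs \<and> m_primary (Y + gen_ideal (set xs))"

lemma regular_sop_Nil: "regular_sop Y [] \<longleftrightarrow> m_primary Y"
  by (simp add: regular_sop_def)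

lemma regular_sop_Cons:
  "regular_sop Y (x # xs) \<longleftrightarrow> x \<in> m \<and> nzd_mod Y x \<and> regular_sop (Y + gen_ideal {x}) xs"
  unfolding regular_sop_def plus_gen_ideal_Cons by auto

lemma regular_sop_zeroD:
  assumes "regular_sop {0} xs"
  shows "set xs \<subseteq> m" "regular_seq {0} xs" "m_primary (gen_ideal (set xs))" "gen_ideal (set xs) \<subseteq> m"
  using assms R.span_minimal[OF _ ideal_m, of "set xs"] by (simp_all add: regular_sop_def)

lemma plus_gen_ideal_replace:
  "w \<in> gen_ideal (set ys) \<Longrightarrow> Y + gen_ideal (set ((y + w) # ys)) = Y + gen_ideal (set (y # ys))"
  for w :: 'a
  using R.eq_span_insert_eq[of "y + w" y "set ys"] by simp

lemma regular_sop_replace_hd: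
  assumes Y: "ideal Y" and reg: "regular_sop Y (y # ys)" and w: "w \<in> gen_ideal (set ys)"
  shows "regular_sop Y ((y + w) # ys)"
proof -
  have y: "set (y # ys) \<subseteq> m" "regular_seq Y (y # ys)"
    using reg unfolding regular_sop_def by blast+
  then have "w \<in> m"
    using w R.span_minimal[of "set ys" m] by auto
  then have yw: "y + w \<in> m"
    using y(1) by (simp add: R.subspace_add)
  have "w \<in> Y + gen_ideal (set ys)"
    using w R.set_plus_upper_right[OF Y] by blast
  then have "regular_seq Y ((y + w) # ys)"
    using nzd_mod_cong[of "Y + gen_ideal (set ys)" "y + w" y] Y
    by (intro regular_seq_replace_hd[OF Y y(1) yw y(2)]) (simp add: R.subspace_set_plus)
  then show ?thesis
    using reg yw y(1) unfolding regular_sop_def plus_gen_ideal_replace[OF w] by simp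
qed

end

locale noetherian_local_infinite = noetherian_local +
  assumes infinite_residue_field: "residue_field_infinite m"
begin

lemma prime_avoidance_pair:
  fixes x y :: 'a
  assumes F: "finite F" "\<And>P. P \<in> F \<Longrightarrow> prime_ideal P"
  shows "\<exists>t. \<forall>P\<in>F. (x \<in> P \<and> y \<in> P) \<or> x + t * y \<notin> P"
proof (rule ccontr)
  assume "\<nexists>t. \<forall>P\<in>F. (x \<in> P \<and> y \<in> P) \<or> x + t * y \<notin> P"
  then obtain f where f: "f t \<in> F" "\<not> (x \<in> f t \<and> y \<in> f t)" "x + t * y \<in> f t" for t
    by metis
  let ?cls = "\<lambda>r. {s. r - s \<in> m}"
  have cls_cong: "?cls t = ?cls t'" if eq: "f t = f t'" for t t'
  proof -
    have id: "ideal (f t)"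
      using F(2) f(1) unfolding prime_ideal_def by blast
    have "(t - t') * y \<in> f t"
      using R.subspace_diff[OF id f(3) f(3)[of t', folded eq]] by (simp add: algebra_simps)
    moreover have "y \<notin> f t"
      using f(2,3)[of t] R.subspace_diff[OF id f(3) R.subspace_scale[OF id, of y t]] by auto
    ultimately have "t - t' \<in> m"
      using unit_mult_mem[OF id] by blast
    then have "t - s \<in> m \<longleftrightarrow> t' - s \<in> m" for s
      using R.subspace_diff_mem_iff[OF ideal_m, of "t - s" "t' - s"] by simp
    then show ?thesis
      by simp
  qed
  define g where "g P = ?cls (SOME t. f t = P)" for P
  have "?cls t = g (f t)" for t
    unfolding g_def by (rule cls_cong) (metis (mono_tags, lifting) someI)
  then have "range ?cls \<subseteq> g ` F"
    using f(1) by blast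
  then have "finite (range ?cls)"
    using F(1) finite_surj by blast
  then show False
    using infinite_residue_field unfolding residue_field_infinite_def by blast
qed

lemma prime_avoidance:
  fixes x :: 'a
  assumes F: "finite F" "\<And>P. P \<in> F \<Longrightarrow> prime_ideal P" and "finite S"
  shows "\<exists>w\<in>gen_ideal S. \<forall>P\<in>F. insert x S \<subseteq> P \<or> x + w \<notin> P"
  using assms(3)
proof (induction S arbitrary: x rule: finite_induct)
  case (insert y S)
  obtain t where t: "\<forall>P\<in>F. (x \<in> P \<and> y \<in> P) \<or> x + t * y \<notin> P"
    using prime_avoidance_pair[OF F] by blast
  obtain w where w: "w \<in> gen_ideal S" "\<forall>P\<in>F. insert (x + t * y) S \<subseteq> P \<or> x + t * y + w \<notin> P"
    using insert.IH by blast
  have "w \<in> gen_ideal (insert y S)"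
    using w(1) R.span_mono[of S "insert y S"] by blast
  moreover have "t * y \<in> gen_ideal (insert y S)"
    by (intro R.span_scale R.span_base) simp
  ultimately have "t * y + w \<in> gen_ideal (insert y S)"
    by (intro R.span_add)
  moreover have "\<forall>P\<in>F. insert x (insert y S) \<subseteq> P \<or> x + (t * y + w) \<notin> P"
    using t w(2) by (auto simp: add.assoc)
  ultimately show ?case
    by blast
qed simp

lemma nzd_mod_avoidance:
  assumes Y: "ideal Y" "positive_depth Y" and S: "finite S" "m_primary (Y + gen_ideal (insert x S))"
  shows "\<exists>w\<in>gen_ideal S. nzd_mod Y (x + w)"
proof -
  have primes: "prime_ideal P" if "P \<in> associated_primes Y" for P
    using that by (simp add: associated_primes_def)
  obtain w where w: "w \<in> gen_ideal S" "\<forall>P\<in>associated_primes Y. insert x S \<subseteq> P \<or> x + w \<notin> P"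
    using prime_avoidance[OF finite_associated_primes[OF Y(1)] primes S(1)] by blast
  have "x + w \<notin> P" if P: "P \<in> associated_primes Y" for P
  proof
    assume "x + w \<in> P"
    then have "insert x S \<subseteq> P"
      using w(2) P by blast
    moreover have "Y \<subseteq> P"
      using P ideal_mult_right[OF Y(1)] by (auto simp: associated_primes_def)
    moreover have "ideal P"
      using primes[OF P] by (rule prime_idealD)
    ultimately have "m_primary P"
      using S(2) by (intro m_primary_mono[OF S(2)] R.set_plus_least R.span_minimal)
    then show False
      using m_primary_prime_eq_m[OF primes[OF P]] positive_depth_imp_m_not_associated[OF Y(2) P] by blast
  qed
  then have "nzd_mod Y (x + w)"
    using zero_divisor_in_associated_prime[OF Y(1)] by (intro nzd_modI) blast
  then show ?thesis
    using w(1) by blast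
qed

lemma regular_sop_avoidance:
  assumes Y: "ideal Y" and ys: "regular_sop Y (y # ys)" "ys \<noteq> []" and c: "nzd_mod Y c"
  shows "\<exists>w\<in>gen_ideal (set ys). nzd_mod (Y + gen_ideal {c}) (y + w)"
proof (rule nzd_mod_avoidance)
  let ?Yc = "Y + gen_ideal {c}"
  show Yc: "ideal ?Yc"
    using Y by (simp add: R.subspace_set_plus)
  obtain y' ys' where ys': "ys = y' # ys'"
    using ys(2) by (cases ys) auto
  show "positive_depth ?Yc"
    using ys(1) c unfolding ys' regular_sop_Cons by (intro regular_pair_positive_depth[OF Y, of y y']) auto
  show "m_primary (?Yc + gen_ideal (insert y (set ys)))"
  proof (rule m_primary_mono)
    show "m_primary (Y + gen_ideal (insert y (set ys)))"
      using ys(1) by (simp add: regular_sop_def)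
    show "Y + gen_ideal (insert y (set ys)) \<subseteq> ?Yc + gen_ideal (insert y (set ys))"
      by (intro set_plus_mono2 R.set_plus_upper_left R.subspace_span subset_refl)
    show "ideal (?Yc + gen_ideal (insert y (set ys)))"
      by (intro R.subspace_set_plus Yc R.subspace_span)
  qed
qed simp

theorem regular_sop_exchange:
  assumes "ideal Y" "regular_sop Y ys" "ys \<noteq> []" "nzd_mod Y c" "c \<in> m"
  shows "\<exists>zs. Suc (length zs) = length ys \<and> regular_sop Y (c # zs) \<and>
    (simple_socle (Y + gen_ideal (set ys)) \<longrightarrow> simple_socle (Y + gen_ideal (set (c # zs))))"
  using assms
proof (induction ys arbitrary: Y)
  case (Cons y1 rest)
  note Y = Cons.prems(1) and c = Cons.prems(4,5)
  have y1: "y1 \<in> m" "nzd_mod Y y1"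
    using Cons.prems(2) by (auto simp: regular_sop_Cons)
  show ?case
  proof (cases rest)
    case Nil
    then show ?thesis
      using Cons.prems m_primary_exchange[OF Y y1(1) _ c(1)] simple_socle_exchange[OF Y y1(2,1) c]
      by (intro exI[of _ "[]"]) (simp add: regular_sop_Cons regular_sop_Nil)
  next
    case (Cons y2 ys')
    let ?Yc = "Y + gen_ideal {c}"
    obtain w where w: "w \<in> gen_ideal (set rest)" "nzd_mod ?Yc (y1 + w)"
      using regular_sop_avoidance[OF Y Cons.prems(2) _ c(1)] Cons by blast
    let ?z = "y1 + w"
    let ?Yz = "Y + gen_ideal {?z}"
    have z: "nzd_mod Y ?z" "nzd_mod ?Yz c"
      using nzd_mod_swap[OF Y c(2,1) w(2)] by blast+
    have sop: "regular_sop Y (?z # rest)"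
      using regular_sop_replace_hd[OF Y Cons.prems(2) w(1)] .
    have "\<exists>zs. Suc (length zs) = length rest \<and> regular_sop ?Yz (c # zs) \<and>
        (simple_socle (?Yz + gen_ideal (set rest)) \<longrightarrow> simple_socle (?Yz + gen_ideal (set (c # zs))))"
      using Y sop z(2) c(2) Cons by (intro Cons.IH R.subspace_set_plus) (auto simp: regular_sop_Cons)
    then obtain zs where zs: "Suc (length zs) = length rest" "regular_sop ?Yz (c # zs)"
      "simple_socle (?Yz + gen_ideal (set rest)) \<longrightarrow> simple_socle (?Yz + gen_ideal (set (c # zs)))"
      by blast
    have swap: "?Yz + gen_ideal {c} = ?Yc + gen_ideal {?z}"
      by (simp only: ac_simps)
    have "regular_sop Y (c # ?z # zs)"
      using zs(2) sop w(2) c unfolding regular_sop_Cons swap by blast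
    moreover have "?Yz + gen_ideal (set (c # zs)) = Y + gen_ideal (set (c # ?z # zs))"
      unfolding plus_gen_ideal_Cons swap ..
    moreover have "?Yz + gen_ideal (set rest) = Y + gen_ideal (set (y1 # rest))"
      using plus_gen_ideal_replace[OF w(1)] plus_gen_ideal_Cons by metis
    ultimately show ?thesis
      using zs(1,3) by (intro exI[of _ "?z # zs"]) (simp only: list.size add_Suc_right add_0_right)
  qed
qed simp

theorem regular_generators_of_parameter_ideal:
  assumes "ideal Y" "regular_sop Y ys" "simple_socle (Y + gen_ideal (set ys))" "length ys = length xs"
    and "set xs \<subseteq> m" "m_primary (Y + gen_ideal (set xs))"
  shows "\<exists>zs. length zs = length xs \<and> regular_sop Y zs \<and>
    Y + gen_ideal (set zs) = Y + gen_ideal (set xs) \<and> simple_socle (Y + gen_ideal (set xs))"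
  using assms
proof (induction xs arbitrary: Y ys)
  case Nil
  then show ?case by auto
next
  case (Cons x xs)
  note Y = Cons.prems(1)
  obtain y ys' where ys: "ys = y # ys'"
    using Cons.prems(4) by (cases ys) auto
  then have "positive_depth Y"
    using Cons.prems(2) nzd_mod_positive_depth unfolding ys regular_sop_Cons by blast
  then obtain w where w: "w \<in> gen_ideal (set xs)" "nzd_mod Y (x + w)"
    using nzd_mod_avoidance[OF Y, of "set xs" x] Cons.prems(6) by auto
  let ?z = "x + w" and ?Yz = "Y + gen_ideal {x + w}"
  have "w \<in> m"
    using w(1) Cons.prems(5) R.span_minimal[of "set xs" m] by auto
  then have z: "?z \<in> m"
    using Cons.prems(5) by (simp add: R.subspace_add)
  have ideal_eq: "?Yz + gen_ideal (set xs) = Y + gen_ideal (set (x # xs))"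
    using plus_gen_ideal_replace[OF w(1)] plus_gen_ideal_Cons by metis
  obtain zs where zs: "Suc (length zs) = length ys" "regular_sop Y (?z # zs)"
    "simple_socle (Y + gen_ideal (set (?z # zs)))"
    using regular_sop_exchange[OF Y Cons.prems(2) _ w(2) z] Cons.prems(3) ys by blast
  have "\<exists>us. length us = length xs \<and> regular_sop ?Yz us \<and>
      ?Yz + gen_ideal (set us) = ?Yz + gen_ideal (set xs) \<and> simple_socle (?Yz + gen_ideal (set xs))"
  proof (rule Cons.IH)
    show "regular_sop ?Yz zs" "simple_socle (?Yz + gen_ideal (set zs))"
      using zs(2,3) unfolding regular_sop_Cons plus_gen_ideal_Cons by blast+
    show "m_primary (?Yz + gen_ideal (set xs))"
      unfolding ideal_eq by (rule Cons.prems(6))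
  qed (use Y zs(1) Cons.prems(4,5) in \<open>auto intro: R.subspace_set_plus\<close>)
  then obtain us where us: "length us = length xs" "regular_sop ?Yz us"
    "?Yz + gen_ideal (set us) = ?Yz + gen_ideal (set xs)" "simple_socle (?Yz + gen_ideal (set xs))"
    by blast
  then have "regular_sop Y (?z # us)"
    using z w(2) by (simp add: regular_sop_Cons)
  moreover have "Y + gen_ideal (set (?z # us)) = Y + gen_ideal (set (x # xs))"
    unfolding plus_gen_ideal_Cons using us(3) ideal_eq plus_gen_ideal_Cons by simp
  ultimately show ?case
    using us(1,4) unfolding ideal_eq by (intro exI[of _ "?z # us"]) simp
qed

end

section \<open>Duality over rings with simple socle\<close>

definition colon :: "'a::comm_ring_1 set \<Rightarrow> 'a set \<Rightarrow> 'a set" where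
  "colon Q K = {r. \<forall>k\<in>K. k * r \<in> Q}"

locale symmetric_pairing = local_module m scale
  for m :: "'a::comm_ring_1 set" and scale :: "'a \<Rightarrow> 'b::ab_group_add \<Rightarrow> 'b" (infixr "*s" 75) +
  fixes pair :: "'b \<Rightarrow> 'b \<Rightarrow> 'a" and Q :: "'a set"
  assumes pair_commute: "pair x y = pair y x"
    and pair_add: "pair (x + y) z = pair x z + pair y z"
    and pair_scale: "pair (r *s x) z = r * pair x z"
    and ideal_Q: "ideal Q" and simple_socle_Q: "simple_socle Q"
begin

lemma pair_add_right: "pair x (y + z) = pair x y + pair x z"
  using pair_add pair_commute by metis

lemma pair_scale_right: "pair x (r *s y) = r * pair x y"
  using pair_scale pair_commute by metis

lemma pair_diff_right: "pair x (y - z) = pair x y - pair x z"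
  using pair_add_right[of x "y - z" z] by simp

definition perp :: "'b set \<Rightarrow> 'b set" where
  "perp N = {y. \<forall>x\<in>N. pair x y \<in> Q}"

lemma subspace_perp [simp]: "subspace (perp N)"
proof (rule subspaceI)
  show "0 \<in> perp N"
    using pair_scale_right[of _ 0 0] R.subspace_0[OF ideal_Q] by (simp add: perp_def)
qed (auto simp: perp_def pair_add_right pair_scale_right ideal_Q R.subspace_add R.subspace_scale)

lemma perp_antimono: "N \<subseteq> N' \<Longrightarrow> perp N' \<subseteq> perp N"
  unfolding perp_def by blast

lemma subset_perp_perp: "N \<subseteq> perp (perp N)"
  unfolding perp_def using pair_commute by auto

lemma mem_perp_plus_span_iff:
  assumes "subspace N"
  shows "y \<in> perp (N + span {a}) \<longleftrightarrow> y \<in> perp N \<and> pair a y \<in> Q"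
proof
  assume "y \<in> perp (N + span {a})"
  moreover have "N \<subseteq> N + span {a}" "a \<in> N + span {a}"
    using set_plus_upper_left[of "span {a}" N] set_plus_upper_right[OF assms] mem_span_singleton(2)
    by blast+
  ultimately show "y \<in> perp N \<and> pair a y \<in> Q"
    unfolding perp_def by blast
next
  assume y: "y \<in> perp N \<and> pair a y \<in> Q"
  have "pair x y \<in> Q" if x: "x \<in> N + span {a}" for x
  proof -
    obtain r where "x - r *s a \<in> N"
      using x mem_plus_span_singleton by blast
    then have "pair (x - r *s a) y + r * pair a y \<in> Q"
      using y ideal_Q by (simp add: perp_def R.subspace_add R.subspace_scale)
    then show ?thesis
      using pair_add[of "x - r *s a" "r *s a" y] by (simp add: pair_scale)
  qed
  then show "y \<in> perp (N + span {a})"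
    by (simp add: perp_def)
qed

lemma len_between_perp_simple_extension:
  assumes N: "subspace N" and a: "\<And>r. r \<in> m \<Longrightarrow> r *s a \<in> N"
  shows "len_between (perp (N + span {a})) (perp N) \<le> 1"
proof (cases "perp N \<subseteq> perp (N + span {a})")
  case True
  then have "perp (N + span {a}) = perp N"
    using mem_perp_plus_span_iff[OF N] by blast
  then show ?thesis
    by (simp add: len_between_refl)
next
  case False
  let ?E = "perp (N + span {a})"
  obtain v where v: "v \<in> perp N" "pair a v \<notin> Q"
    using False mem_perp_plus_span_iff[OF N] by blast
  obtain u where u: "socle_generator Q u"
    using simple_socle_Q unfolding simple_socle_def by blast
  have socle: "r * pair a y \<in> Q" if "y \<in> perp N" "r \<in> m" for y r
    using that a unfolding perp_def pair_scale[symmetric] by blast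
  obtain s where s: "s * pair a v - u \<in> Q"
    using socle_generator_multiple[OF ideal_Q u v(2)] socle[OF v(1)] by blast
  have "perp N \<subseteq> ?E + span {v}"
  proof
    fix y assume y: "y \<in> perp N"
    obtain t where t: "pair a y - t * u \<in> Q"
      using socle_generatorD(3)[OF u] socle[OF y] by blast
    have "pair a (y - (t * s) *s v) \<in> Q"
      by (rule R.subspace_lincomb[OF ideal_Q t s, where a = 1 and b = "- t"])
        (simp add: pair_diff_right pair_scale_right algebra_simps)
    moreover have "y - (t * s) *s v \<in> perp N"
      using y v(1) by (simp add: subspace_diff subspace_scale)
    ultimately show "y \<in> ?E + span {v}"
      using mem_perp_plus_span_iff[OF N] mem_plus_span_singleton by blast
  qed
  then have "len_between ?E (perp N) \<le> len_between ?E (?E + span {v})"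
    using mem_perp_plus_span_iff[OF N] by (intro len_between_mono subspace_set_plus) auto
  also have "\<dots> \<le> 1"
    using mem_perp_plus_span_iff[OF N] socle[OF v(1)] v(1)
    by (intro len_between_plus_span_le_1) (simp_all add: pair_scale_right subspace_scale)
  finally show ?thesis .
qed

lemma len_between_perp_le:
  assumes "subspace N" "subspace N'" "N \<subseteq> N'" "len_between N N' = enat n"
  shows "len_between (perp N') (perp N) \<le> enat n"
  using assms
proof (induction n arbitrary: N)
  case 0
  then have "N = N'"
    using len_between_eq_0[of N' N] by (simp add: zero_enat_def)
  then show ?case
    by (simp add: len_between_refl)
next
  case (Suc n)
  obtain a where a: "a \<in> N'" "\<And>r. r \<in> m \<Longrightarrow> r *s a \<in> N" "len_between (N + span {a}) N' = enat n"
    using simple_extension_exists[OF Suc.prems(2,1,3,4)] by metis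
  have N'': "subspace (N + span {a})" "N \<subseteq> N + span {a}" "N + span {a} \<subseteq> N'"
    using Suc.prems a(1) plus_span_singleton_subset[of N' N a]
    by (simp_all add: subspace_set_plus set_plus_upper_left)
  have "len_between (perp N') (perp N)
      = len_between (perp N') (perp (N + span {a})) + len_between (perp (N + span {a})) (perp N)"
    using N'' by (intro len_between_add perp_antimono) simp_all
  also have "\<dots> \<le> enat n + 1"
    using Suc.IH[OF N''(1) Suc.prems(2) N''(3) a(3)] len_between_perp_simple_extension[OF Suc.prems(1) a(2)]
    by (rule add_mono)
  finally show ?case
    by (simp add: one_enat_def)
qed

theorem len_between_perp:
  assumes fin: "len_between (perp UNIV) UNIV \<noteq> \<infinity>" and N: "subspace N" "perp UNIV \<subseteq> N"
  shows "len_between (perp N) UNIV = len_between (perp UNIV) N"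
proof -
  have sum: "len_between (perp UNIV) UNIV = len_between (perp UNIV) N + len_between N UNIV"
    using N by (intro len_between_add) simp_all
  have dual_sum: "len_between (perp UNIV) UNIV = len_between (perp UNIV) (perp N) + len_between (perp N) UNIV"
    using perp_antimono[of N UNIV] by (intro len_between_add) simp_all
  have "perp (perp UNIV) = UNIV"
    using subset_perp_perp[of UNIV] by blast
  moreover have "len_between (perp UNIV) N \<noteq> \<infinity>" "len_between N UNIV \<noteq> \<infinity>"
    using fin unfolding sum plus_eq_infty_iff_enat by simp_all
  then obtain i j where ij: "len_between (perp UNIV) N = enat i" "len_between N UNIV = enat j"
    by auto
  ultimately have "len_between (perp N) UNIV \<le> enat i" "len_between (perp UNIV) (perp N) \<le> enat j"
    using len_between_perp_le[OF subspace_perp N(1) N(2) ij(1)]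
      len_between_perp_le[OF N(1) subspace_UNIV subset_UNIV ij(2)] by simp_all
  then show ?thesis
    using sum dual_sum ij
    by (cases "len_between (perp N) UNIV"; cases "len_between (perp UNIV) (perp N)") auto
qed

theorem perp_perp:
  assumes fin: "len_between (perp UNIV) UNIV \<noteq> \<infinity>" and N: "subspace N" "perp UNIV \<subseteq> N"
  shows "perp (perp N) = N"
proof -
  have P: "perp UNIV \<subseteq> perp N"
    by (rule perp_antimono) simp
  have "len_between N UNIV = len_between (perp (perp N)) UNIV"
    using len_between_perp[OF fin N] len_between_perp[OF fin subspace_perp P]
      len_between_add[OF subspace_UNIV subspace_perp N(1) N(2)]
      len_between_add[OF subspace_UNIV subspace_perp subspace_perp P] fin
    by (cases "len_between N UNIV"; cases "len_between (perp UNIV) N"; cases "len_between (perp N) UNIV";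
        cases "len_between (perp UNIV) (perp N)") auto
  moreover have "len_between N UNIV \<noteq> \<infinity>"
    using fin len_between_add[OF subspace_UNIV subspace_perp N(1) N(2)]
    by (simp add: plus_eq_infty_iff_enat)
  ultimately show ?thesis
    using len_between_cancel[OF N(1) subspace_perp subspace_UNIV subset_perp_perp] by simp
qed

end

context noetherian_local
begin

lemma symmetric_pairing_times:
  "ideal Q \<Longrightarrow> simple_socle Q \<Longrightarrow> symmetric_pairing m (*) (*) Q"
  by unfold_locales (simp_all add: algebra_simps)

theorem colength_colon:
  assumes Q: "m_primary Q" "simple_socle Q" and K: "ideal K" "Q \<subseteq> K"
  shows "colength (colon Q K) = R.len_between Q K"
proof -
  interpret D: symmetric_pairing m "(*)" "(*)" Q
    using m_primary_ideal[OF Q(1)] Q(2) by (rule symmetric_pairing_times)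
  have "D.perp UNIV = Q"
    using ideal_mult_right[OF m_primary_ideal[OF Q(1)]]
    by (auto simp: D.perp_def mult.commute dest: spec[of _ 1])
  moreover have "D.perp K = colon Q K"
    by (simp add: D.perp_def colon_def)
  ultimately show ?thesis
    using D.len_between_perp[of K] K colength_finite[OF Q(1)] by (simp add: subspace_times_eq_ideal)
qed

end

lemma ideal_colon_set: "ideal Q \<Longrightarrow> ideal (colon Q K)"
  by (auto simp: colon_def ideal_def distrib_left mult.left_commute)

lemma subset_colon: "ideal Q \<Longrightarrow> Q \<subseteq> colon Q K"
  by (auto simp: colon_def R.subspace_scale)

section \<open>The Hilbert-Samuel multiplicity\<close>

lemma ideal_pow_plus_principal_subset:
  assumes J: "ideal J"
  shows "ideal_pow (gen_ideal {x} + J) n \<subseteq>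
    (\<lambda>a. a * x) ` ideal_pow (gen_ideal {x} + J) (n - 1) + ideal_pow J n"
proof (induction n)
  case 0
  show ?case
    using R.set_plus_upper_right[OF R.subspace_image_scale, of UNIV "UNIV :: 'a set" x] by auto
next
  case (Suc n)
  let ?I = "gen_ideal {x} + J"
  show ?case
    unfolding diff_Suc_1 ideal_pow.simps(2)[of ?I]
  proof (rule R.ideal_scale_least)
    show "ideal ((\<lambda>a. a * x) ` ideal_pow ?I n + ideal_pow J (Suc n))"
      by (intro R.subspace_set_plus R.subspace_image_scale ideal_ideal_pow)
    fix a b assume "a \<in> ?I" and b: "b \<in> ideal_pow ?I n"
    then obtain r j where a: "a = r * x + j" "j \<in> J"
      by (auto elim: set_plus_elim simp: R.span_singleton)
    obtain c b' where c: "b = c * x + b'" "c \<in> ideal_pow ?I (n - 1)" "b' \<in> ideal_pow J n"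
      using b Suc.IH by (auto elim!: set_plus_elim)
    have "j \<in> ?I"
      using a(2) R.set_plus_upper_right[of "gen_ideal {x}" J] by auto
    then have "j * c \<in> ideal_pow ?I n"
      using c(2) mult_mem_ideal_pow_Suc[of j ?I c "n - 1"] by (cases n) simp_all
    then have "r * b + j * c \<in> ideal_pow ?I n"
      using b by (simp add: R.subspace_add R.subspace_scale)
    moreover have "j * b' \<in> ideal_pow J (Suc n)"
      using a(2) c(3) by (rule mult_mem_ideal_pow_Suc)
    moreover have "a * b = (r * b + j * c) * x + j * b'"
      using a(1) c(1) by (simp add: algebra_simps)
    ultimately show "a * b \<in> (\<lambda>a. a * x) ` ideal_pow ?I n + ideal_pow J (Suc n)"
      by (simp only:) (intro set_plus_intro imageI)
  qed
qed

lemma ideal_pow_plus_principal_subset':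
  assumes "ideal J"
  shows "ideal_pow (gen_ideal {x} + J) n \<subseteq> gen_ideal {x} + ideal_pow J n"
proof -
  have "(\<lambda>a. a * x) ` A \<subseteq> gen_ideal {x}" for A
    by auto
  then show ?thesis
    using ideal_pow_plus_principal_subset[OF assms, of x n] set_plus_mono2[of _ "gen_ideal {x}"]
    by (meson order_refl order_trans)
qed

lemma colon_ideal_pow_Suc_subset:
  assumes Y: "ideal Y" and J: "ideal J" and w: "nzd_mod (Y + ideal_pow J (Suc n)) w"
    and s: "w * s \<in> Y + ideal_pow (gen_ideal {w} + J) (Suc n)"
  shows "s \<in> Y + ideal_pow (gen_ideal {w} + J) n"
proof -
  let ?I = "gen_ideal {w} + J"
  obtain y i where "w * s = y + i" "y \<in> Y" "i \<in> ideal_pow ?I (Suc n)"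
    using s by (rule set_plus_elim)
  moreover obtain c b where "i = c * w + b" "c \<in> ideal_pow ?I n" "b \<in> ideal_pow J (Suc n)"
    using ideal_pow_plus_principal_subset[OF J, of w "Suc n"] \<open>i \<in> _\<close>
    unfolding diff_Suc_1 by (auto elim!: set_plus_elim simp del: ideal_pow.simps)
  ultimately have "w * (s - c) = y + b" and c: "c \<in> ideal_pow ?I n" and yb: "y \<in> Y" "b \<in> ideal_pow J (Suc n)"
    by (simp_all add: algebra_simps)
  then have "w * (s - c) \<in> Y + ideal_pow J (Suc n)"
    by (simp only: set_plus_intro)
  then have "s - c \<in> Y + ideal_pow J (Suc n)"
    by (rule nzd_modD[OF w])
  moreover have "ideal_pow J (Suc n) \<subseteq> ideal_pow ?I n"
    using ideal_pow_antimono[of n "Suc n" J] ideal_pow_mono[of J ?I n]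
      R.set_plus_upper_right[of "gen_ideal {w}" J]
    by (meson R.subspace_span le_SucI order_refl order_trans)
  ultimately have "s - c \<in> Y + ideal_pow ?I n"
    using set_plus_mono2[of Y Y] by blast
  moreover have "c \<in> Y + ideal_pow ?I n"
    using c R.set_plus_upper_right[OF Y] by blast
  ultimately have "(s - c) + c \<in> Y + ideal_pow ?I n"
    using Y by (intro R.subspace_add R.subspace_set_plus ideal_ideal_pow)
  then show ?thesis
    by simp
qed

lemma colon_ideal_pow_Suc_eq:
  assumes Y: "ideal Y" and J: "ideal J" and w: "nzd_mod (Y + ideal_pow J (Suc n)) w"
  shows "{r. r * w \<in> Y + ideal_pow (gen_ideal {w} + J) (Suc n)} = Y + ideal_pow (gen_ideal {w} + J) n"
proof
  let ?I = "gen_ideal {w} + J"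
  show "{r. r * w \<in> Y + ideal_pow ?I (Suc n)} \<subseteq> Y + ideal_pow ?I n"
    using colon_ideal_pow_Suc_subset[OF assms] by (auto simp: mult.commute simp del: ideal_pow.simps)
  show "Y + ideal_pow ?I n \<subseteq> {r. r * w \<in> Y + ideal_pow ?I (Suc n)}"
  proof
    fix r assume "r \<in> Y + ideal_pow ?I n"
    then obtain y c where r: "r = y + c" "y \<in> Y" "c \<in> ideal_pow ?I n"
      by (rule set_plus_elim)
    have "w \<in> ?I"
      using R.set_plus_upper_left[OF J, of "gen_ideal {w}"] by auto
    then have "y * w + w * c \<in> Y + ideal_pow ?I (Suc n)"
      by (intro set_plus_intro ideal_mult_right[OF Y r(2)] mult_mem_ideal_pow_Suc[OF _ r(3)])
    then show "r \<in> {r. r * w \<in> Y + ideal_pow ?I (Suc n)}"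
      by (simp only: mem_Collect_eq r(1) distrib_right mult.commute[of c w])
  qed
qed

lemma nzd_mod_ideal_pow_Suc:
  assumes Y: "ideal Y" and J: "ideal J" and w: "nzd_mod (Y + ideal_pow J (Suc n)) w"
    and x: "nzd_mod (Y + gen_ideal {w} + ideal_pow J (Suc n)) x"
    and IH: "nzd_mod (Y + ideal_pow (gen_ideal {w} + J) n) x"
  shows "nzd_mod (Y + ideal_pow (gen_ideal {w} + J) (Suc n)) x"
proof (rule nzd_modI)
  let ?I = "gen_ideal {w} + J"
  let ?YI = "Y + ideal_pow ?I (Suc n)"
  have YI: "ideal ?YI"
    using Y by (intro R.subspace_set_plus ideal_ideal_pow)
  fix r assume r: "x * r \<in> ?YI"
  have "?YI \<subseteq> Y + gen_ideal {w} + ideal_pow J (Suc n)"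
    unfolding add.assoc by (intro set_plus_mono2 ideal_pow_plus_principal_subset' J subset_refl)
  then have "r \<in> Y + gen_ideal {w} + ideal_pow J (Suc n)"
    using r nzd_modD[OF x] by blast
  then obtain y a b where r_eq: "r = y + a * w + b" "y \<in> Y" "b \<in> ideal_pow J (Suc n)"
    by (auto elim!: set_plus_elim simp: R.span_singleton simp del: ideal_pow.simps)
  have "ideal_pow J (Suc n) \<subseteq> ideal_pow ?I (Suc n)"
    by (rule ideal_pow_mono) (simp add: R.set_plus_upper_right)
  then have "b \<in> ideal_pow ?I (Suc n)"
    using r_eq(3) by (rule subsetD)
  with r_eq(2) have yb: "y + b \<in> ?YI"
    by (rule set_plus_intro)
  have "x * r - x * (y + b) \<in> ?YI"
    by (rule R.subspace_diff[OF YI r R.subspace_scale[OF YI yb]])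
  then have "w * (x * a) \<in> ?YI"
    using r_eq(1) by (simp add: algebra_simps del: ideal_pow.simps)
  then have "x * a \<in> Y + ideal_pow ?I n"
    by (rule colon_ideal_pow_Suc_subset[OF Y J w])
  then have "a \<in> Y + ideal_pow ?I n"
    by (rule nzd_modD[OF IH])
  then obtain y' c where a_eq: "a = y' + c" "y' \<in> Y" "c \<in> ideal_pow ?I n"
    by (rule set_plus_elim)
  have "w \<in> ?I"
    using R.set_plus_upper_left[OF J, of "gen_ideal {w}"] by auto
  then have "w * c \<in> ideal_pow ?I (Suc n)"
    using a_eq(3) by (rule mult_mem_ideal_pow_Suc)
  then have "y' * w + w * c \<in> ?YI"
    using ideal_mult_right[OF Y a_eq(2)] by (intro set_plus_intro)
  then have "(y + b) + (y' * w + w * c) \<in> ?YI"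
    by (rule R.subspace_add[OF YI yb])
  moreover have "r = (y + b) + (y' * w + w * c)"
    using r_eq(1) a_eq(1) by (simp add: algebra_simps)
  ultimately show "r \<in> ?YI"
    by simp
qed

lemma colength_ideal_pow_Suc:
  assumes Y: "ideal Y" and J: "ideal J" and w: "nzd_mod (Y + ideal_pow J (Suc n)) w"
  shows "colength (Y + ideal_pow (gen_ideal {w} + J) (Suc n))
    = colength (Y + ideal_pow (gen_ideal {w} + J) n) + colength (Y + gen_ideal {w} + ideal_pow J (Suc n))"
proof -
  let ?I = "gen_ideal {w} + J"
  let ?A = "Y + ideal_pow ?I (Suc n)"
  have A: "ideal ?A"
    using Y by (intro R.subspace_set_plus ideal_ideal_pow)
  have "J \<subseteq> ?I"
    by (simp add: R.set_plus_upper_right)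
  have "{r. r * w \<in> ?A} = Y + ideal_pow ?I n"
    by (rule colon_ideal_pow_Suc_eq[OF assms])
  moreover have "?A + gen_ideal {w} = Y + gen_ideal {w} + ideal_pow J (Suc n)"
  proof
    have "ideal (Y + (gen_ideal {w} + ideal_pow J (Suc n)))"
      by (intro R.subspace_set_plus Y ideal_ideal_pow R.subspace_span)
    moreover have "?A \<subseteq> Y + (gen_ideal {w} + ideal_pow J (Suc n))"
      by (intro set_plus_mono2 ideal_pow_plus_principal_subset' J subset_refl)
    moreover have "gen_ideal {w} \<subseteq> Y + (gen_ideal {w} + ideal_pow J (Suc n))"
      using Y R.set_plus_upper_right[of "Y + ideal_pow J (Suc n)" "gen_ideal {w}"]
      by (simp only: R.subspace_set_plus ideal_ideal_pow ac_simps)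
    ultimately show "?A + gen_ideal {w} \<subseteq> Y + gen_ideal {w} + ideal_pow J (Suc n)"
      unfolding add.assoc[of Y "gen_ideal {w}"] by (rule R.set_plus_least)
    have "Y + ideal_pow J (Suc n) + gen_ideal {w} \<subseteq> ?A + gen_ideal {w}"
      by (intro set_plus_mono2 ideal_pow_mono \<open>J \<subseteq> ?I\<close> subset_refl)
    then show "Y + gen_ideal {w} + ideal_pow J (Suc n) \<subseteq> ?A + gen_ideal {w}"
      by (simp only: ac_simps)
  qed
  moreover have "colength ?A = R.len_between ?A (?A + gen_ideal {w}) + colength (?A + gen_ideal {w})"
    by (intro R.len_between_add R.subspace_set_plus[OF A] R.set_plus_upper_left A
        R.subspace_UNIV R.subspace_span subset_UNIV)
  ultimately show ?thesis
    using R.len_between_plus_span_singleton[OF A, of w] by simp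
qed

context noetherian_local
begin

lemma nzd_mod_plus_ideal_pow:
  assumes "ideal Y" "set xs \<subseteq> m" "regular_seq Y xs" "nzd_mod (Y + gen_ideal (set xs)) x"
  shows "nzd_mod (Y + ideal_pow (gen_ideal (set xs)) n) x"
  using assms
proof (induction xs arbitrary: Y x n)
  case Nil
  then show ?case
    by (cases n) (simp_all add: ideal_pow_zero del: ideal_pow.simps(2))
next
  case (Cons w ws)
  note Y = Cons.prems(1)
  let ?J = "gen_ideal (set ws)"
  have Yw: "ideal (Y + gen_ideal {w})"
    using Y by (simp add: R.subspace_set_plus)
  have w: "nzd_mod (Y + ideal_pow ?J k) w" for k
    using regular_seq_rotateD[OF Cons.prems(1-3)] Cons.prems(2) by (intro Cons.IH Y) simp_all
  have x: "nzd_mod (Y + gen_ideal {w} + ideal_pow ?J k) x" for k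
    using Cons.prems(2-4) plus_gen_ideal_Cons[of Y w ws] by (intro Cons.IH Yw) simp_all
  have "nzd_mod (Y + ideal_pow (gen_ideal {w} + ?J) n) x"
  proof (induction n)
    case 0
    then show ?case
      using Y by simp
  next
    case (Suc n)
    then show ?case
      by (rule nzd_mod_ideal_pow_Suc[OF Y R.subspace_span w x])
  qed
  then show ?case
    by (simp only: list.set R.span_insert_eq_set_plus[of w "set ws"])
qed

theorem colength_ideal_pow_regular_seq:
  assumes "ideal Y" "set xs \<subseteq> m" "regular_seq Y xs"
  shows "colength (Y + ideal_pow (gen_ideal (set xs)) (Suc n))
    = enat ((n + length xs) choose length xs) * colength (Y + gen_ideal (set xs))"
  using assms
proof (induction xs arbitrary: Y n)
  case Nil
  then show ?case
    by (simp add: ideal_pow_zero one_enat_def[symmetric] del: ideal_pow.simps flip: One_nat_def)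
next
  case (Cons x xs)
  note Y = Cons.prems(1)
  let ?J = "gen_ideal (set xs)" and ?d = "length xs"
  let ?I = "gen_ideal {x} + ?J"
  let ?L = "colength (Y + ?I)"
  have Yx: "ideal (Y + gen_ideal {x})"
    using Y by (simp add: R.subspace_set_plus)
  have x: "nzd_mod (Y + ideal_pow ?J k) x" for k
    using regular_seq_rotateD[OF Cons.prems] Cons.prems(2) by (intro nzd_mod_plus_ideal_pow Y) simp_all
  have "colength (Y + ideal_pow ?I (Suc n)) = enat ((n + Suc ?d) choose Suc ?d) * ?L"
  proof (induction n)
    case 0
    have "ideal_pow ?I (Suc 0) = ?I"
      by (intro ideal_pow_1 R.subspace_set_plus R.subspace_span)
    then show ?case
      by (simp only: add_0 binomial_n_n one_enat_def[symmetric] mult_1)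
  next
    case (Suc n)
    have "colength (Y + ideal_pow ?I (Suc (Suc n)))
        = colength (Y + ideal_pow ?I (Suc n)) + colength (Y + gen_ideal {x} + ideal_pow ?J (Suc (Suc n)))"
      by (rule colength_ideal_pow_Suc[OF Y R.subspace_span x])
    also have "colength (Y + gen_ideal {x} + ideal_pow ?J (Suc (Suc n)))
        = enat ((Suc n + ?d) choose ?d) * colength (Y + gen_ideal {x} + ?J)"
      using Cons.prems(2,3) by (intro Cons.IH Yx) simp_all
    also have "colength (Y + ideal_pow ?I (Suc n))
          + enat ((Suc n + ?d) choose ?d) * colength (Y + gen_ideal {x} + ?J)
        = enat (((n + Suc ?d) choose Suc ?d) + ((Suc n + ?d) choose ?d)) * ?L"
      unfolding Suc.IH
      by (simp only: add.assoc distrib_right plus_enat_simps(1)[symmetric])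
    also have "((n + Suc ?d) choose Suc ?d) + ((Suc n + ?d) choose ?d) = (Suc n + Suc ?d) choose Suc ?d"
      by simp
    finally show ?case .
  qed
  then show ?case
    by (simp only: list.set list.size add_Suc_right add_0_right R.span_insert_eq_set_plus[of x "set xs"])
qed

end

lemma integral_power_mem:
  assumes "integral_over_ideal J a"
  shows "\<exists>N. \<forall>j. a ^ j \<in> ideal_pow J (j - N)"
proof -
  obtain n c where n: "n \<ge> 1" "\<And>i. i \<in> {1..n} \<Longrightarrow> c i \<in> ideal_pow J i"
    "a ^ n + (\<Sum>i=1..n. c i * a ^ (n - i)) = 0"
    using assms unfolding integral_over_ideal_def by blast
  have "a ^ j \<in> ideal_pow J (j - n)" for j
  proof (induction j rule: less_induct)
    case (less j)
    show ?case
    proof (cases "j < n")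
      case False
      have "a ^ n = - (\<Sum>i=1..n. c i * a ^ (n - i))"
        using n(3) by (simp add: eq_neg_iff_add_eq_0)
      then have "a ^ (j - n) * a ^ n = - (\<Sum>i=1..n. c i * (a ^ (j - n) * a ^ (n - i)))"
        by (simp add: sum_distrib_left mult.left_commute)
      then have "a ^ j = - (\<Sum>i=1..n. c i * a ^ (j - i))"
        using False by (simp add: power_add[symmetric])
      also have "\<dots> \<in> ideal_pow J (j - n)"
      proof (intro R.subspace_neg R.subspace_sum ideal_ideal_pow)
        fix i assume i: "i \<in> {1..n}"
        have "c i * a ^ (j - i) \<in> ideal_pow J (i + (j - i - n))"
          using n(2)[OF i] less[of "j - i"] i False by (intro mult_mem_ideal_pow_add) auto
        moreover have "j - n \<le> i + (j - i - n)"
          by simp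
        ultimately show "c i * a ^ (j - i) \<in> ideal_pow J (j - n)"
          using ideal_pow_antimono by blast
      qed
      finally show ?thesis .
    qed simp
  qed
  then show ?thesis
    by blast
qed

lemma ideal_pow_plus_integral:
  assumes A: "ideal A" "\<And>T. ideal_pow A T \<subseteq> ideal_pow J (T - c)"
    and a: "\<And>j. a ^ j \<in> ideal_pow J (j - N)"
    and x: "x \<in> ideal_pow (gen_ideal {a} + A) T"
  shows "x * a ^ k \<in> ideal_pow J (T + k - (c + N))"
  using x
proof (induction T arbitrary: x k)
  case 0
  have "x * a ^ k \<in> ideal_pow J (k - N)"
    using a by (intro R.subspace_scale ideal_ideal_pow)
  moreover have "0 + k - (c + N) \<le> k - N"
    by simp
  ultimately show ?case
    using ideal_pow_antimono by blast
next
  case (Suc T)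
  obtain y z where yz: "x = y * a + z" "y \<in> ideal_pow (gen_ideal {a} + A) T" "z \<in> ideal_pow A (Suc T)"
    using Suc.prems ideal_pow_plus_principal_subset[OF A(1), of a "Suc T"] unfolding diff_Suc_1
    by (auto elim!: set_plus_elim simp del: ideal_pow.simps)
  have "y * a ^ Suc k \<in> ideal_pow J (Suc T + k - (c + N))"
    using Suc.IH[OF yz(2), of "Suc k"] by simp
  moreover have "z * a ^ k \<in> ideal_pow J (Suc T + k - (c + N))"
  proof -
    have "z * a ^ k \<in> ideal_pow J ((Suc T - c) + (k - N))"
      using yz(3) A(2) a by (intro mult_mem_ideal_pow_add) blast+
    moreover have "Suc T + k - (c + N) \<le> (Suc T - c) + (k - N)"
      by simp
    ultimately show ?thesis
      using ideal_pow_antimono by blast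
  qed
  ultimately have "y * a ^ Suc k + z * a ^ k \<in> ideal_pow J (Suc T + k - (c + N))"
    by (intro R.subspace_add ideal_ideal_pow)
  then show ?case
    using yz(1) by (simp add: algebra_simps)
qed

lemma integral_ideal_pow_subset:
  assumes "finite S" "\<And>a. a \<in> S \<Longrightarrow> integral_over_ideal J a"
  shows "\<exists>c. \<forall>n. ideal_pow (gen_ideal S) n \<subseteq> ideal_pow J (n - c)"
  using assms
proof (induction S rule: finite_induct)
  case empty
  have "ideal_pow {0} n \<subseteq> ideal_pow J (n - 1)" for n
    by (cases n) (simp_all add: ideal_pow_zero R.subspace_0 del: ideal_pow.simps(2))
  then show ?case
    by (intro exI[of _ 1]) simp
next
  case (insert a S)
  obtain c where c: "\<And>n. ideal_pow (gen_ideal S) n \<subseteq> ideal_pow J (n - c)"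
    using insert by auto
  obtain N where N: "\<And>j. a ^ j \<in> ideal_pow J (j - N)"
    using integral_power_mem[of J a] insert.prems by auto
  have "ideal_pow (gen_ideal (insert a S)) n \<subseteq> ideal_pow J (n - (c + N))" for n
    unfolding R.span_insert_eq_set_plus[of a S]
    using ideal_pow_plus_integral[OF R.subspace_span c N, of _ n 0] by auto
  then show ?case
    by blast
qed

lemma binomial_coefficient_asymptotics:
  "(\<lambda>n. fact d * real ((n + a + d) choose d) / real (n + Suc b) ^ d) \<longlonglongrightarrow> 1"
proof (induction d)
  case (Suc d)
  have ratio: "(\<lambda>n. real (n + a + Suc d) / real (n + Suc b)) \<longlonglongrightarrow> 1"
  proof -
    have "(\<lambda>n. (real a + real d - real b) / real (n + Suc b)) \<longlonglongrightarrow> 0"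
      by (intro tendsto_divide_0[OF tendsto_const] filterlim_at_top_imp_at_infinity
          filterlim_compose[OF filterlim_real_sequentially] filterlim_add_const_nat_at_top)
    then have "(\<lambda>n. 1 + (real a + real d - real b) / real (n + Suc b)) \<longlonglongrightarrow> 1 + 0"
      by (intro tendsto_intros)
    moreover have "1 + (real a + real d - real b) / real (n + Suc b)
        = real (n + a + Suc d) / real (n + Suc b)" for n
      by (simp add: field_simps)
    ultimately show ?thesis
      by simp
  qed
  have "fact (Suc d) * real ((n + a + Suc d) choose Suc d) / real (n + Suc b) ^ Suc d
      = (fact d * real ((n + a + d) choose d) / real (n + Suc b) ^ d)
        * (real (n + a + Suc d) / real (n + Suc b))" for n
  proof -
    have "real (Suc d) * real ((n + a + Suc d) choose Suc d)
        = real (n + a + Suc d) * real ((n + a + d) choose d)"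
      using Suc_times_binomial_eq[of "n + a + d" d] by (metis add_Suc_right mult.commute of_nat_mult)
    then have "fact (Suc d) * real ((n + a + Suc d) choose Suc d)
        = fact d * (real (n + a + Suc d) * real ((n + a + d) choose d))"
      by (simp only: fact_Suc of_nat_mult mult.assoc mult.left_commute[of _ "fact d"])
    then show ?thesis
      by (simp only: power_Suc times_divide_times_eq ac_simps)
  qed
  then show ?case
    using tendsto_mult[OF Suc ratio] by simp
qed simp

lemma tendsto_if_binomially_bounded:
  fixes l :: "nat \<Rightarrow> nat"
  assumes lower: "\<And>n. ((n + d) choose d) * L \<le> l (n + Suc c)"
    and upper: "\<And>n. l (n + Suc c) \<le> ((n + c + d) choose d) * L"
  shows "(\<lambda>n. fact d * real (l n) / real n ^ d) \<longlonglongrightarrow> real L"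
proof (rule LIMSEQ_offset[of _ "Suc c"], rule tendsto_sandwich)
  let ?b = "\<lambda>a n. fact d * real ((n + a + d) choose d) / real (n + Suc c) ^ d * real L"
  have b: "?b a \<longlonglongrightarrow> real L" for a
    using tendsto_mult_right[OF binomial_coefficient_asymptotics[of d a c], of "real L"] by simp
  show "?b 0 \<longlonglongrightarrow> real L" "?b c \<longlonglongrightarrow> real L"
    by (rule b)+
  have scale: "fact d * real i / real (n + Suc c) ^ d \<le> fact d * real j / real (n + Suc c) ^ d"
    if "i \<le> j" for i j n
    using that by (intro divide_right_mono mult_left_mono) simp_all
  show "\<forall>\<^sub>F n in sequentially. ?b 0 n \<le> fact d * real (l (n + Suc c)) / real (n + Suc c) ^ d"
    using scale[OF lower] by (intro always_eventually allI) (simp add: mult.assoc)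
  show "\<forall>\<^sub>F n in sequentially. fact d * real (l (n + Suc c)) / real (n + Suc c) ^ d \<le> ?b c n"
    using scale[OF upper] by (intro always_eventually allI) (simp add: mult.assoc)
qed

context noetherian_local
begin

theorem hs_mult_reduction:
  assumes xs: "regular_sop {0} xs"
    and int: "\<And>a. a \<in> m \<Longrightarrow> integral_over_ideal (gen_ideal (set xs)) a"
  shows "hs_mult m (length xs) = real (len_quot (gen_ideal (set xs)))"
proof -
  let ?J = "gen_ideal (set xs)" and ?d = "length xs"
  have J: "set xs \<subseteq> m" "regular_seq {0} xs" "m_primary ?J"
    by (rule regular_sop_zeroD[OF xs])+
  have Jm: "?J \<subseteq> m"
    using J(1) by (simp add: R.span_minimal)
  obtain S where S: "finite S" "m = gen_ideal S"
    using ideal_finitely_generated[OF ideal_m] .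
  have "\<And>a. a \<in> S \<Longrightarrow> integral_over_ideal ?J a"
    using int S(2) R.span_base by blast
  then obtain c where c: "\<And>n. ideal_pow m n \<subseteq> ideal_pow ?J (n - c)"
    using integral_ideal_pow_subset[OF S(1), of ?J] S(2) by auto
  have m: "m_primary (ideal_pow m n)" for n
    unfolding m_primary_def using power_mem_ideal_pow[of _ m n] by auto
  have Jn: "m_primary (ideal_pow ?J n)" for n
    using m_primary_mono[OF m ideal_ideal_pow c, of "n + c"] by simp
  have len: "len_quot (ideal_pow ?J (Suc n)) = ((n + ?d) choose ?d) * len_quot ?J" for n
    using colength_ideal_pow_regular_seq[OF _ J(1,2), of n] len_quot_eq[OF Jn, of "Suc n"] len_quot_eq[OF J(3)]
    by (simp del: ideal_pow.simps)
  have "(\<lambda>n. fact ?d * real (len_quot (ideal_pow m n)) / real n ^ ?d) \<longlonglongrightarrow> real (len_quot ?J)"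
  proof (rule tendsto_if_binomially_bounded[of _ _ _ c])
    show "((n + ?d) choose ?d) * len_quot ?J \<le> len_quot (ideal_pow m (n + Suc c))" for n
      using len_quot_antimono[OF m ideal_ideal_pow c, of "n + Suc c"] len[of n]
      by (simp del: ideal_pow.simps)
    show "len_quot (ideal_pow m (n + Suc c)) \<le> ((n + c + ?d) choose ?d) * len_quot ?J" for n
      using len_quot_antimono[OF Jn ideal_ideal_pow ideal_pow_mono[OF Jm], of "n + Suc c"] len[of "n + c"]
      by (simp del: ideal_pow.simps)
  qed
  then show ?thesis
    unfolding hs_mult_def by (rule limI)
qed

lemma m_primary_reduction:
  assumes "ideal J" "\<And>a. a \<in> m \<Longrightarrow> integral_over_ideal J a"
  shows "m_primary J"
  unfolding m_primary_def
proof (intro conjI ballI assms(1))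
  fix a assume "a \<in> m"
  then obtain N where "\<And>j. a ^ j \<in> ideal_pow J (j - N)"
    using integral_power_mem[OF assms(2)] by blast
  then have "a ^ Suc N \<in> ideal_pow J (Suc N - N)" .
  then show "\<exists>n. a ^ n \<in> J"
    using ideal_pow_1[OF assms(1)] by (metis Suc_diff_le diff_self_eq_0 order_refl)
qed

end

section \<open>The Frobenius\<close>

lemma ideal_frob_pow [simp]: "ideal (frob_pow I q)"
  by (simp add: frob_pow_def)

lemma frob_pow_mem: "a \<in> I \<Longrightarrow> a ^ q \<in> frob_pow I q"
  unfolding frob_pow_def by (rule R.span_base) (rule imageI)

lemma power_times_mem_frob_pow: "a \<in> I \<Longrightarrow> a ^ q * r \<in> frob_pow I q"
  by (intro ideal_mult_right ideal_frob_pow frob_pow_mem)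

lemma frob_pow_least: "ideal K \<Longrightarrow> (\<And>a. a \<in> I \<Longrightarrow> a ^ q \<in> K) \<Longrightarrow> frob_pow I q \<subseteq> K"
  unfolding frob_pow_def by (rule R.span_minimal) auto

lemma frob_pow_mono: "I \<subseteq> J \<Longrightarrow> frob_pow I q \<subseteq> frob_pow J q"
  unfolding frob_pow_def by (intro R.span_mono image_mono)

lemma (in noetherian_local) m_primary_frob_pow:
  assumes "m_primary K"
  shows "m_primary (frob_pow K q)"
  unfolding m_primary_def
proof (intro conjI ballI ideal_frob_pow)
  fix a assume "a \<in> m"
  then obtain n where "a ^ n \<in> K"
    using assms unfolding m_primary_def by blast
  then have "a ^ (n * q) \<in> frob_pow K q"
    using frob_pow_mem[of "a ^ n" K q] by (simp add: power_mult)
  then show "\<exists>n. a ^ n \<in> frob_pow K q" ..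
qed

(* The module F_*R is R itself, with r acting as multiplication by r ^ q. *)
locale frobenius_power =
  fixes ty :: "'a::comm_ring_1 itself" and q :: nat
  assumes q_pos: "0 < q" and power_q_add: "\<And>a b :: 'a. (a + b) ^ q = a ^ q + b ^ q"
begin

sublocale frob: ring_module "\<lambda>r x :: 'a. r ^ q * x"
  by unfold_locales (simp_all add: distrib_left power_q_add distrib_right power_mult_distrib mult.assoc)

declare frob.scale_scale [simp del]

lemma power_q_zero: "(0 :: 'a) ^ q = 0"
  using q_pos by (simp add: zero_power)

lemma power_q_diff: "(a - b) ^ q = a ^ q - b ^ q" for a b :: 'a
  using frob.scale_left_diff_distrib[of a b 1] by simp

lemma power_q_sum: "(\<Sum>i\<in>I. f i) ^ q = (\<Sum>i\<in>I. f i ^ q)" for f :: "'i \<Rightarrow> 'a"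
  using frob.scale_sum_left[of f I 1] by simp

lemma ideal_imp_frob_subspace: "ideal S \<Longrightarrow> frob.subspace S" for S :: "'a set"
  by (simp add: frob.subspace_def ideal_def)

lemma frob_subspace_times_vimage: "frob.subspace W \<Longrightarrow> frob.subspace {x. c * x \<in> W}" for c :: 'a
  by (auto simp: frob.subspace_def distrib_left mult.left_commute[of c])

lemma ideal_power_q_vimage: "ideal K \<Longrightarrow> ideal {r. r ^ q \<in> K}" for K :: "'a set"
  using frob.ideal_colon[OF ideal_imp_frob_subspace, of K 1] by simp

lemma frob_pow_gen_ideal: "frob_pow (gen_ideal S) q = gen_ideal ((\<lambda>x. x ^ q) ` S)" for S :: "'a set"
proof
  have "gen_ideal S \<subseteq> {r. r ^ q \<in> gen_ideal ((\<lambda>x. x ^ q) ` S)}"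
    by (intro R.span_minimal ideal_power_q_vimage) (auto intro: R.span_base)
  then show "frob_pow (gen_ideal S) q \<subseteq> gen_ideal ((\<lambda>x. x ^ q) ` S)"
    by (intro frob_pow_least) auto
  show "gen_ideal ((\<lambda>x. x ^ q) ` S) \<subseteq> frob_pow (gen_ideal S) q"
    by (intro R.span_minimal) (auto intro: frob_pow_mem R.span_base)
qed

lemma frob_pow_principal: "frob_pow (gen_ideal {a}) q = gen_ideal {a ^ q}" for a :: 'a
  by (simp add: frob_pow_gen_ideal)

lemma frob_pow_plus:
  fixes I J :: "'a set"
  assumes "ideal I" "ideal J"
  shows "frob_pow (I + J) q = frob_pow I q + frob_pow J q"
proof -
  have "gen_ideal (I \<union> J) = I + J"
    using assms by (simp add: R.span_Un_eq_set_plus R.span_eq_iff[THEN iffD2])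
  then show ?thesis
    using frob_pow_gen_ideal[of "I \<union> J"] by (simp add: frob_pow_def image_Un R.span_Un_eq_set_plus)
qed

lemma frob_pow_frob_pow_mem:
  fixes K :: "'a set"
  assumes "r \<in> frob_pow K q'"
  shows "r ^ q \<in> frob_pow K (q' * q)"
proof -
  have "frob_pow K q' \<subseteq> {r. r ^ q \<in> frob_pow K (q' * q)}"
    by (intro frob_pow_least ideal_power_q_vimage ideal_frob_pow)
      (auto simp: power_mult[symmetric] intro: frob_pow_mem)
  then show ?thesis
    using assms by blast
qed

lemma frob_pow_subset_ideal_scale:
  fixes I :: "'a set"
  shows "frob_pow I q \<subseteq> frob.ideal_scale I UNIV"
proof (rule frob_pow_least)
  let ?S = "frob.ideal_scale I UNIV"
  have "frob.ideal_scale I UNIV \<subseteq> {x. c * x \<in> ?S}" for c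
    by (intro frob.ideal_scale_least frob_subspace_times_vimage frob.subspace_ideal_scale)
      (auto simp: mult.left_commute[of c] intro: frob.ideal_scale_mem)
  then show "ideal ?S"
    using frob.subspace_0[OF frob.subspace_ideal_scale] frob.subspace_add[OF frob.subspace_ideal_scale]
    unfolding ideal_def by blast
  show "a ^ q \<in> ?S" if "a \<in> I" for a
    using frob.ideal_scale_mem[OF that, of 1 UNIV] by simp
qed

end

lemma frobenius_power_mult:
  "frobenius_power TYPE('a::comm_ring_1) q \<Longrightarrow> frobenius_power TYPE('a) q' \<Longrightarrow> frobenius_power TYPE('a) (q' * q)"
  unfolding frobenius_power_def by (simp only: power_mult nat_0_less_mult_iff) simp

lemma (in frobenius_power) frob_span_UNIV_mult:
  assumes q': "frobenius_power TYPE('a) q'"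
    and S: "finite S" "frob.span S = (UNIV :: 'a set)"
    and T: "finite T" "module.span (\<lambda>r x. r ^ q' * x) T = (UNIV :: 'a set)"
  shows "module.span (\<lambda>r x. r ^ (q' * q) * x) ((\<lambda>(s, t). s * t ^ q) ` (S \<times> T)) = (UNIV :: 'a set)"
proof -
  interpret frob': frobenius_power "TYPE('a)" q'
    by (rule q')
  interpret comp: frobenius_power "TYPE('a)" "q' * q"
    using frobenius_power_axioms q' by (rule frobenius_power_mult)
  let ?U = "(\<lambda>(s, t). s * t ^ q) ` (S \<times> T)"
  have "x \<in> comp.frob.span ?U" for x
  proof -
    obtain c where c: "x = (\<Sum>s\<in>S. c s ^ q * s)"
      using frob.span_finite[OF S(1)] S(2) by fastforce
    have "\<exists>d. c s = (\<Sum>t\<in>T. d t ^ q' * t)" for s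
      using frob'.frob.span_finite[OF T(1)] T(2) by fastforce
    then obtain d where d: "c s = (\<Sum>t\<in>T. d s t ^ q' * t)" for s
      by metis
    have "c s ^ q * s = (\<Sum>t\<in>T. d s t ^ (q' * q) * (s * t ^ q))" for s
      unfolding d power_q_sum power_mult power_mult_distrib sum_distrib_right
      by (simp only: ac_simps)
    then have "x = (\<Sum>s\<in>S. \<Sum>t\<in>T. d s t ^ (q' * q) * (s * t ^ q))"
      unfolding c by (rule sum.cong[OF refl])
    also have "\<dots> \<in> comp.frob.span ?U"
      by (intro comp.frob.span_sum comp.frob.span_scale comp.frob.span_base) auto
    finally show ?thesis .
  qed
  then show ?thesis
    by blast
qed

locale frobenius_local = noetherian_local m + frobenius_power "TYPE('a)" q
  for m :: "'a::comm_ring_1 set" and q :: nat +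
  assumes residue_power_q: "\<exists>b. a - b ^ q \<in> m"
begin

sublocale frob: local_module m "\<lambda>r x :: 'a. r ^ q * x"
  by unfold_locales

lemma plus_gen_ideal_eq_plus_frob_span:
  assumes B: "ideal B" and a: "\<And>r. r \<in> m \<Longrightarrow> r * a \<in> B"
  shows "B + gen_ideal {a} = B + frob.span {a}"
proof
  show "B + frob.span {a} \<subseteq> B + gen_ideal {a}"
    by (intro set_plus_mono2) (auto simp: frob.span_singleton)
  show "B + gen_ideal {a} \<subseteq> B + frob.span {a}"
  proof
    fix x assume "x \<in> B + gen_ideal {a}"
    then obtain r where r: "x - r * a \<in> B"
      using R.mem_plus_span_singleton by blast
    obtain b where b: "r - b ^ q \<in> m"
      using residue_power_q by blast
    have "x - b ^ q * a \<in> B"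
      by (rule R.subspace_lincomb[OF B r a[OF b], where a = 1 and b = 1]) (simp add: algebra_simps)
    then show "x \<in> B + frob.span {a}"
      using frob.mem_plus_span_singleton by blast
  qed
qed

theorem frob_len_between_eq:
  assumes "ideal B" "ideal A" "B \<subseteq> A" "R.len_between B A = enat n"
  shows "frob.len_between B A = enat n"
  using assms
proof (induction n arbitrary: B)
  case 0
  then have "B = A"
    using R.len_between_eq_0[of A B] by (simp add: zero_enat_def)
  then show ?case
    by (simp add: frob.len_between_refl zero_enat_def)
next
  case (Suc n)
  obtain a where a: "a \<in> A" "a \<notin> B" "\<And>r. r \<in> m \<Longrightarrow> r * a \<in> B" "R.len_between (B + gen_ideal {a}) A = enat n"
    using R.simple_extension_exists[OF Suc.prems(2,1,3,4)] by metis
  let ?B = "B + gen_ideal {a}"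
  have B': "ideal ?B" "?B \<subseteq> A" "B \<subseteq> ?B"
    using Suc.prems a(1) R.plus_span_singleton_subset[of A B a]
    by (simp_all add: R.subspace_set_plus R.set_plus_upper_left)
  have "m \<subseteq> {r. r ^ q * a \<in> B}"
    using a(3) power_mem_m[OF _ q_pos] by blast
  moreover have "ideal {r. r ^ q * a \<in> B}"
    by (intro frob.ideal_colon ideal_imp_frob_subspace Suc.prems(1))
  moreover have "1 \<notin> {r. r ^ q * a \<in> B}"
    using a(2) by simp
  ultimately have "{r. r ^ q * a \<in> B} = m"
    using proper_ideal_subset_m by blast
  moreover have "?B = B + frob.span {a}"
    by (intro plus_gen_ideal_eq_plus_frob_span Suc.prems(1) a(3))
  ultimately have "frob.len_between B ?B = 1"
    using frob.len_between_plus_span_singleton[OF ideal_imp_frob_subspace[OF Suc.prems(1)], of a]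
    by (simp add: colength_m)
  moreover have "frob.len_between ?B A = enat n"
    using B' Suc.prems(2) a(4) by (intro Suc.IH)
  moreover have "frob.len_between B A = frob.len_between B ?B + frob.len_between ?B A"
    using B' Suc.prems by (intro frob.len_between_add ideal_imp_frob_subspace)
  ultimately show ?case
    by (simp add: one_enat_def)
qed

lemma frob_colength_eq: "m_primary Q \<Longrightarrow> frob.len_between Q UNIV = enat (len_quot Q)"
  using frob_len_between_eq[of Q UNIV] len_quot_eq[of Q] m_primary_ideal[of Q] by simp

end

locale frobenius_finite_local = frobenius_local +
  assumes frob_finite: "\<exists>S. finite S \<and> frob.span S = UNIV"
begin

lemma frob_span_eq_UNIV_if:
  assumes "frob_pow m q + frob.span S = UNIV"
  shows "frob.span S = UNIV"
proof -
  obtain T where T: "finite T" "frob.span T = UNIV"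
    using frob_finite by blast
  have "frob_pow m q + frob.span S \<subseteq> frob.ideal_scale m UNIV + frob.span S"
    by (intro set_plus_mono2 frob_pow_subset_ideal_scale subset_refl)
  then have "frob.span T \<subseteq> frob.span S + frob.ideal_scale m (frob.span T)"
    using assms unfolding T(2) by (simp add: add.commute)
  then have "frob.span T \<subseteq> frob.span S"
    by (rule frob.nakayama[OF T(1) frob.subspace_span])
  then show ?thesis
    using T(2) by blast
qed

lemma frob_generators:
  obtains S where "finite S" "card S \<le> len_quot (frob_pow m q)" "frob.span S = UNIV"
proof -
  have "frob.len_between (frob_pow m q) UNIV = enat (len_quot (frob_pow m q))"
    by (intro frob_colength_eq m_primary_frob_pow m_primary_m)
  then obtain S where S: "finite S" "card S \<le> len_quot (frob_pow m q)" "UNIV = frob_pow m q + frob.span S"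
    by (rule frob.generators_of_finite_length[OF frob.subspace_UNIV
          ideal_imp_frob_subspace[OF ideal_frob_pow] subset_UNIV])
  then show thesis
    using that[of S] frob_span_eq_UNIV_if[of S] by simp
qed

end

section \<open>The generic rank of the Frobenius\<close>

lemma pivot_elimination_sum:
  fixes a :: "'i \<Rightarrow> 'k \<Rightarrow> 'a::comm_ring_1" and r :: "'i \<Rightarrow> 'a" and k :: 'k
  assumes I: "finite I" "i \<in> I"
  defines "R \<equiv> \<lambda>j. if j = i then - (\<Sum>j\<in>I - {i}. r j * a j k) else a i k * r j"
  shows "(\<Sum>j\<in>I. R j * a j l) = (\<Sum>j\<in>I - {i}. r j * (a i k * a j l - a j k * a i l))"
proof -
  have "(\<Sum>j\<in>I. R j * a j l) = R i * a i l + (\<Sum>j\<in>I - {i}. R j * a j l)"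
    by (rule sum.remove[OF I])
  also have "(\<Sum>j\<in>I - {i}. R j * a j l) = (\<Sum>j\<in>I - {i}. a i k * r j * a j l)"
    by (rule sum.cong) (auto simp: R_def)
  also have "R i * a i l = - (\<Sum>j\<in>I - {i}. r j * a j k * a i l)"
    by (simp add: R_def sum_distrib_right)
  finally show ?thesis
    by (simp add: algebra_simps sum_subtractf)
qed

lemma linear_dependence_mod_prime:
  fixes a :: "'i \<Rightarrow> 'k \<Rightarrow> 'a::comm_ring_1"
  assumes P: "prime_ideal P" and "finite K" "finite I" "card K < card I"
  shows "\<exists>r. (\<forall>k\<in>K. (\<Sum>i\<in>I. r i * a i k) \<in> P) \<and> (\<exists>i\<in>I. r i \<notin> P)"
  using assms(2-)
proof (induction K arbitrary: I a rule: finite_induct)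
  case empty
  then obtain i where "i \<in> I"
    by fastforce
  then show ?case
    using prime_idealD(2)[OF P] by (intro exI[of _ "\<lambda>_. 1"]) auto
next
  case (insert k K)
  show ?case
  proof (cases "\<forall>i\<in>I. a i k \<in> P")
    case True
    obtain r where r: "\<forall>l\<in>K. (\<Sum>i\<in>I. r i * a i l) \<in> P" "\<exists>i\<in>I. r i \<notin> P"
      using insert.IH[of I a] insert.prems insert.hyps by auto
    have "(\<Sum>i\<in>I. r i * a i k) \<in> P"
      using True by (intro R.subspace_sum R.subspace_scale prime_idealD(1)[OF P]) blast
    then show ?thesis
      using r by (intro exI[of _ r]) blast
  next
    case False
    then obtain i where i: "i \<in> I" "a i k \<notin> P"
      by blast
    define a' where "a' j l = a i k * a j l - a j k * a i l" for j l
    have "card K < card (I - {i})"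
      using insert.prems insert.hyps i by simp
    then obtain r where r: "\<And>l. l \<in> K \<Longrightarrow> (\<Sum>j\<in>I - {i}. r j * a' j l) \<in> P" "\<exists>j\<in>I - {i}. r j \<notin> P"
      using insert.IH[of "I - {i}" a'] insert.prems by auto
    define R where "R j = (if j = i then - (\<Sum>j\<in>I - {i}. r j * a j k) else a i k * r j)" for j
    have elim: "(\<Sum>j\<in>I. R j * a j l) = (\<Sum>j\<in>I - {i}. r j * a' j l)" for l
      unfolding R_def a'_def by (rule pivot_elimination_sum[OF insert.prems(1) i(1)])
    have "(\<Sum>j\<in>I - {i}. r j * a' j k) = 0"
      by (simp add: a'_def mult.commute)
    then have "\<forall>l\<in>insert k K. (\<Sum>j\<in>I. R j * a j l) \<in> P"
      using elim r(1) R.subspace_0[OF prime_idealD(1)[OF P]] by auto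
    moreover obtain j where "j \<in> I - {i}" "r j \<notin> P"
      using r(2) by blast
    then have "R j \<notin> P" "j \<in> I"
      using prime_idealD(3)[OF P] i(2) by (auto simp: R_def)
    ultimately show ?thesis
      by blast
  qed
qed

definition frob_independent :: "nat \<Rightarrow> 'a::comm_ring_1 set \<Rightarrow> 'i set \<Rightarrow> ('i \<Rightarrow> 'a) \<Rightarrow> bool" where
  "frob_independent q P I f \<longleftrightarrow> (\<forall>c. (\<Sum>i\<in>I. c i ^ q * f i) \<in> P \<longrightarrow> (\<forall>i\<in>I. c i \<in> P))"

lemma frob_independentD:
  "frob_independent q P I f \<Longrightarrow> (\<Sum>i\<in>I. c i ^ q * f i) \<in> P \<Longrightarrow> i \<in> I \<Longrightarrow> c i \<in> P"
  by (simp add: frob_independent_def)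

lemma frob_independent_reindex:
  assumes h: "bij_betw h I J" and f: "frob_independent q P J f"
  shows "frob_independent q P I (f \<circ> h)"
  unfolding frob_independent_def
proof (intro allI impI ballI)
  fix c i assume c: "(\<Sum>i\<in>I. c i ^ q * (f \<circ> h) i) \<in> P" and i: "i \<in> I"
  have inv: "inv_into I h (h i) = i" if "i \<in> I" for i
    using h that by (simp add: bij_betw_inv_into_left)
  have "(\<Sum>j\<in>J. c (inv_into I h j) ^ q * f j) = (\<Sum>i\<in>I. c (inv_into I h (h i)) ^ q * f (h i))"
    by (rule sum.reindex_bij_betw[OF h, symmetric])
  also have "\<dots> = (\<Sum>i\<in>I. c i ^ q * (f \<circ> h) i)"
    by (rule sum.cong) (simp_all add: inv)
  finally have "c (inv_into I h (h i)) \<in> P"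
    using frob_independentD[OF f, of "\<lambda>j. c (inv_into I h j)" "h i"] c bij_betwE[OF h] i by simp
  then show "c i \<in> P"
    by (simp add: inv i)
qed

context frobenius_power
begin

lemma frob_independent_mult:
  fixes f :: "'i \<Rightarrow> 'a" and g :: "'j \<Rightarrow> 'a"
  assumes f: "frob_independent q P I f" and g: "frob_independent q' P J g"
  shows "frob_independent (q' * q) P (I \<times> J) (\<lambda>(i, j). f i * g j ^ q)"
  unfolding frob_independent_def
proof (intro allI impI ballI)
  fix c k assume c: "(\<Sum>k\<in>I \<times> J. c k ^ (q' * q) * (case k of (i, j) \<Rightarrow> f i * g j ^ q)) \<in> P" and k: "k \<in> I \<times> J"
  obtain i j where ij: "k = (i, j)" "i \<in> I" "j \<in> J"
    using k by blast
  have "(\<Sum>k\<in>I \<times> J. c k ^ (q' * q) * (case k of (i, j) \<Rightarrow> f i * g j ^ q))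
      = (\<Sum>i\<in>I. \<Sum>j\<in>J. c (i, j) ^ (q' * q) * (f i * g j ^ q))"
    by (simp add: sum.cartesian_product case_prod_unfold)
  also have "\<dots> = (\<Sum>i\<in>I. (\<Sum>j\<in>J. c (i, j) ^ q' * g j) ^ q * f i)"
    unfolding power_q_sum sum_distrib_right power_mult power_mult_distrib by (simp only: ac_simps)
  finally have "(\<Sum>j\<in>J. c (i, j) ^ q' * g j) \<in> P"
    using c frob_independentD[OF f _ ij(2), of "\<lambda>i. \<Sum>j\<in>J. c (i, j) ^ q' * g j"] by simp
  then show "c k \<in> P"
    unfolding ij(1) using frob_independentD[OF g _ ij(3), of "\<lambda>j. c (i, j)"] by simp
qed

lemma frob_independent_power:
  fixes f :: "nat \<Rightarrow> 'a"
  assumes f: "frob_independent q P {..<n} f"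
  shows "\<exists>g :: nat \<Rightarrow> 'a. frob_independent (q ^ e) P {..<n ^ e} g"
proof (induction e)
  case 0
  have "frob_independent 1 P {..<1 :: nat} (\<lambda>_. 1 :: 'a)"
    by (simp add: frob_independent_def)
  then show ?case
    by auto
next
  case (Suc e)
  then obtain g :: "nat \<Rightarrow> 'a" where g: "frob_independent (q ^ e) P {..<n ^ e} g"
    by blast
  obtain h where h: "bij_betw h {..<n ^ Suc e} ({..<n} \<times> {..<n ^ e})"
    using finite_same_card_bij[of "{..<n ^ Suc e}" "{..<n} \<times> {..<n ^ e}"]
    by (auto simp: card_cartesian_product)
  have "frob_independent (q ^ e * q) P {..<n ^ Suc e} ((\<lambda>(i, j). f i * g j ^ q) \<circ> h)"
    by (rule frob_independent_reindex[OF h frob_independent_mult[OF f g]])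
  then show ?case
    by (auto simp: mult.commute)
qed

lemma frob_independent_card_le:
  fixes P S :: "'a set"
  assumes P: "prime_ideal P" and f: "frob_independent q P I f" and I: "finite I"
    and S: "finite S" "P + frob.span S = UNIV"
  shows "card I \<le> card S"
proof (rule ccontr)
  assume "\<not> card I \<le> card S"
  have ideal_P: "ideal P"
    by (rule prime_idealD(1)[OF P])
  have "\<exists>d. f i - (\<Sum>y\<in>S. d y ^ q * y) \<in> P" for i
  proof -
    have "f i \<in> P + frob.span S"
      unfolding S(2) ..
    then obtain b d where "f i = b + (\<Sum>y\<in>S. d y ^ q * y)" "b \<in> P"
      unfolding frob.span_finite[OF S(1)] by (auto elim!: set_plus_elim)
    then show ?thesis
      by (intro exI[of _ d]) simp
  qed
  then obtain a where a: "\<And>i. f i - (\<Sum>y\<in>S. a i y ^ q * y) \<in> P"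
    by metis
  obtain r where r: "\<forall>y\<in>S. (\<Sum>i\<in>I. r i * a i y) \<in> P" "\<exists>i\<in>I. r i \<notin> P"
    using linear_dependence_mod_prime[OF P S(1) I, of a] \<open>\<not> card I \<le> card S\<close> by auto
  have "(\<Sum>i\<in>I. r i ^ q * (f i - (\<Sum>y\<in>S. a i y ^ q * y))) \<in> P"
    by (intro R.subspace_sum R.subspace_scale ideal_P a)
  then have diff: "(\<Sum>i\<in>I. r i ^ q * f i) - (\<Sum>i\<in>I. \<Sum>y\<in>S. (r i * a i y) ^ q * y) \<in> P"
    unfolding right_diff_distrib sum_subtractf sum_distrib_left power_mult_distrib by (simp only: ac_simps)
  moreover have "(\<Sum>i\<in>I. \<Sum>y\<in>S. (r i * a i y) ^ q * y) = (\<Sum>y\<in>S. (\<Sum>i\<in>I. r i * a i y) ^ q * y)"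
    by (subst sum.swap) (simp add: power_q_sum sum_distrib_right)
  moreover have "(\<Sum>y\<in>S. (\<Sum>i\<in>I. r i * a i y) ^ q * y) \<in> P"
  proof (intro R.subspace_sum ideal_P)
    fix y assume "y \<in> S"
    then show "(\<Sum>i\<in>I. r i * a i y) ^ q * y \<in> P"
      using r(1) ideal_power_mono[OF ideal_P, of _ 1 q] q_pos by (intro ideal_mult_right ideal_P) simp
  qed
  ultimately have "(\<Sum>i\<in>I. r i ^ q * f i) \<in> P"
    using R.subspace_diff_mem_iff[OF ideal_P diff] by simp
  then show False
    using frob_independentD[OF f] r(2) by blast
qed

lemma multiple_mem_maximal_frob_independent:
  fixes P :: "'a set"
  assumes P: "prime_ideal P" and f: "frob_independent q P {..<n} f"
    and max: "\<And>g. \<not> frob_independent q P {..<Suc n} g"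
  shows "\<exists>c. c \<notin> P \<and> c ^ q * s \<in> P + frob.span (f ` {..<n})"
proof -
  obtain c i where c: "(\<Sum>i<Suc n. c i ^ q * (f(n := s)) i) \<in> P" and i: "i < Suc n" "c i \<notin> P"
    using max[of "f(n := s)"] unfolding frob_independent_def by (metis lessThan_iff)
  let ?t = "\<Sum>i<n. c i ^ q * f i"
  have rel: "?t + c n ^ q * s \<in> P"
    using c by simp
  have "c n \<notin> P"
  proof
    assume "c n \<in> P"
    then have "c n ^ q * s \<in> P"
      using ideal_power_mono[OF prime_idealD(1)[OF P], of "c n" 1 q] q_pos prime_idealD(1)[OF P]
      by (intro ideal_mult_right) simp_all
    then have "?t \<in> P"
      using R.subspace_diff[OF prime_idealD(1)[OF P] rel, of "c n ^ q * s"] by simp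
    then show False
      using frob_independentD[OF f] i \<open>c n \<in> P\<close> by (auto simp: less_Suc_eq)
  qed
  moreover have "- ?t \<in> frob.span (f ` {..<n})"
    by (intro frob.span_neg frob.span_sum frob.span_scale frob.span_base imageI)
  then have "(?t + c n ^ q * s) + (- ?t) \<in> P + frob.span (f ` {..<n})"
    by (rule set_plus_intro[OF rel])
  then have "c n ^ q * s \<in> P + frob.span (f ` {..<n})"
    by simp
  ultimately show ?thesis
    by blast
qed

lemma frob_common_denominator:
  fixes P W S :: "'a set"
  assumes P: "prime_ideal P" and S: "finite S" "frob.span S = UNIV" and W: "frob.subspace W"
    and ex: "\<And>s. \<exists>c. c \<notin> P \<and> c ^ q * s \<in> W"
  shows "\<exists>c. c \<notin> P \<and> (\<forall>r. c ^ q * r \<in> W)"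
proof -
  obtain c where c: "\<And>s. c s \<notin> P" "\<And>s. c s ^ q * s \<in> W"
    using ex by metis
  let ?C = "\<Prod>s\<in>S. c s"
  have "?C ^ q * s \<in> W" if s: "s \<in> S" for s
  proof -
    have "?C = (\<Prod>t\<in>S - {s}. c t) * c s"
      using S(1) s by (simp add: prod.remove mult.commute)
    then have "?C ^ q * s = (\<Prod>t\<in>S - {s}. c t) ^ q * (c s ^ q * s)"
      by (simp only: power_mult_distrib mult.assoc)
    then show ?thesis
      using frob.subspace_scale[OF W c(2)] by simp
  qed
  then have "frob.span S \<subseteq> {r. ?C ^ q * r \<in> W}"
    by (intro frob.span_minimal frob_subspace_times_vimage[OF W]) blast
  then have "\<forall>r. ?C ^ q * r \<in> W"
    using S(2) by blast
  moreover have "?C \<notin> P"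
    by (rule prime_ideal_prod_notin[OF P c(1)])
  ultimately show ?thesis
    by blast
qed

end

context noetherian_local
begin

(* The ring embeds into the product of its quotients by the primes in F; E P lives on the factor P. *)
lemma orthogonal_elements_reduced:
  assumes "reduced_ring TYPE('a)"
  obtains F :: "'a set set" and E where "finite F" "\<And>P. P \<in> F \<Longrightarrow> prime_ideal P" "\<Inter>F = {0}"
    "\<And>P. P \<in> F \<Longrightarrow> E P \<notin> P" "\<And>P x. P \<in> F \<Longrightarrow> x \<in> P \<Longrightarrow> E P * x = 0"
    "\<And>P Q. P \<in> F \<Longrightarrow> Q \<in> F \<Longrightarrow> P \<noteq> Q \<Longrightarrow> E P \<in> Q"
proof -
  let ?good = "\<lambda>F. finite F \<and> (\<forall>P\<in>F. prime_ideal P) \<and> \<Inter>F = {0 :: 'a}"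
  have "?good (associated_primes {0})"
    using Inter_associated_primes_reduced[OF assms] finite_associated_primes[of "{0}"]
    by (auto simp: associated_primes_def)
  then have "?good (arg_min card ?good) \<and> (\<forall>G. ?good G \<longrightarrow> card (arg_min card ?good) \<le> card G)"
    by (rule arg_min_nat_lemma)
  then obtain F where F: "?good F" "\<And>G. ?good G \<Longrightarrow> card F \<le> card G"
    by blast
  have "\<exists>e. e \<notin> P \<and> (\<forall>Q\<in>F - {P}. e \<in> Q)" if P: "P \<in> F" for P
  proof (rule ccontr)
    assume "\<nexists>e. e \<notin> P \<and> (\<forall>Q\<in>F - {P}. e \<in> Q)"
    then have "\<Inter>(F - {P}) = \<Inter>F"
      by blast
    then have "?good (F - {P})"
      using F(1) by simp
    then have "card F \<le> card (F - {P})"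
      by (rule F(2))
    then show False
      using card_Diff1_less[of F P] F(1) P by simp
  qed
  then obtain E where E: "\<And>P. P \<in> F \<Longrightarrow> E P \<notin> P" "\<And>P Q. P \<in> F \<Longrightarrow> Q \<in> F \<Longrightarrow> P \<noteq> Q \<Longrightarrow> E P \<in> Q"
    by (metis Diff_iff singletonD)
  have "E P * x \<in> Q" if "P \<in> F" "x \<in> P" "Q \<in> F" for P Q x
    using that E(2)[of P Q] F(1) prime_idealD(1)[of Q]
      R.subspace_scale[of Q x "E P"] ideal_mult_right[of Q "E P" x]
    by (cases "P = Q") auto
  then have "E P * x = 0" if "P \<in> F" "x \<in> P" for P x
    using that F(1) by blast
  then show thesis
    using that[of F E] F(1) E by blast
qed

end

lemma nzd_mod_zero_if_avoids_primes:
  assumes F: "\<And>P. P \<in> F \<Longrightarrow> prime_ideal P" "\<Inter>F = {0}" and c: "\<And>P. P \<in> F \<Longrightarrow> c \<notin> P"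
  shows "nzd_mod {0} c"
proof (rule nzd_modI)
  fix r assume "c * r \<in> {0}"
  then have "r \<in> P" if "P \<in> F" for P
    using prime_idealD(1)[OF F(1)[OF that]] prime_idealD(3)[OF F(1)[OF that], of c r] c[OF that]
      R.subspace_0[of P]
    by simp
  then show "r \<in> {0}"
    using F(2) by blast
qed

lemma (in frobenius_power) frob_span_glue:
  fixes F :: "'p set" and E :: "'p \<Rightarrow> 'a" and f :: "'p \<Rightarrow> 'j \<Rightarrow> 'a"
  assumes F: "finite F" "\<And>P Q. P \<in> F \<Longrightarrow> Q \<in> F \<Longrightarrow> P \<noteq> Q \<Longrightarrow> E P * E Q = 0"
    and P: "P \<in> F" and v: "v \<in> frob.span (f P ` I)"
  shows "E P ^ (2 * q) * v \<in> frob.span ((\<lambda>j. \<Sum>P\<in>F. E P ^ q * f P j) ` I)" (is "_ \<in> ?W")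
proof -
  have "E P ^ (2 * q) * f P j \<in> ?W" if j: "j \<in> I" for j
  proof -
    have "E P ^ q * (E Q ^ q * f Q j) = (if Q = P then E P ^ (2 * q) * f P j else 0)" if "Q \<in> F" for Q
      using F(2)[OF P that] power_q_zero
      by (auto simp: mult.assoc[symmetric] power_mult_distrib[symmetric] power_mult power2_eq_square)
    then have "E P ^ q * (\<Sum>Q\<in>F. E Q ^ q * f Q j) = (\<Sum>Q\<in>F. if Q = P then E P ^ (2 * q) * f P j else 0)"
      unfolding sum_distrib_left by (rule sum.cong[OF refl])
    also have "\<dots> = E P ^ (2 * q) * f P j"
      using P F(1) by simp
    finally have "E P ^ (2 * q) * f P j = E P ^ q * (\<Sum>Q\<in>F. E Q ^ q * f Q j)" ..
    also have "\<dots> \<in> ?W"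
      by (intro frob.span_scale frob.span_base imageI j)
    finally show ?thesis .
  qed
  then have "frob.span (f P ` I) \<subseteq> {v. E P ^ (2 * q) * v \<in> ?W}"
    by (intro frob.span_minimal frob_subspace_times_vimage frob.subspace_span) auto
  then show ?thesis
    using v by blast
qed

lemma (in frobenius_power) frob_denominator_glue:
  fixes F :: "'a set set" and E c :: "'a set \<Rightarrow> 'a" and f :: "'a set \<Rightarrow> 'j \<Rightarrow> 'a"
  assumes F: "finite F" "\<And>P Q. P \<in> F \<Longrightarrow> Q \<in> F \<Longrightarrow> P \<noteq> Q \<Longrightarrow> E P * E Q = 0"
    and P: "P \<in> F" "\<And>x. x \<in> P \<Longrightarrow> E P * x = 0" and c: "c P ^ q * r \<in> P + frob.span (f P ` I)"
  shows "(E P ^ 2 * c P) ^ q * r \<in> frob.span ((\<lambda>j. \<Sum>P\<in>F. E P ^ q * f P j) ` I)"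
proof -
  obtain y v where v: "c P ^ q * r = y + v" "y \<in> P" "v \<in> frob.span (f P ` I)"
    using c by (rule set_plus_elim)
  have "E P ^ Suc (2 * q - 1) * y = 0"
    using P(2)[OF v(2)] by (simp add: mult.assoc mult.left_commute[of "E P"])
  then have "E P ^ (2 * q) * y = 0"
    using q_pos by simp
  moreover have "(E P ^ 2 * c P) ^ q * r = E P ^ (2 * q) * (y + v)"
    by (simp only: v(1)[symmetric] power_mult_distrib power_mult mult.assoc)
  ultimately have "(E P ^ 2 * c P) ^ q * r = E P ^ (2 * q) * v"
    by (simp add: distrib_left)
  then show ?thesis
    using frob_span_glue[where E = E and f = f, OF F P(1) v(3)] by simp
qed

lemma (in frobenius_local) frob_generic_surjection:
  assumes reduced: "reduced_ring TYPE('a)"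
    and gen: "\<And>P :: 'a set. prime_ideal P \<Longrightarrow>
      \<exists>(f :: nat \<Rightarrow> 'a) c. c \<notin> P \<and> (\<forall>r. c ^ q * r \<in> P + frob.span (f ` {..<n}))"
  shows "\<exists>(g :: nat \<Rightarrow> 'a) c. nzd_mod {0} c \<and> (\<forall>r. c ^ q * r \<in> frob.span (g ` {..<n}))"
proof -
  obtain F :: "'a set set" and E where F: "finite F" "\<And>P. P \<in> F \<Longrightarrow> prime_ideal P" "\<Inter>F = {0}"
    and E: "\<And>P. P \<in> F \<Longrightarrow> E P \<notin> P" "\<And>P x. P \<in> F \<Longrightarrow> x \<in> P \<Longrightarrow> E P * x = 0"
      "\<And>P Q. P \<in> F \<Longrightarrow> Q \<in> F \<Longrightarrow> P \<noteq> Q \<Longrightarrow> E P \<in> Q"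
    by (rule orthogonal_elements_reduced[OF reduced]) (rule that)
  have "\<exists>f c. P \<in> F \<longrightarrow> c \<notin> P \<and> (\<forall>r. c ^ q * r \<in> P + frob.span (f ` {..<n}))" for P
    using gen[of P] F(2)[of P] by blast
  then obtain f c where fc: "\<And>P. P \<in> F \<Longrightarrow> c P \<notin> P"
    "\<And>P r. P \<in> F \<Longrightarrow> c P ^ q * r \<in> P + frob.span (f P ` {..<n})"
    by metis
  have orthogonal: "E P * E Q = 0" if "P \<in> F" "Q \<in> F" "P \<noteq> Q" for P Q
    using that by (intro E(2) E(3)) auto
  let ?W = "frob.span ((\<lambda>j. \<Sum>P\<in>F. E P ^ q * f P j) ` {..<n})"
  let ?C = "\<Sum>P\<in>F. E P ^ 2 * c P"
  have "(E P ^ 2 * c P) ^ q * r \<in> ?W" if P: "P \<in> F" for P r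
    by (rule frob_denominator_glue[where E = E and f = f and c = c,
          OF F(1) orthogonal P E(2)[OF P] fc(2)[OF P]])
  then have "?C ^ q * r \<in> ?W" for r
    unfolding power_q_sum sum_distrib_right by (intro frob.span_sum)
  moreover have "?C \<notin> P" if P: "P \<in> F" for P
  proof
    assume "?C \<in> P"
    moreover have "?C = E P ^ 2 * c P + (\<Sum>Q\<in>F - {P}. E Q ^ 2 * c Q)"
      using F(1) P by (rule sum.remove)
    moreover have "(\<Sum>Q\<in>F - {P}. E Q ^ 2 * c Q) \<in> P"
      using E(3)[of _ P] P prime_idealD(1)[OF F(2)[OF P]]
      by (intro R.subspace_sum ideal_mult_right) (auto simp: power2_eq_square intro: ideal_mult_right)
    ultimately have "E P ^ 2 * c P \<in> P"
      using R.subspace_diff[OF prime_idealD(1)[OF F(2)[OF P]], of ?C "\<Sum>Q\<in>F - {P}. E Q ^ 2 * c Q"] by simp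
    then show False
      using prime_idealD(3)[OF F(2)[OF P]] E(1)[OF P] fc(1)[OF P] unfolding power2_eq_square by blast
  qed
  then have "nzd_mod {0} ?C"
    using F(2,3) by (simp add: nzd_mod_zero_if_avoids_primes[of F])
  ultimately show ?thesis
    by blast
qed

locale F_finite_local = noetherian_local_infinite m for m :: "'a::comm_ring_1 set" +
  fixes p :: nat
  assumes prime_p: "prime p" and CHAR_eq: "CHAR('a) = p"
    and F_finite: "F_finite p TYPE('a)" and perfect_residue_field: "residue_field_perfect p m"
begin

lemma p_gt_1: "1 < p"
  using prime_p by (rule prime_gt_1_nat)

lemma frobenius_power_p: "frobenius_power TYPE('a) (p ^ e)"
  using p_gt_1 prime_p CHAR_eq by unfold_locales (auto intro: freshmans_dream')

lemma residue_p_power_root: "\<exists>b. a - b ^ (p ^ e) \<in> m"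
proof (induction e)
  case (Suc e)
  then obtain b where b: "a - b ^ (p ^ e) \<in> m"
    by blast
  obtain c where "b - c ^ p \<in> m"
    using perfect_residue_field unfolding residue_field_perfect_def by blast
  then have "b ^ (p ^ e) - (c ^ p) ^ (p ^ e) \<in> m"
    by (rule ideal_power_diff[OF ideal_m])
  then have "a - c ^ (p ^ Suc e) \<in> m"
    using R.subspace_add[OF ideal_m b, of "b ^ (p ^ e) - (c ^ p) ^ (p ^ e)"] by (simp add: power_mult)
  then show ?case ..
qed (auto intro: exI[of _ a] simp: R.subspace_0)

lemma frob_p_power_finite:
  "\<exists>S. finite S \<and> module.span (\<lambda>r x :: 'a. r ^ (p ^ e) * x) S = UNIV"
proof -
  interpret frob1: frobenius_power "TYPE('a)" p
    using frobenius_power_p[of 1] by simp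
  obtain S :: "'a set" where S: "finite S" "\<And>r. \<exists>c. r = (\<Sum>s\<in>S. c s ^ p * s)"
    using F_finite unfolding F_finite_def by blast
  then have span_S: "frob1.frob.span S = UNIV"
    by (auto simp: frob1.frob.span_finite)
  show ?thesis
  proof (induction e)
    case 0
    have "module.span (\<lambda>r x :: 'a. r ^ (p ^ 0) * x) {1} = UNIV"
      by (simp add: span_times_eq_gen_ideal)
    then show ?case
      by blast
  next
    case (Suc e)
    then obtain T :: "'a set" where T: "finite T" "module.span (\<lambda>r x. r ^ (p ^ e) * x) T = UNIV"
      by blast
    have "module.span (\<lambda>r x. r ^ (p ^ e * p) * x) ((\<lambda>(s, t). s * t ^ p) ` (S \<times> T)) = UNIV"
      by (rule frob1.frob_span_UNIV_mult[OF frobenius_power_p S(1) span_S T])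
    then show ?case
      using S(1) T(1) by (intro exI[of _ "(\<lambda>(s, t). s * t ^ p) ` (S \<times> T)"]) (simp add: mult.commute)
  qed
qed

theorem frobenius_finite_local_p_power: "frobenius_finite_local m (p ^ e)"
proof -
  interpret frobenius_power "TYPE('a)" "p ^ e"
    by (rule frobenius_power_p)
  show ?thesis
    by unfold_locales (fact residue_p_power_root frob_p_power_finite)+
qed

end

sublocale F_finite_local \<subseteq> frobenius_finite_local m p
  using frobenius_finite_local_p_power[of 1] by simp

lemma (in frobenius_local) len_quot_frob_pow_parameters:
  assumes xs: "regular_sop {0} xs"
  shows "len_quot (frob_pow (gen_ideal (set xs)) q) = q ^ length xs * len_quot (gen_ideal (set xs))"
proof -
  have J: "m_primary (gen_ideal (set xs))"
    by (rule regular_sop_zeroD[OF xs])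
  have "colength (gen_ideal ((\<lambda>x. x ^ q) ` set xs)) = enat (q ^ length xs) * colength (gen_ideal (set xs))"
    using colength_regular_seq_powers[OF R.subspace_single_0 regular_sop_zeroD(1,2)[OF xs] q_pos] by simp
  then show ?thesis
    using len_quot_eq[OF J] len_quot_eq[OF m_primary_frob_pow[OF J], of q] by (simp add: frob_pow_gen_ideal)
qed

lemma power_growth_le:
  fixes n k C :: nat
  assumes "\<And>e. n ^ e \<le> C * k ^ e"
  shows "n \<le> k"
proof (rule ccontr)
  assume "\<not> n \<le> k"
  show False
  proof (cases "k = 0")
    case True
    then show False
      using assms[of 1] \<open>\<not> n \<le> k\<close> by simp
  next
    case False
    then have "1 < real n / real k"
      using \<open>\<not> n \<le> k\<close> by (simp add: field_simps)
    then obtain e where "real C < (real n / real k) ^ e"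
      using real_arch_pow by blast
    then have "real (C * k ^ e) < real (n ^ e)"
      using False by (simp add: field_simps)
    then show False
      using assms[of e] by (simp only: of_nat_less_iff not_less)
  qed
qed

context F_finite_local
begin

lemma frob_independent_le:
  fixes P :: "'a set"
  assumes xs: "regular_sop {0} xs" and P: "prime_ideal P" and f: "frob_independent p P {..<n} f"
  shows "n \<le> p ^ length xs"
proof (rule power_growth_le)
  fix e
  interpret pe: frobenius_finite_local m "p ^ e"
    by (rule frobenius_finite_local_p_power)
  let ?J = "gen_ideal (set xs)"
  obtain g :: "nat \<Rightarrow> 'a" where g: "frob_independent (p ^ e) P {..<n ^ e} g"
    using frob_independent_power[OF f] by blast
  obtain S where S: "finite S" "card S \<le> len_quot (frob_pow m (p ^ e))" "pe.frob.span S = UNIV"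
    by (rule pe.frob_generators)
  have J: "m_primary ?J" "?J \<subseteq> m"
    by (rule regular_sop_zeroD[OF xs])+
  have "n ^ e \<le> card S"
    using pe.frob_independent_card_le[OF P g _ S(1)] S(3) prime_idealD(1)[OF P] by simp
  also have "\<dots> \<le> len_quot (frob_pow ?J (p ^ e))"
    using S(2) len_quot_antimono[OF m_primary_frob_pow[OF J(1)] ideal_frob_pow frob_pow_mono[OF J(2)]]
    by (rule order_trans)
  also have "\<dots> = len_quot ?J * (p ^ length xs) ^ e"
    unfolding pe.len_quot_frob_pow_parameters[OF xs] by (simp add: power_mult[symmetric] mult.commute)
  finally show "n ^ e \<le> len_quot ?J * (p ^ length xs) ^ e" .
qed

lemma frob_generic_generators:
  fixes P :: "'a set"
  assumes xs: "regular_sop {0} xs" and P: "prime_ideal P"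
  shows "\<exists>(f :: nat \<Rightarrow> 'a) c. c \<notin> P \<and> (\<forall>r. c ^ p * r \<in> P + frob.span (f ` {..<p ^ length xs}))"
proof -
  let ?ranks = "{n. \<exists>f :: nat \<Rightarrow> 'a. frob_independent p P {..<n} f}"
  have "0 \<in> ?ranks"
    by (simp add: frob_independent_def)
  moreover have "?ranks \<subseteq> {..p ^ length xs}"
    using frob_independent_le[OF xs P] by blast
  then have fin: "finite ?ranks"
    using finite_atMost by (rule finite_subset)
  ultimately have "Max ?ranks \<in> ?ranks"
    by (intro Max_in) blast+
  then obtain n f where n: "n = Max ?ranks" "frob_independent p P {..<n} (f :: nat \<Rightarrow> 'a)"
    by blast
  have "\<not> frob_independent p P {..<Suc n} g" for g :: "nat \<Rightarrow> 'a"
    using Max_ge[OF fin, of "Suc n"] n(1) by auto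
  then have multiples: "\<exists>c. c \<notin> P \<and> c ^ p * s \<in> P + frob.span (f ` {..<n})" for s
    by (rule multiple_mem_maximal_frob_independent[OF P n(2)])
  obtain S where "finite S" "frob.span S = UNIV"
    using frob_finite by blast
  then obtain c where c: "c \<notin> P" "\<forall>r. c ^ p * r \<in> P + frob.span (f ` {..<n})"
    using frob_common_denominator[OF P _ _ _ multiples]
      frob.subspace_set_plus[OF ideal_imp_frob_subspace[OF prime_idealD(1)[OF P]] frob.subspace_span]
    by blast
  have "P + frob.span (f ` {..<n}) \<subseteq> P + frob.span (f ` {..<p ^ length xs})"
    using frob_independent_le[OF xs P n(2)] by (intro set_plus_mono2 frob.span_mono image_mono) auto
  then show ?thesis
    using c by blast
qed

end

section \<open>Existence of Hilbert-Kunz multiplicities\<close>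

lemma quasi_decreasing_convergent:
  fixes u :: "nat \<Rightarrow> real"
  assumes nonneg: "\<And>e. 0 \<le> u e" and step: "\<And>e. u (Suc e) \<le> u e + B * c ^ e"
    and B: "0 \<le> B" and c: "0 \<le> c" "c < 1"
  shows "convergent u"
proof -
  define t where "t e = B / (1 - c) * c ^ e" for e
  have t: "t e = B * c ^ e + t (Suc e)" for e
    using c by (simp add: t_def field_simps)
  have "decseq (\<lambda>e. u e + t e)"
  proof (rule decseq_SucI)
    show "u (Suc e) + t (Suc e) \<le> u e + t e" for e
      using step[of e] t[of e] by simp
  qed
  moreover have "0 \<le> u e + t e" for e
    using nonneg B c by (simp add: t_def)
  ultimately have "convergent (\<lambda>e. u e + t e)"
    using decseq_convergent[of "\<lambda>e. u e + t e" 0] by (metis convergentI)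
  moreover have "t \<longlonglongrightarrow> 0"
    unfolding t_def using LIMSEQ_realpow_zero[OF c] by (rule tendsto_mult_right_zero)
  then have "convergent t"
    by (rule convergentI)
  ultimately have "convergent (\<lambda>e. u e + t e - t e)"
    by (rule convergent_diff)
  then show ?thesis
    by simp
qed

lemma convergent_normalized_if_quasi_decreasing:
  fixes h l :: "nat \<Rightarrow> nat"
  assumes p: "1 < p" and h: "\<And>e. h (Suc e) \<le> p ^ d * h e + A * l e"
    and l: "\<And>e. p ^ e * l e \<le> C * (p ^ e) ^ d"
  shows "convergent (\<lambda>e. real (h e) / real (p ^ e) ^ d)"
proof (rule quasi_decreasing_convergent)
  fix e
  let ?D = "real (p ^ e) ^ d"
  have pos: "0 < ?D" "1 \<le> real p ^ d" "0 < real p"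
    using p by simp_all
  have "real (p ^ e * l e) \<le> real (C * (p ^ e) ^ d)"
    using l by (simp only: of_nat_le_iff)
  then have "real (l e) / ?D \<le> real C * (1 / real p) ^ e"
    using pos by (simp add: field_simps)
  then have l': "real A * (real (l e) / ?D) \<le> real A * (real C * (1 / real p) ^ e)"
    by (rule mult_left_mono) simp
  have "real (h (Suc e)) \<le> real (p ^ d * h e + A * l e)"
    using h by (simp only: of_nat_le_iff)
  then have "real (h (Suc e)) / (real p ^ d * ?D)
      \<le> (real p ^ d * real (h e) + real A * real (l e)) / (real p ^ d * ?D)"
    using pos by (intro divide_right_mono) simp_all
  also have "\<dots> = real (h e) / ?D + real A * (real (l e) / ?D) / real p ^ d"
    using pos by (simp add: add_divide_distrib)
  also have "\<dots> \<le> real (h e) / ?D + real A * (real (l e) / ?D)"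
    using pos divide_left_mono[of 1 "real p ^ d" "real A * (real (l e) / ?D)"] by simp
  finally show "real (h (Suc e)) / real (p ^ Suc e) ^ d
      \<le> real (h e) / ?D + (real A * real C) * (1 / real p) ^ e"
    using l' by (simp add: power_mult_distrib)
qed (use p in simp_all)

lemma (in noetherian_local) len_quot_plus_frob_pow_le:
  assumes Y: "ideal Y" and K: "m_primary K" and zs: "set zs \<subseteq> m" "m_primary (Y + gen_ideal (set zs))"
  shows "\<exists>C. \<forall>q>0. len_quot (Y + frob_pow K q) \<le> C * q ^ length zs"
proof -
  let ?L = "len_quot (Y + gen_ideal (set zs))"
  obtain M where M: "\<And>z. z \<in> set zs \<Longrightarrow> z ^ M \<in> K"
    using finite_common_power[OF m_primary_ideal[OF K] finite_set[of zs]] K zs(1)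
    unfolding m_primary_def by (metis subsetD)
  have "len_quot (Y + frob_pow K q) \<le> (Suc M ^ length zs * ?L) * q ^ length zs" if q: "0 < q" for q
  proof -
    let ?Q = "Y + frob_pow K q" and ?Z = "Y + gen_ideal ((\<lambda>z. z ^ (Suc M * q)) ` set zs)"
    have Q: "ideal ?Q" "m_primary ?Q"
      using Y m_primary_mono[OF m_primary_frob_pow[OF K], of ?Q q]
      by (simp_all add: R.subspace_set_plus R.set_plus_upper_right)
    have "gen_ideal ((\<lambda>z. z ^ (Suc M * q)) ` set zs) \<subseteq> frob_pow K q"
    proof (intro R.span_minimal ideal_frob_pow image_subsetI)
      fix z assume "z \<in> set zs"
      then have "z ^ Suc M \<in> K"
        by (intro ideal_power_mono[OF m_primary_ideal[OF K] M]) simp_all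
      then show "z ^ (Suc M * q) \<in> frob_pow K q"
        unfolding power_mult by (rule frob_pow_mem)
    qed
    then have "colength ?Q \<le> colength ?Z"
      using Y by (intro R.len_between_mono Q(1) R.subspace_set_plus set_plus_mono2) simp_all
    also have "\<dots> \<le> enat ((Suc M * q) ^ card (set zs)) * enat ?L"
      unfolding len_quot_eq[OF zs(2), symmetric] using Y by (intro colength_plus_powers_le) simp_all
    finally have "len_quot ?Q \<le> (Suc M * q) ^ card (set zs) * ?L"
      by (simp add: len_quot_eq[OF Q(2)])
    also have "\<dots> \<le> (Suc M * q) ^ length zs * ?L"
      using q card_length[of zs] by (intro mult_le_mono1 power_increasing) simp_all
    finally show ?thesis
      by (simp only: power_mult_distrib ac_simps)
  qed
  then show ?thesis
    by blast
qed

lemma (in noetherian_local) nzd_mod_zero_imp_parameters_nonempty: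
  assumes xs: "regular_sop {0} xs" and c: "nzd_mod {0} c" "c \<in> m"
  shows "xs \<noteq> []"
proof
  assume "xs = []"
  then obtain n where "c ^ n * 1 \<in> {0}"
    using xs c(2) by (auto simp: regular_sop_Nil m_primary_def)
  then have "1 \<in> {0 :: 'a}"
    by (rule nzd_modD[OF nzd_mod_power[OF c(1)]])
  then show False
    using one_notin_m R.subspace_0[OF ideal_m] by simp
qed

lemma (in noetherian_local_infinite) len_quot_nzd_plus_frob_pow_le:
  assumes xs: "regular_sop {0} xs" and K: "m_primary K" and c: "nzd_mod {0} c"
  shows "\<exists>C. \<forall>q>0. q * len_quot (gen_ideal {c} + frob_pow K q) \<le> C * q ^ length xs"
proof (cases "c \<in> m")
  case False
  then obtain s where "s * c = 1"
    by (rule unit_inverse)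
  then show ?thesis
    by (simp add: gen_ideal_eq_UNIV_if_unit add.commute[of UNIV] len_quot_UNIV)
next
  case True
  obtain zs where zs: "Suc (length zs) = length xs" "regular_sop {0} (c # zs)"
    using regular_sop_exchange[OF R.subspace_single_0 xs
        nzd_mod_zero_imp_parameters_nonempty[OF xs c True] c True]
    by blast
  have "set zs \<subseteq> m" "m_primary (gen_ideal {c} + gen_ideal (set zs))"
    using zs(2)[unfolded regular_sop_Cons, unfolded regular_sop_def] by simp_all
  then obtain C where C: "\<And>q. 0 < q \<Longrightarrow> len_quot (gen_ideal {c} + frob_pow K q) \<le> C * q ^ length zs"
    using len_quot_plus_frob_pow_le[OF R.subspace_span K, of zs] by blast
  have "q * len_quot (gen_ideal {c} + frob_pow K q) \<le> C * q ^ length xs" if "0 < q" for q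
    using mult_le_mono2[OF C[OF that], of q] unfolding zs(1)[symmetric] by (simp only: power_Suc ac_simps)
  then show ?thesis
    by blast
qed

lemma (in frobenius_finite_local) len_quot_frob_pow_mult_le:
  assumes K: "m_primary K" and S: "finite S" "frob.span S = UNIV"
    and G: "finite G" "\<And>r. c ^ q * r \<in> frob.span G"
  shows "len_quot (frob_pow K (q' * q))
    \<le> card G * len_quot (frob_pow K q') + card S * len_quot (gen_ideal {c} + frob_pow K q')"
proof -
  let ?B = "frob_pow K (q' * q)" and ?Q = "gen_ideal {c} + frob_pow K q'"
  let ?W = "?B + frob.span G"
  have sub: "frob.subspace ?B" "frob.subspace ?W" "?B \<subseteq> ?W" "frob.span G \<subseteq> ?W"
    by (simp_all add: ideal_imp_frob_subspace frob.subspace_set_plus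
        frob.set_plus_upper_left frob.set_plus_upper_right)
  have Q: "ideal ?Q" "m_primary ?Q"
    using m_primary_mono[OF m_primary_frob_pow[OF K], of ?Q q']
    by (simp_all add: R.subspace_set_plus R.set_plus_upper_right)
  have "frob.len_between ?B ?W \<le> enat (card G) * colength (frob_pow K q')"
    by (intro frob.len_between_plus_span_le G(1) sub(1) ideal_frob_pow ideal_mult_right frob_pow_frob_pow_mem)
  moreover have "frob.len_between ?W (?W + frob.span S) \<le> enat (card S) * colength ?Q"
  proof (intro frob.len_between_plus_span_le S(1) sub(2) Q(1))
    fix s r assume "r \<in> ?Q"
    then obtain t where t: "r - t * c \<in> frob_pow K q'"
      unfolding add.commute[of "gen_ideal {c}"] using R.mem_plus_span_singleton by blast
    then have "(r - t * c) ^ q * s + c ^ q * (t ^ q * s) \<in> ?W"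
      by (intro set_plus_intro G(2) ideal_mult_right ideal_frob_pow frob_pow_frob_pow_mem)
    then show "r ^ q * s \<in> ?W"
      by (simp add: power_q_diff algebra_simps)
  qed
  moreover have "?W + frob.span S = UNIV"
    using S(2) sub(2) by simp
  moreover have "frob.len_between ?B UNIV = frob.len_between ?B ?W + frob.len_between ?W UNIV"
    by (intro frob.len_between_add sub frob.subspace_UNIV subset_UNIV)
  ultimately have "enat (len_quot ?B)
      \<le> enat (card G) * enat (len_quot (frob_pow K q')) + enat (card S) * enat (len_quot ?Q)"
    using frob_colength_eq[OF m_primary_frob_pow[OF K], of "q' * q"] len_quot_eq[OF m_primary_frob_pow[OF K]]
      len_quot_eq[OF Q(2)]
    by (metis add_mono)
  then show ?thesis
    by simp
qed

context F_finite_local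
begin

theorem hk_convergent:
  assumes reduced: "reduced_ring TYPE('a)" and xs: "regular_sop {0} xs" and K: "m_primary K"
  shows "convergent (\<lambda>e. real (len_quot (frob_pow K (p ^ e))) / real (p ^ e) ^ length xs)"
proof -
  obtain g :: "nat \<Rightarrow> 'a" and c where c: "nzd_mod {0} c"
    and gc: "\<And>r. c ^ p * r \<in> frob.span (g ` {..<p ^ length xs})"
    using frob_generic_surjection[OF reduced frob_generic_generators[OF xs]] by blast
  obtain S where S: "finite S" "frob.span S = UNIV"
    using frob_finite by blast
  have step: "len_quot (frob_pow K (p ^ Suc e))
      \<le> p ^ length xs * len_quot (frob_pow K (p ^ e))
        + card S * len_quot (gen_ideal {c} + frob_pow K (p ^ e))" for e
  proof -
    have "len_quot (frob_pow K (p ^ e * p)) \<le> card (g ` {..<p ^ length xs}) * len_quot (frob_pow K (p ^ e))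
        + card S * len_quot (gen_ideal {c} + frob_pow K (p ^ e))"
      by (rule len_quot_frob_pow_mult_le[OF K S _ gc]) simp
    also have "\<dots> \<le> p ^ length xs * len_quot (frob_pow K (p ^ e))
        + card S * len_quot (gen_ideal {c} + frob_pow K (p ^ e))"
      using card_image_le[of "{..<p ^ length xs}" g] by (intro add_le_mono1 mult_le_mono1) simp
    finally show ?thesis
      by (simp only: power_Suc mult.commute)
  qed
  obtain C where C: "\<And>q. 0 < q \<Longrightarrow> q * len_quot (gen_ideal {c} + frob_pow K q) \<le> C * q ^ length xs"
    using len_quot_nzd_plus_frob_pow_le[OF xs K c] by blast
  show ?thesis
    by (rule convergent_normalized_if_quasi_decreasing[where
          l = "\<lambda>e. len_quot (gen_ideal {c} + frob_pow K (p ^ e))", OF p_gt_1 step C])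
      (use p_gt_1 in simp)
qed

corollary hk_mult_tendsto:
  assumes "reduced_ring TYPE('a)" "regular_sop {0} xs" "m_primary K"
  shows "(\<lambda>e. real (len_quot (frob_pow K (p ^ e))) / real (p ^ e) ^ length xs) \<longlonglongrightarrow> hk_mult p K (length xs)"
  using hk_convergent[OF assms] unfolding hk_mult_def by (simp add: convergent_LIMSEQ_iff)

end

section \<open>The inequality for a fixed power of the Frobenius\<close>

lemma (in noetherian_local) mu_quot_le:
  fixes I J :: "'a set"
  assumes ideals: "ideal I" "ideal J" "J \<subseteq> I" and len: "R.len_between (J + ideal_mult m I) I = enat n"
  shows "mu_quot I J \<le> n"
proof -
  have sub: "ideal (J + ideal_mult m I)" "J + ideal_mult m I \<subseteq> I"
    using ideals by (simp_all add: R.subspace_set_plus R.set_plus_least R.ideal_scale_subset)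
  obtain S where S: "finite S" "card S \<le> n" "S \<subseteq> I" "I = J + ideal_mult m I + gen_ideal S"
    by (rule R.generators_of_finite_length[OF ideals(1) sub len])
  obtain T where T: "finite T" "I = gen_ideal T"
    using ideal_finitely_generated[OF ideals(1)] .
  have "I \<subseteq> (J + gen_ideal S) + ideal_mult m I"
    using S(4) by (simp only: ac_simps)
  then have "I \<subseteq> J + gen_ideal S"
    using R.nakayama[OF T(1), of "J + gen_ideal S"] ideals(2) unfolding T(2)[symmetric]
    by (simp add: R.subspace_set_plus)
  then have I: "I = gen_ideal (J \<union> S)"
    using ideals S(3) by (simp add: R.span_Un_eq_set_plus R.span_eq_iff[THEN iffD2] R.set_plus_least R.span_minimal
        subset_antisym)
  obtain h where "h ` {..<card S} = S"
    using finite_eq_image_lessThan_card[OF S(1)] by blast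
  then have "I = gen_ideal (J \<union> h ` {..<card S})"
    using I by simp
  then have "mu_quot I J \<le> card S"
    unfolding mu_quot_def by (intro Least_le) blast
  then show ?thesis
    using S(2) by simp
qed

definition frob_colon :: "nat \<Rightarrow> 'a::comm_ring_1 set \<Rightarrow> 'a \<Rightarrow> 'a set" where
  "frob_colon q Q u = {r. r * u ^ q \<in> frob_pow Q q}"

lemma ideal_frob_colon [simp]: "ideal (frob_colon q Q u)"
  unfolding frob_colon_def by (intro R.ideal_colon ideal_frob_pow)

lemma frob_pow_subset_frob_colon:
  assumes "\<And>r. r \<in> K \<Longrightarrow> r * u \<in> Q"
  shows "frob_pow K q \<subseteq> frob_colon q Q u"
proof (intro frob_pow_least ideal_frob_colon)
  show "a ^ q \<in> frob_colon q Q u" if "a \<in> K" for a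
    using frob_pow_mem[OF assms[OF that], of q] by (simp add: frob_colon_def power_mult_distrib)
qed

lemma power_times_mem_colon_frob_pow:
  assumes "\<And>i. i \<in> I \<Longrightarrow> (w * i) ^ q * b \<in> frob_pow Q q"
  shows "w ^ q * b \<in> colon (frob_pow Q q) (frob_pow I q)"
proof -
  have "frob_pow I q \<subseteq> {k. k * (w ^ q * b) \<in> frob_pow Q q}"
  proof (intro frob_pow_least R.ideal_colon ideal_frob_pow CollectI)
    show "i ^ q * (w ^ q * b) \<in> frob_pow Q q" if "i \<in> I" for i
      using assms[OF that] by (simp add: power_mult_distrib ac_simps)
  qed
  then show ?thesis
    unfolding colon_def by blast
qed

context frobenius_local
begin

lemma m_primary_frob_colon: "m_primary Q \<Longrightarrow> m_primary (frob_colon q Q u)"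
  by (rule m_primary_mono[OF m_primary_frob_pow ideal_frob_colon])
    (auto simp: frob_colon_def intro: ideal_mult_right)

lemma len_quot_frob_colon:
  assumes Q: "m_primary Q"
  shows "len_quot (frob_colon q Q u) + len_quot (frob_pow (Q + gen_ideal {u}) q) = len_quot (frob_pow Q q)"
proof -
  let ?B = "frob_pow Q q" and ?A = "frob_pow (Q + gen_ideal {u}) q"
  have A: "?A = ?B + gen_ideal {u ^ q}"
    using m_primary_ideal[OF Q] by (simp add: frob_pow_plus frob_pow_principal)
  have BA: "?B \<subseteq> ?A"
    unfolding A by (rule R.set_plus_upper_left) simp
  have "R.len_between ?B ?A = colength (frob_colon q Q u)"
    unfolding A frob_colon_def by (intro R.len_between_plus_span_singleton ideal_frob_pow)
  moreover have "colength ?B = R.len_between ?B ?A + colength ?A"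
    by (intro R.len_between_add ideal_frob_pow BA) simp_all
  ultimately show ?thesis
    using len_quot_eq[OF m_primary_frob_colon[OF Q]] len_quot_eq[OF m_primary_frob_pow[OF Q]]
      len_quot_eq[OF m_primary_mono[OF m_primary_frob_pow[OF Q] ideal_frob_pow BA]]
    by simp
qed

lemma frob_colon_times_colon:
  assumes Q: "ideal Q" and u: "socle_generator Q u" and I: "ideal I"
    and b: "b \<in> frob_colon q Q u" and w: "w \<in> colon Q (Q + ideal_mult m I)"
  shows "w ^ q * b \<in> colon (frob_pow Q q) (frob_pow I q)"
proof (rule power_times_mem_colon_frob_pow)
  fix i assume i: "i \<in> I"
  have "r * (w * i) \<in> Q" if r: "r \<in> m" for r
  proof -
    have "r * i \<in> Q + ideal_mult m I"
      using R.ideal_scale_mem[OF r i] R.set_plus_upper_right[OF Q] by blast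
    then have "r * i * w \<in> Q"
      using w by (simp add: colon_def)
    then show ?thesis
      by (simp add: ac_simps)
  qed
  then have "w * i \<in> Q + gen_ideal {u}"
    using u unfolding socle_generator_def by blast
  then have "(w * i) ^ q \<in> frob_pow Q q + gen_ideal {u ^ q}"
    using frob_pow_mem[of "w * i" "Q + gen_ideal {u}" q] Q by (simp add: frob_pow_plus frob_pow_principal)
  then obtain t where t: "(w * i) ^ q - t * u ^ q \<in> frob_pow Q q"
    using R.mem_plus_span_singleton by blast
  have bu: "b * u ^ q \<in> frob_pow Q q"
    using b by (simp add: frob_colon_def)
  show "(w * i) ^ q * b \<in> frob_pow Q q"
    by (rule R.subspace_lincomb[OF ideal_frob_pow t bu, where a = b and b = t]) (simp add: algebra_simps)
qed

end

context frobenius_finite_local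
begin

lemma len_quot_frob_pow_le:
  assumes I: "m_primary I"
  shows "len_quot (frob_pow I q) \<le> len_quot (frob_pow m q) * len_quot I"
proof -
  obtain S where S: "finite S" "card S \<le> len_quot (frob_pow m q)" "frob.span S = UNIV"
    by (rule frob_generators)
  have "frob.len_between (frob_pow I q) (frob_pow I q + frob.span S) \<le> enat (card S) * colength I"
    by (intro frob.len_between_plus_span_le S(1) ideal_imp_frob_subspace ideal_frob_pow m_primary_ideal[OF I]
        power_times_mem_frob_pow)
  then have "len_quot (frob_pow I q) \<le> card S * len_quot I"
    using frob_colength_eq[OF m_primary_frob_pow[OF I], of q] len_quot_eq[OF I] S(3)
    by (simp add: ideal_imp_frob_subspace)
  also have "\<dots> \<le> len_quot (frob_pow m q) * len_quot I"
    using S(2) by (rule mult_le_mono1)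
  finally show ?thesis .
qed

lemma frob_generators_through:
  assumes A: "ideal A" "frob_pow m q \<subseteq> A"
  obtains S T where "finite S" "S \<subseteq> A" "card S + len_quot A \<le> len_quot (frob_pow m q)"
    "finite T" "card T \<le> len_quot A" "frob.span (S \<union> T) = UNIV"
proof -
  have sub: "frob.subspace (frob_pow m q)" "frob.subspace A"
    using A(1) by (simp_all add: ideal_imp_frob_subspace)
  have m_primary: "m_primary (frob_pow m q)" "m_primary A"
    using m_primary_frob_pow[OF m_primary_m] m_primary_mono[OF _ A] by blast+
  have "frob.len_between (frob_pow m q) UNIV = frob.len_between (frob_pow m q) A + frob.len_between A UNIV"
    by (intro frob.len_between_add sub A(2)) simp_all
  then obtain s where s: "frob.len_between (frob_pow m q) A = enat s" "len_quot (frob_pow m q) = s + len_quot A"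
    using frob_colength_eq[OF m_primary(1)] frob_colength_eq[OF m_primary(2)]
    by (cases "frob.len_between (frob_pow m q) A") auto
  obtain S where S: "finite S" "card S \<le> s" "S \<subseteq> A" "A = frob_pow m q + frob.span S"
    by (rule frob.generators_of_finite_length[OF sub(2,1) A(2) s(1)])
  obtain T where T: "finite T" "card T \<le> len_quot A" "UNIV = A + frob.span T"
    by (rule frob.generators_of_finite_length[OF frob.subspace_UNIV sub(2) subset_UNIV
          frob_colength_eq[OF m_primary(2)]])
  have "frob_pow m q + frob.span (S \<union> T) = UNIV"
    unfolding frob.span_Un_eq_set_plus using S(4) T(3) by (simp only: add.assoc)
  then have "frob.span (S \<union> T) = UNIV"
    by (rule frob_span_eq_UNIV_if)
  then show thesis
    using that[of S T] S T s(2) by simp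
qed

lemma len_between_frob_pow_le:
  assumes Q: "m_primary Q" "socle_generator Q u" "simple_socle (frob_pow Q q)" and I: "ideal I" "Q \<subseteq> I"
    and S: "finite S" "S \<subseteq> frob_colon q Q u" and T: "finite T" and span: "frob.span (S \<union> T) = UNIV"
  shows "R.len_between (frob_pow Q q) (frob_pow I q)
    \<le> enat (card S) * R.len_between Q (Q + ideal_mult m I) + enat (card T) * R.len_between Q I"
proof -
  let ?B = "frob_pow Q q" and ?mI = "Q + ideal_mult m I"
  let ?X = "colon ?B (frob_pow I q)"
  have idQ: "ideal Q" "simple_socle Q" "ideal ?mI" "Q \<subseteq> ?mI"
    using m_primary_ideal[OF Q(1)] Q(2)
    by (auto simp: simple_socle_def R.subspace_set_plus R.set_plus_upper_left)
  have X: "ideal ?X"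
    by (intro ideal_colon_set ideal_frob_pow)
  then have sub: "frob.subspace ?X" "frob.subspace (?X + frob.span S)" "?X \<subseteq> ?X + frob.span S"
    by (simp_all add: ideal_imp_frob_subspace frob.subspace_set_plus frob.set_plus_upper_left)
  have "frob.len_between ?X (?X + frob.span S) \<le> enat (card S) * colength (colon Q ?mI)"
    using S frob_colon_times_colon[OF idQ(1) Q(2) I(1)]
    by (intro frob.len_between_plus_span_le sub ideal_colon_set idQ(1)) auto
  moreover have "frob.len_between (?X + frob.span S) (?X + frob.span S + frob.span T)
      \<le> enat (card T) * colength (colon Q I)"
  proof (intro frob.len_between_plus_span_le T sub(2) ideal_colon_set idQ(1))
    fix b w assume w: "w \<in> colon Q I"
    have "w ^ q * b \<in> ?X"
      using w
      by (intro power_times_mem_colon_frob_pow power_times_mem_frob_pow) (simp add: colon_def mult.commute)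
    then show "w ^ q * b \<in> ?X + frob.span S"
      using sub(3) by blast
  qed
  moreover have "?X + frob.span S + frob.span T = UNIV"
    using span sub(1) unfolding frob.span_Un_eq_set_plus by (simp add: add.assoc)
  moreover have "frob.len_between ?X UNIV
      = frob.len_between ?X (?X + frob.span S) + frob.len_between (?X + frob.span S) UNIV"
    by (intro frob.len_between_add sub) simp_all
  moreover have "m_primary ?X"
    by (rule m_primary_mono[OF m_primary_frob_pow[OF Q(1)] X subset_colon[OF ideal_frob_pow]])
  then have "frob.len_between ?X UNIV = colength ?X"
    by (simp add: frob_colength_eq len_quot_eq)
  moreover have "colength ?X = R.len_between ?B (frob_pow I q)"
    by (intro colength_colon m_primary_frob_pow Q ideal_frob_pow frob_pow_mono I(2))
  moreover have "colength (colon Q ?mI) = R.len_between Q ?mI" "colength (colon Q I) = R.len_between Q I"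
    using Q(1) idQ I by (simp_all add: colength_colon)
  ultimately show ?thesis
    by (metis add_mono)
qed

lemma len_quot_frob_pow_le_frob_colon:
  assumes Q: "m_primary Q" "socle_generator Q u" "simple_socle (frob_pow Q q)" and I: "ideal I" "Q \<subseteq> I"
    and l: "R.len_between Q (Q + ideal_mult m I) = enat l'" "R.len_between Q I = enat l"
  defines "h \<equiv> len_quot (frob_pow m q)" and "a \<equiv> len_quot (frob_colon q Q u)"
  shows "len_quot (frob_pow Q q) \<le> (h - a) * l' + a * l + h * len_quot I" "a \<le> h"
proof -
  have m_primary: "m_primary I"
    by (rule m_primary_mono[OF Q(1) I])
  obtain S T where S: "finite S" "S \<subseteq> frob_colon q Q u" "card S + a \<le> h"
    and T: "finite T" "card T \<le> a" and span: "frob.span (S \<union> T) = UNIV"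
    using frob_generators_through[OF ideal_frob_colon
        frob_pow_subset_frob_colon[OF socle_generatorD(2)[OF Q(2)]]]
    unfolding a_def h_def by metis
  show "a \<le> h"
    using S(3) by simp
  have "colength (frob_pow Q q) = R.len_between (frob_pow Q q) (frob_pow I q) + colength (frob_pow I q)"
    by (intro R.len_between_add frob_pow_mono I(2)) simp_all
  also have "\<dots> \<le> enat (card S * l' + card T * l) + colength (frob_pow I q)"
    using len_between_frob_pow_le[OF Q I S(1,2) T(1) span] unfolding l
    by (intro add_right_mono) simp
  finally have "len_quot (frob_pow Q q) \<le> card S * l' + card T * l + len_quot (frob_pow I q)"
    using len_quot_eq[OF m_primary_frob_pow[OF Q(1)]] len_quot_eq[OF m_primary_frob_pow[OF m_primary]]
    by simp
  also have "\<dots> \<le> card S * l' + card T * l + h * len_quot I"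
    using len_quot_frob_pow_le[OF m_primary] unfolding h_def by simp
  also have "\<dots> \<le> (h - a) * l' + a * l + h * len_quot I"
    using S(3) T(2) by (intro add_le_mono mult_le_mono) simp_all
  finally show "len_quot (frob_pow Q q) \<le> (h - a) * l' + a * l + h * len_quot I" .
qed

theorem frob_len_quot_inequality:
  assumes Q: "m_primary Q" "socle_generator Q u" "simple_socle (frob_pow Q q)" and I: "ideal I" "Q \<subseteq> I"
  shows "len_quot (frob_pow Q q) + mu_quot I Q * len_quot (frob_pow m q)
      \<le> len_quot Q * len_quot (frob_pow m q) + mu_quot I Q * len_quot (frob_colon q Q u)" (is ?inequality)
    and "mu_quot I Q \<le> len_quot Q"
proof -
  let ?mI = "Q + ideal_mult m I" and ?\<mu> = "mu_quot I Q"
  define h a L where "h = len_quot (frob_pow m q)" and "a = len_quot (frob_colon q Q u)" and "L = len_quot I"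
  have ideals: "ideal Q" "ideal ?mI" "Q \<subseteq> ?mI" "?mI \<subseteq> I"
    using m_primary_ideal[OF Q(1)] I
    by (simp_all add: R.subspace_set_plus R.set_plus_upper_left R.set_plus_least R.ideal_scale_subset)
  have "colength Q = R.len_between Q I + colength I"
    by (intro R.len_between_add ideals I) simp_all
  then obtain l where l: "R.len_between Q I = enat l" "len_quot Q = l + L"
    using len_quot_eq[OF Q(1)] len_quot_eq[OF m_primary_mono[OF Q(1) I]]
    by (cases "R.len_between Q I") (auto simp: L_def)
  have "R.len_between Q I = R.len_between Q ?mI + R.len_between ?mI I"
    by (intro R.len_between_add ideals I)
  then obtain l' n where n: "R.len_between Q ?mI = enat l'" "R.len_between ?mI I = enat n" "l = l' + n"
    using l(1) by (cases "R.len_between Q ?mI"; cases "R.len_between ?mI I") auto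
  have \<mu>: "?\<mu> \<le> n"
    by (rule mu_quot_le[OF I(1) ideals(1) I(2) n(2)])
  then show "?\<mu> \<le> len_quot Q"
    using l(2) n(3) by simp
  have a: "len_quot (frob_pow Q q) \<le> (h - a) * l' + a * l + h * L" "a \<le> h"
    using len_quot_frob_pow_le_frob_colon[OF Q I n(1) l(1)] unfolding h_def a_def L_def .
  have "len_quot (frob_pow Q q) + ?\<mu> * ((h - a) + a) \<le> (h - a) * l' + a * l + h * L + (n * (h - a) + ?\<mu> * a)"
    using a(1) mult_le_mono1[OF \<mu>, of "h - a"] unfolding distrib_left by linarith
  also have "\<dots> = ((h - a) + a) * l + h * L + ?\<mu> * a"
    unfolding n(3) by (simp only: algebra_simps)
  finally show ?inequality
    using a(2) l(2) unfolding h_def[symmetric] a_def[symmetric] by (simp add: algebra_simps)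
qed

end

section \<open>Linear systems over a Noetherian local ring\<close>

context ring_module
begin

lemma set_plus_eq_if_leading_ideal_eq:
  assumes sub: "subspace A" "subspace B" "subspace C" and AB: "A \<subseteq> B" "B \<subseteq> C + span {a}"
    and lead: "{r. r *s a \<in> A + C} = {r. r *s a \<in> B + C}"
  shows "A + C = B + C"
proof (rule subset_antisym)
  have AC: "subspace (A + C)" and BC: "subspace (B + C)"
    using sub by (simp_all add: subspace_set_plus)
  show "B + C \<subseteq> A + C"
  proof (intro set_plus_least AC set_plus_upper_right sub(1) subsetI)
    fix b assume "b \<in> B"
    then obtain r where r: "b - r *s a \<in> C"
      using AB(2) mem_plus_span_singleton by blast
    then have rA: "b - r *s a \<in> A + C" and rB: "b - r *s a \<in> B + C"
      using set_plus_upper_right sub by blast+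
    have "b \<in> B + C"
      using \<open>b \<in> B\<close> set_plus_upper_left[OF sub(3)] by blast
    then have "r *s a \<in> A + C"
      using lead subspace_diff_mem_iff[OF BC rB] by blast
    then show "b \<in> A + C"
      using subspace_diff_mem_iff[OF AC rA] by blast
  qed
  show "A + C \<subseteq> B + C"
    using AB(1) by (intro set_plus_mono2 subset_refl)
qed

lemma noetherian_plus_span_singleton:
  assumes R: "R.noetherian (UNIV :: 'a set)" and C: "subspace C" "noetherian C"
  shows "noetherian (C + span {a})"
proof -
  let ?lead = "\<lambda>A. {r. r *s a \<in> A + C}"
  let ?ideals = "{(J, I). ideal I \<and> ideal J \<and> I \<subset> J \<and> J \<subseteq> (UNIV :: 'a set)}"
  let ?submodules = "{(B, A). subspace A \<and> subspace B \<and> A \<subset> B \<and> B \<subseteq> C}"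
  let ?less = "inv_image (?ideals <*lex*> ?submodules) (\<lambda>A. (?lead A, A \<inter> C))"
  have "wf ?less"
    using R C(2) unfolding R.noetherian_def noetherian_def by (intro wf_inv_image wf_lex_prod)
  moreover have less: "(B, A) \<in> ?less" if BA: "subspace A" "subspace B" "A \<subset> B" "B \<subseteq> C + span {a}" for A B
  proof -
    have "A + C \<subseteq> B + C"
      using BA(3) by (intro set_plus_mono2) auto
    then have ideals: "ideal (?lead A)" "ideal (?lead B)" "?lead A \<subseteq> ?lead B"
      using BA(1,2) C(1) by (auto intro!: ideal_colon subspace_set_plus)
    have "A \<inter> C \<subset> B \<inter> C" if "?lead A = ?lead B"
    proof -
      have "A + C = B + C"
        using BA that by (intro set_plus_eq_if_leading_ideal_eq C(1)) auto
      then have "A \<inter> C \<noteq> B \<inter> C"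
        using modular_cancel[of A B C] BA subspace_0[OF C(1)] by blast
      then show ?thesis
        using BA(3) by blast
    qed
    then show ?thesis
      using ideals BA C(1) by (auto simp: subspace_inter)
  qed
  ultimately show ?thesis
    unfolding noetherian_def using less by (elim wf_subset) blast
qed

lemma noetherian_span_finite:
  assumes R: "R.noetherian (UNIV :: 'a set)" and "finite S"
  shows "noetherian (span S)"
  using assms(2)
proof (induction S rule: finite_induct)
  case empty
  have no_pair: "{(B, A). subspace A \<and> subspace B \<and> A \<subset> B \<and> B \<subseteq> {0}} = {}"
    using subspace_0 by blast
  show ?case
    unfolding noetherian_def span_empty no_pair by simp
next
  case (insert a S)
  then show ?case
    using noetherian_plus_span_singleton[OF R subspace_span insert.IH, of a] span_insert_eq_set_plus[of a S]
    by (simp add: add.commute)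
qed

lemma noetherian_scale_power_stable:
  assumes T: "noetherian T" "subspace T" and L: "subspace L"
  shows "\<exists>k. \<forall>t\<in>T. x ^ Suc k *s t \<in> L \<longrightarrow> x ^ k *s t \<in> L"
proof -
  define A where "A j = T \<inter> (\<lambda>t. x ^ j *s t) -` L" for j
  have A: "subspace (A j)" "A j \<subseteq> T" for j
    using T(2) L
    by (auto simp: A_def intro: subspace_inter module_hom.subspace_vimage[OF module_hom_scale_self])
  obtain M where M: "M \<in> range A" "\<And>B. B \<in> range A \<Longrightarrow> \<not> M \<subset> B"
    by (rule noetherian_maximal[OF T(1), of "A 0" "range A"]) (use A in blast)+
  then obtain k where k: "M = A k"
    by blast
  have "A k \<subseteq> A (Suc k)"
    using L by (auto simp: A_def scale_scale[symmetric] subspace_scale simp del: scale_scale)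
  then have "A (Suc k) = A k"
    using M(2)[OF rangeI] k by blast
  then show ?thesis
    unfolding A_def by blast
qed

lemma ideal_scale_into: "subspace B \<Longrightarrow> ideal {r. \<forall>t\<in>T. r *s t \<in> B}"
  by (auto simp: ideal_def scale_left_distrib subspace_0 subspace_add subspace_scale simp flip: scale_scale)

end

(* Krull's intersection argument: L is maximal among the submodules of T meeting N in m N. *)
theorem (in local_module) weak_artin_rees:
  assumes T: "noetherian T" "subspace T" and N: "subspace N" "N \<subseteq> T"
  shows "\<exists>L. subspace L \<and> L \<inter> N \<subseteq> ideal_scale m N \<and> (\<forall>x\<in>m. \<exists>k. \<forall>t\<in>T. x ^ k *s t \<in> L)"
proof -
  let ?F = "{L. subspace L \<and> L \<subseteq> T \<and> ideal_scale m N \<subseteq> L \<and> L \<inter> N \<subseteq> ideal_scale m N}"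
  have "ideal_scale m N \<in> ?F"
    using ideal_scale_subset[OF N(1)] N(2) by auto
  then obtain L where "L \<in> ?F" and max: "\<And>L'. L' \<in> ?F \<Longrightarrow> \<not> L \<subset> L'"
    by (rule noetherian_maximal[OF T(1)]) auto
  then have L: "subspace L" "L \<subseteq> T" "ideal_scale m N \<subseteq> L" "L \<inter> N \<subseteq> ideal_scale m N"
    by blast+
  have "\<exists>k. \<forall>t\<in>T. x ^ k *s t \<in> L" if x: "x \<in> m" for x
  proof -
    obtain k where k: "\<And>t. t \<in> T \<Longrightarrow> x ^ Suc k *s t \<in> L \<Longrightarrow> x ^ k *s t \<in> L"
      using noetherian_scale_power_stable[OF T L(1)] by blast
    let ?L' = "L + (\<lambda>t. x ^ k *s t) ` T"
    have image: "subspace ((\<lambda>t. x ^ k *s t) ` T)"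
      by (rule module_hom.subspace_image[OF module_hom_scale_self T(2)])
    have "z \<in> ideal_scale m N" if z: "z \<in> ?L'" "z \<in> N" for z
    proof -
      obtain l t where lt: "z = l + x ^ k *s t" "l \<in> L" "t \<in> T"
        using z(1) by (auto elim: set_plus_elim)
      have "x *s z - x *s l \<in> L"
        using ideal_scale_mem[OF x z(2)] L(3) subspace_diff[OF L(1) _ subspace_scale[OF L(1) lt(2)]]
        by blast
      then have "x ^ k *s t \<in> L"
        using k[OF lt(3)] by (simp add: lt(1) scale_right_distrib)
      then have "z \<in> L"
        unfolding lt(1) by (rule subspace_add[OF L(1) lt(2)])
      then show ?thesis
        using z(2) L(4) by blast
    qed
    moreover have "?L' \<subseteq> T"
      using L(2) T(2) by (intro set_plus_least) (auto intro: subspace_scale)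
    moreover have "subspace ?L'" "L \<subseteq> ?L'"
      using L(1) image by (simp_all add: subspace_set_plus set_plus_upper_left)
    ultimately have "?L' \<in> ?F"
      using L(3) by blast
    then have "?L' \<subseteq> L"
      using max \<open>L \<subseteq> ?L'\<close> by blast
    then show ?thesis
      using set_plus_upper_right[OF L(1), of "(\<lambda>t. x ^ k *s t) ` T"] by blast
  qed
  then show ?thesis
    using L by blast
qed

corollary (in local_module) weak_artin_rees_powers:
  assumes "noetherian T" "subspace T" "subspace M" "M \<subseteq> T" and S: "finite S" "S \<subseteq> m"
  shows "\<exists>L N. subspace L \<and> L \<inter> M \<subseteq> ideal_scale m M \<and> (\<forall>r\<in>gen_ideal ((\<lambda>x. x ^ N) ` S). \<forall>t\<in>T. r *s t \<in> L)"
proof -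
  obtain L where L: "subspace L" "L \<inter> M \<subseteq> ideal_scale m M" "\<forall>x\<in>m. \<exists>k. \<forall>t\<in>T. x ^ k *s t \<in> L"
    using weak_artin_rees[OF assms(1-4)] by blast
  have into_L: "ideal {r. \<forall>t\<in>T. r *s t \<in> L}"
    by (rule ideal_scale_into[OF L(1)])
  have "\<exists>k. x ^ k \<in> {r. \<forall>t\<in>T. r *s t \<in> L}" if "x \<in> S" for x
    using L(3) S(2) that by blast
  then obtain N where "\<And>x. x \<in> S \<Longrightarrow> x ^ N \<in> {r. \<forall>t\<in>T. r *s t \<in> L}"
    using finite_common_power[OF into_L S(1)] by blast
  then have "gen_ideal ((\<lambda>x. x ^ N) ` S) \<subseteq> {r. \<forall>t\<in>T. r *s t \<in> L}"
    by (intro R.span_minimal into_L) blast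
  then show ?thesis
    using L by blast
qed

definition scale_vec :: "'a::comm_ring_1 \<Rightarrow> (nat \<Rightarrow> 'a) \<Rightarrow> nat \<Rightarrow> 'a" where
  "scale_vec r v = (\<lambda>j. r * v j)"

definition unit_vec :: "nat \<Rightarrow> nat \<Rightarrow> 'a::comm_ring_1" where
  "unit_vec i = (\<lambda>j. if j = i then 1 else 0)"

definition dot :: "nat \<Rightarrow> (nat \<Rightarrow> 'a::comm_ring_1) \<Rightarrow> (nat \<Rightarrow> 'a) \<Rightarrow> 'a" where
  "dot n v w = (\<Sum>j<n. v j * w j)"

lemma scale_vec_apply [simp]: "scale_vec r v j = r * v j"
  by (simp add: scale_vec_def)

interpretation vec: ring_module "scale_vec :: 'a::comm_ring_1 \<Rightarrow> _"
  by unfold_locales (auto simp: fun_eq_iff algebra_simps)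

sublocale noetherian_local \<subseteq> vec: local_module m scale_vec
  by unfold_locales

lemma sum_fun_apply: "sum f I j = (\<Sum>i\<in>I. f i j)"
  by (induction I rule: infinite_finite_induct) simp_all

lemma sum_scale_unit_vec: "(\<Sum>i<n. scale_vec (v i) (unit_vec i)) = (\<lambda>j. if j < n then v j else 0)"
proof
  fix j
  have "(\<Sum>i<n. scale_vec (v i) (unit_vec i)) j = (\<Sum>i<n. if i = j then v i else 0)"
    unfolding sum_fun_apply by (rule sum.cong) (auto simp: unit_vec_def)
  then show "(\<Sum>i<n. scale_vec (v i) (unit_vec i)) j = (if j < n then v j else 0)"
    by simp
qed

lemma truncate_mem_span_unit_vec: "(\<lambda>j. if j < n then v j else 0) \<in> vec.span (unit_vec ` {..<n})"
  unfolding sum_scale_unit_vec[symmetric] by (intro vec.span_sum vec.span_scale vec.span_base imageI)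

lemma dot_commute: "dot n v w = dot n w v"
  by (simp add: dot_def mult.commute)

lemma dot_add: "dot n (v + v') w = dot n v w + dot n v' w"
  by (simp add: dot_def distrib_right sum.distrib)

lemma dot_scale: "dot n (scale_vec r v) w = r * dot n v w"
  by (simp add: dot_def sum_distrib_left mult.assoc)

lemma dot_cong: "(\<And>j. j < n \<Longrightarrow> w j = w' j) \<Longrightarrow> dot n v w = dot n v w'"
  by (simp add: dot_def)

lemma dot_mem: "ideal I \<Longrightarrow> (\<And>j. j < n \<Longrightarrow> v j \<in> I) \<Longrightarrow> dot n v w \<in> I"
  unfolding dot_def by (intro R.subspace_sum ideal_mult_right) auto

lemma module_hom_dot: "module_hom scale_vec (*) (dot n w)"
  using dot_add[of n _ _ w] dot_scale[of n _ _ w]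
  by unfold_locales (simp_all add: dot_commute[of n w])

theorem (in noetherian_local) exact_solution_near_approximate:
  fixes k :: "nat \<Rightarrow> nat \<Rightarrow> 'a"
  assumes S: "finite S" "S \<subseteq> m"
  shows "\<exists>N. \<forall>v. (\<forall>i<b. dot n v (k i) \<in> gen_ideal ((\<lambda>x. x ^ N) ` S)) \<longrightarrow>
    (\<exists>w. (\<forall>j. v j - w j \<in> m) \<and> (\<forall>i<b. dot n w (k i) = 0))"
proof -
  define F :: "(nat \<Rightarrow> 'a) \<Rightarrow> nat \<Rightarrow> 'a" where "F v = (\<lambda>i. if i < b then dot n v (k i) else 0)" for v
  interpret F: module_hom scale_vec scale_vec F
    by unfold_locales (auto simp: F_def fun_eq_iff dot_add dot_scale)
  let ?T = "vec.span (unit_vec ` {..<b}) :: (nat \<Rightarrow> 'a) set"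
  have T: "vec.noetherian ?T"
    by (rule vec.noetherian_span_finite[OF noetherian_UNIV]) simp
  have range_F: "vec.subspace (range F)" "range F \<subseteq> ?T"
    using F.subspace_image[OF vec.subspace_UNIV] truncate_mem_span_unit_vec by (auto simp: F_def)
  obtain L N where L: "vec.subspace L" "L \<inter> range F \<subseteq> vec.ideal_scale m (range F)"
    and N: "\<forall>r\<in>gen_ideal ((\<lambda>x. x ^ N) ` S). \<forall>t\<in>?T. scale_vec r t \<in> L"
    using vec.weak_artin_rees_powers[OF T vec.subspace_span range_F S] by blast
  let ?V = "{w. \<forall>j. w j \<in> m} :: (nat \<Rightarrow> 'a) set"
  have "vec.ideal_scale m (range F) \<subseteq> F ` ?V"
  proof (rule vec.ideal_scale_least)
    have "vec.subspace ?V"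
      using ideal_m by (auto simp: vec.subspace_def ideal_def)
    then show "vec.subspace (F ` ?V)"
      by (rule F.subspace_image)
    show "scale_vec r x \<in> F ` ?V" if "r \<in> m" "x \<in> range F" for r x
      using that ideal_mult_right[OF ideal_m] by (auto simp flip: F.scale)
  qed
  show ?thesis
  proof (intro exI[of _ N] allI impI)
    fix v assume v: "\<forall>i<b. dot n v (k i) \<in> gen_ideal ((\<lambda>x. x ^ N) ` S)"
    have "F v = (\<Sum>i<b. scale_vec (dot n v (k i)) (unit_vec i))"
      by (simp add: sum_scale_unit_vec F_def)
    also have "\<dots> \<in> L"
      using v N vec.span_base[of "unit_vec _" "unit_vec ` {..<b}"] by (intro vec.subspace_sum L(1)) blast
    finally have "F v \<in> F ` ?V"
      using L(2) \<open>vec.ideal_scale m (range F) \<subseteq> F ` ?V\<close> by blast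
    then obtain w where w: "F v = F w" "\<forall>j. w j \<in> m"
      by blast
    have "F (v - w) = 0"
      using w(1) by (simp add: F.diff)
    then have "\<forall>i<b. dot n (v - w) (k i) = 0"
      by (simp add: F_def fun_eq_iff) metis
    then show "\<exists>w. (\<forall>j. v j - w j \<in> m) \<and> (\<forall>i<b. dot n w (k i) = 0)"
      using w(2) by (intro exI[of _ "v - w"]) simp
  qed
qed

section \<open>Splittings of the Frobenius\<close>

context noetherian_local
begin

lemma symmetric_pairing_dot:
  assumes "ideal Q" "simple_socle Q"
  shows "symmetric_pairing m scale_vec (dot n) Q"
  using assms by unfold_locales (simp_all add: dot_commute[of n] dot_add dot_scale)

lemma all_dot_mem_iff:
  fixes Q :: "'a set"
  assumes Q: "ideal Q"
  shows "(\<forall>x. dot n x v \<in> Q) \<longleftrightarrow> (\<forall>j<n. v j \<in> Q)"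
proof (intro iffI allI impI)
  fix j assume dot: "\<forall>x. dot n x v \<in> Q" and j: "j < n"
  have "dot n (unit_vec j) v = (\<Sum>i<n. if i = j then v j else 0)"
    unfolding dot_def by (rule sum.cong) (auto simp: unit_vec_def)
  then show "v j \<in> Q"
    using dot[rule_format, of "unit_vec j"] j by simp
next
  show "dot n x v \<in> Q" if "\<forall>j<n. v j \<in> Q" for x
    unfolding dot_commute[of n x] using that by (intro dot_mem Q) blast
qed

lemma vec_len_between_finite:
  assumes Q: "m_primary Q"
  shows "vec.len_between {v. \<forall>j<n. v j \<in> Q} UNIV \<noteq> \<infinity>"
proof -
  let ?O = "{v. \<forall>j<n. v j \<in> Q}" and ?E = "unit_vec ` {..<n} :: (nat \<Rightarrow> 'a) set"
  have ideal_Q: "ideal Q"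
    by (rule m_primary_ideal[OF Q])
  then have O: "vec.subspace ?O"
    by (auto simp: vec.subspace_def ideal_def)
  have "v \<in> ?O + vec.span ?E" for v :: "nat \<Rightarrow> 'a"
  proof -
    let ?v = "\<lambda>j. if j < n then v j else 0"
    have "(v - ?v) + ?v \<in> ?O + vec.span ?E"
      using R.subspace_0[OF ideal_Q] by (intro set_plus_intro truncate_mem_span_unit_vec) simp
    then show ?thesis
      by simp
  qed
  then have "?O + vec.span ?E = UNIV"
    by blast
  moreover have "vec.len_between ?O (?O + vec.span ?E) \<le> enat (card ?E) * colength Q"
    by (intro vec.len_between_plus_span_le O ideal_Q) (auto intro: ideal_mult_right[OF ideal_Q])
  ultimately show ?thesis
    using len_quot_eq[OF Q] by (auto dest: enat_ile)
qed

lemma functional_separating: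
  assumes Q: "m_primary Q" "simple_socle Q" and N: "vec.subspace N" "{v. \<forall>j<n. v j \<in> Q} \<subseteq> N"
    and a: "a \<notin> N"
  shows "\<exists>w. (\<forall>c\<in>N. dot n w c \<in> Q) \<and> dot n w a \<notin> Q"
proof -
  have ideal_Q: "ideal Q"
    by (rule m_primary_ideal[OF Q(1)])
  interpret pairing: symmetric_pairing m scale_vec "dot n" Q
    by (rule symmetric_pairing_dot[OF ideal_Q Q(2)])
  have "pairing.perp UNIV = {v. \<forall>j<n. v j \<in> Q}"
    using all_dot_mem_iff[OF ideal_Q] by (simp add: pairing.perp_def)
  then have "pairing.perp (pairing.perp N) = N"
    using pairing.perp_perp[OF _ N(1)] vec_len_between_finite[OF Q(1)] N(2) by simp
  then have "a \<notin> pairing.perp (pairing.perp N)"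
    using a by simp
  then obtain w where w: "w \<in> pairing.perp N" "dot n w a \<notin> Q"
    unfolding pairing.perp_def[of "pairing.perp N"] by blast
  then have "\<forall>c\<in>N. dot n w c \<in> Q"
    by (simp add: pairing.perp_def dot_commute[of n w])
  then show ?thesis
    using w(2) by blast
qed

lemma m_primary_if_colength_finite:
  assumes Q: "ideal Q" "colength Q \<noteq> \<infinity>"
  shows "m_primary Q"
  unfolding m_primary_def
proof (intro conjI ballI Q(1))
  fix a assume a: "a \<in> m"
  define D where "D k = Q + gen_ideal {a ^ k}" for k
  have "D (Suc k) \<subseteq> D k" for k
    unfolding D_def power_Suc by (intro set_plus_mono2 gen_ideal_singleton_mono) simp
  then obtain k where k: "D (Suc k) = D k"
    using R.finite_length_dcc[OF R.subspace_UNIV Q, of D] Q(1)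
    by (auto simp: D_def R.subspace_set_plus R.set_plus_upper_left)
  have "a ^ k \<in> D (Suc k)"
    unfolding k unfolding D_def by (rule subsetD[OF R.set_plus_upper_right[OF Q(1)]]) simp
  then obtain r where r: "a ^ k - r * a ^ Suc k \<in> Q"
    unfolding D_def using R.mem_plus_span_singleton by blast
  then have "(1 - r * a) * a ^ k \<in> Q"
    by (simp add: algebra_simps)
  then have "a ^ k \<in> Q"
    by (rule unit_mult_mem[OF Q(1) one_minus_notin_m[OF R.subspace_scale[OF ideal_m a]]])
  then show "\<exists>k. a ^ k \<in> Q" ..
qed

lemma m_primary_parameter_powers:
  assumes xs: "regular_sop {0} xs"
  shows "m_primary (gen_ideal ((\<lambda>x. x ^ Suc k) ` set xs))"
proof (rule m_primary_if_colength_finite)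
  have "colength (gen_ideal ((\<lambda>x. x ^ Suc k) ` set xs))
      = enat (Suc k ^ length xs) * colength (gen_ideal (set xs))"
    using colength_regular_seq_powers[OF R.subspace_single_0 regular_sop_zeroD(1,2)[OF xs], of "Suc k"]
    by simp
  moreover have "colength (gen_ideal (set xs)) = enat (len_quot (gen_ideal (set xs)))"
    by (intro len_quot_eq regular_sop_zeroD[OF xs])
  ultimately show "colength (gen_ideal ((\<lambda>x. x ^ Suc k) ` set xs)) \<noteq> \<infinity>"
    by simp
qed simp

end

context frobenius_power
begin

abbreviation frob_linear :: "('a \<Rightarrow> 'a) \<Rightarrow> bool" where
  "frob_linear \<equiv> module_hom (\<lambda>r x. r ^ q * x) (*)"

lemma frob_linear_iff:
  "frob_linear \<phi> \<longleftrightarrow> (\<forall>a b. \<phi> (a + b) = \<phi> a + \<phi> b) \<and> (\<forall>r x. \<phi> (r ^ q * x) = r * \<phi> x)"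
  by (simp add: module_hom_iff frob.module_axioms R.module_axioms)

end

locale frobenius_presentation = frobenius_local +
  fixes y :: "nat \<Rightarrow> 'a" and n :: nat
  assumes span_y: "frob.span (y ` {..<n}) = UNIV"
begin

definition ev :: "(nat \<Rightarrow> 'a) \<Rightarrow> 'a" where
  "ev c = (\<Sum>j<n. c j ^ q * y j)"

sublocale ev: module_hom scale_vec "\<lambda>r x. r ^ q * x" ev
  by unfold_locales
    (simp_all add: ev_def power_q_add distrib_right sum.distrib power_mult_distrib sum_distrib_left mult.assoc)

lemma ev_cong: "(\<And>j. j < n \<Longrightarrow> c j = c' j) \<Longrightarrow> ev c = ev c'"
  by (simp add: ev_def)

lemma ev_unit_vec: "i < n \<Longrightarrow> ev (unit_vec i) = y i"
proof -
  assume i: "i < n"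
  have "ev (unit_vec i) = (\<Sum>j<n. if j = i then y i else 0)"
    unfolding ev_def by (rule sum.cong) (auto simp: unit_vec_def power_q_zero)
  then show ?thesis
    using i by simp
qed

lemma surj_ev: "\<exists>c. ev c = x"
proof -
  have "ev ` unit_vec ` {..<n} = y ` {..<n}"
    by (auto simp: ev_unit_vec image_iff)
  then have "x \<in> ev ` vec.span (unit_vec ` {..<n})"
    using ev.span_image[of "unit_vec ` {..<n}"] span_y by simp
  then show ?thesis
    by blast
qed

lemma frob_linear_of_relations:
  assumes w: "\<And>c. ev c = 0 \<Longrightarrow> dot n w c = 0"
  shows "\<exists>\<phi>. frob_linear \<phi> \<and> (\<forall>c. \<phi> (ev c) = dot n w c)"
proof -
  interpret w: module_hom scale_vec "(*)" "dot n w"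
    by (rule module_hom_dot)
  obtain C where C: "\<And>x. ev (C x) = x"
    using surj_ev by metis
  have \<phi>: "dot n w (C (ev c)) = dot n w c" for c
    using w[of "C (ev c) - c"] by (simp add: ev.diff w.diff C)
  have "dot n w (C (a + b)) = dot n w (C a) + dot n w (C b)" for a b
    using \<phi>[of "C a + C b"] by (simp add: ev.add w.add C)
  moreover have "dot n w (C (r ^ q * x)) = r * dot n w (C x)" for r x
    using \<phi>[of "scale_vec r (C x)"] by (simp add: ev.scale w.scale C)
  ultimately show ?thesis
    using \<phi> by (intro exI[of _ "\<lambda>x. dot n w (C x)"]) (simp add: frob_linear_iff)
qed

lemma finitely_many_relations:
  "\<exists>b (k :: nat \<Rightarrow> nat \<Rightarrow> 'a). (\<forall>i<b. ev (k i) = 0) \<and>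
    (\<forall>w c. (\<forall>i<b. dot n w (k i) = 0) \<longrightarrow> ev c = 0 \<longrightarrow> dot n w c = 0)"
proof -
  let ?T = "vec.span (unit_vec ` {..<n}) :: (nat \<Rightarrow> 'a) set"
  let ?K = "{c. ev c = 0} \<inter> ?T"
  have "vec.noetherian ?T"
    by (rule vec.noetherian_span_finite[OF noetherian_UNIV]) simp
  moreover have "vec.subspace ?K"
    by (intro vec.subspace_inter ev.subspace_kernel vec.subspace_span)
  ultimately obtain G where G: "finite G" "?K = vec.span G"
    using vec.noetherian_finitely_generated by blast
  obtain k where k_G: "k ` {..<card G} = G"
    using finite_eq_image_lessThan_card[OF G(1)] by blast
  have G_K: "G \<subseteq> ?K"
    unfolding G(2) by (rule vec.span_superset)
  have "dot n w c = 0" if w: "\<forall>i<card G. dot n w (k i) = 0" and c: "ev c = 0" for w c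
  proof -
    let ?c = "\<lambda>j. if j < n then c j else 0"
    interpret w: module_hom scale_vec "(*)" "dot n w"
      by (rule module_hom_dot)
    have "k ` {..<card G} \<subseteq> {c. dot n w c = 0}"
      using w by auto
    then have "vec.span G \<subseteq> {c. dot n w c = 0}"
      unfolding k_G by (intro vec.span_minimal w.subspace_kernel)
    moreover have "ev ?c = ev c"
      by (rule ev_cong) simp
    then have "?c \<in> vec.span G"
      using c truncate_mem_span_unit_vec[of n c] unfolding G(2)[symmetric] by simp
    moreover have "dot n w ?c = dot n w c"
      by (rule dot_cong) simp
    ultimately show ?thesis
      by auto
  qed
  moreover have "\<forall>i<card G. ev (k i) = 0"
    using G_K k_G by blast
  ultimately show ?thesis
    by (intro exI[of _ "card G"] exI[of _ k]) simp
qed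

lemma functional_mod_frob_pow:
  assumes Q: "m_primary Q" "simple_socle Q" and a: "ev a \<notin> frob_pow Q q"
  shows "\<exists>w. (\<forall>c. ev c = 0 \<longrightarrow> dot n w c \<in> Q) \<and> dot n w a \<notin> Q"
proof -
  let ?N = "ev -` frob_pow Q q"
  have "vec.subspace ?N"
    by (intro ev.subspace_vimage ideal_imp_frob_subspace ideal_frob_pow)
  moreover have "{v. \<forall>j<n. v j \<in> Q} \<subseteq> ?N"
    unfolding ev_def by (auto intro!: R.subspace_sum power_times_mem_frob_pow)
  ultimately obtain w where "\<forall>c\<in>?N. dot n w c \<in> Q" "dot n w a \<notin> Q"
    using functional_separating[OF Q] a by blast
  then show ?thesis
    using R.subspace_0[OF ideal_frob_pow, of Q q] by auto
qed

end

lemma prod_list_map_power: "prod_list (map (\<lambda>x. x ^ k) xs) = prod_list xs ^ k"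
  for xs :: "'a::comm_monoid_mult list"
  by (induction xs) (simp_all add: power_mult_distrib)

lemma (in frobenius_local) mem_frob_colon_if_socle_power:
  assumes xs: "set xs \<subseteq> m" "regular_seq {0} xs"
    and r: "(prod_list xs ^ N * u) ^ q * r \<in> frob_pow (gen_ideal ((\<lambda>x. x ^ Suc N) ` set xs)) q"
  shows "r \<in> frob_colon q (gen_ideal (set xs)) u"
proof -
  let ?ys = "map (\<lambda>x. x ^ q) xs"
  have ys: "set ?ys \<subseteq> m" "regular_seq {0} ?ys"
    using xs regular_seq_powers[OF R.subspace_single_0 xs q_pos] power_mem_m[OF _ q_pos] by auto
  have "prod_list ?ys ^ N * (r * u ^ q) \<in> {0} + gen_ideal ((\<lambda>x. x ^ Suc N) ` set ?ys)"
    using r by (simp add: frob_pow_gen_ideal image_image prod_list_map_power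
        power_mult_distrib ac_simps flip: power_mult del: power_Suc)
  then have "r * u ^ q \<in> {0} + gen_ideal (set ?ys)"
    by (rule regular_seq_colon_power[OF R.subspace_single_0 ys])
  then show ?thesis
    by (simp add: frob_colon_def frob_pow_gen_ideal)
qed

theorem (in frobenius_presentation) frob_splitting_of_presentation:
  assumes xs: "regular_sop {0} xs" and u: "socle_generator (gen_ideal (set xs)) u"
    and r: "r \<notin> frob_colon q (gen_ideal (set xs)) u"
  shows "\<exists>\<phi>. frob_linear \<phi> \<and> \<phi> r = 1"
proof -
  obtain \<rho> where \<rho>: "ev \<rho> = r"
    using surj_ev by blast
  obtain b and k :: "nat \<Rightarrow> nat \<Rightarrow> 'a" where k: "\<forall>i<b. ev (k i) = 0"
    and relations: "\<And>w c. \<forall>i<b. dot n w (k i) = 0 \<Longrightarrow> ev c = 0 \<Longrightarrow> dot n w c = 0"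
    using finitely_many_relations by blast
  have xs': "set xs \<subseteq> m" "regular_seq {0} xs"
    by (rule regular_sop_zeroD[OF xs])+
  obtain N where N: "\<And>v. (\<forall>i<b. dot n v (k i) \<in> gen_ideal ((\<lambda>x. x ^ N) ` set xs)) \<Longrightarrow>
      \<exists>w. (\<forall>j. v j - w j \<in> m) \<and> (\<forall>i<b. dot n w (k i) = 0)"
    using exact_solution_near_approximate[OF finite_set xs'(1)] by metis
  let ?Q = "gen_ideal ((\<lambda>x. x ^ Suc N) ` set xs)" and ?u = "prod_list xs ^ N * u"
  have Q: "m_primary ?Q" "socle_generator ?Q ?u"
    using m_primary_parameter_powers[OF xs] socle_generator_powers[OF R.subspace_single_0 xs', of u N] u
    by simp_all
  have "ev (scale_vec ?u \<rho>) \<notin> frob_pow ?Q q"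
    using mem_frob_colon_if_socle_power[OF xs'(1,2), of N u r] r by (auto simp: ev.scale \<rho>)
  then obtain v where v: "\<forall>c. ev c = 0 \<longrightarrow> dot n v c \<in> ?Q" "dot n v (scale_vec ?u \<rho>) \<notin> ?Q"
    using functional_mod_frob_pow[OF Q(1)] Q(2) unfolding simple_socle_def by blast
  have "?Q \<subseteq> gen_ideal ((\<lambda>x. x ^ N) ` set xs)"
    by (intro R.span_minimal R.subspace_span) (auto intro: R.span_base R.span_scale)
  then obtain w where w: "\<forall>j. v j - w j \<in> m" "\<forall>i<b. dot n w (k i) = 0"
    using N[of v] v(1) k by blast
  have "dot n v \<rho> \<notin> m"
    using v(2) socle_generatorD(2)[OF Q(2)] by (auto simp: dot_commute[of n v] dot_scale mult.commute)
  moreover have "dot n v \<rho> - dot n w \<rho> \<in> m"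
    using dot_add[of n "v - w" w \<rho>] dot_mem[OF ideal_m, of n "v - w" \<rho>] w(1) by simp
  ultimately have "dot n w \<rho> \<notin> m"
    using R.subspace_diff_mem_iff[OF ideal_m] by blast
  then obtain s where s: "s * dot n w \<rho> = 1"
    by (rule unit_inverse)
  obtain \<phi> where \<phi>: "frob_linear \<phi>" "\<And>c. \<phi> (ev c) = dot n w c"
    using frob_linear_of_relations[OF relations[OF w(2)]] by blast
  have "frob_linear (\<lambda>x. s * \<phi> x)"
    using \<phi>(1) by (simp add: frob_linear_iff distrib_left mult.left_commute)
  then show ?thesis
    using \<phi>(2)[of \<rho>] s unfolding \<rho> by (intro exI[of _ "\<lambda>x. s * \<phi> x"]) simp
qed

section \<open>The F-signature\<close>

lemma (in frobenius_finite_local) frob_splitting_exists: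
  assumes "regular_sop {0} xs" "socle_generator (gen_ideal (set xs)) u"
    and "r \<notin> frob_colon q (gen_ideal (set xs)) u"
  shows "\<exists>\<phi>. frob_linear \<phi> \<and> \<phi> r = 1"
proof -
  obtain S where S: "finite S" "frob.span S = UNIV"
    using frob_finite by blast
  obtain y where "y ` {..<card S} = S"
    using finite_eq_image_lessThan_card[OF S(1)] by blast
  then interpret frobenius_presentation m q y "card S"
    using S(2) by unfold_locales simp
  show ?thesis
    by (rule frob_splitting_of_presentation[OF assms])
qed

context frobenius_local
begin

lemma frob_linear_frob_pow:
  assumes \<phi>: "frob_linear \<phi>" and Q: "ideal Q" and x: "x \<in> frob_pow Q q"
  shows "\<phi> x \<in> Q"
proof -
  interpret \<phi>: module_hom "\<lambda>r x. r ^ q * x" "(*)" \<phi>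
    by (rule \<phi>)
  have "frob.ideal_scale Q UNIV \<subseteq> \<phi> -` Q"
    using Q by (intro frob.ideal_scale_least \<phi>.subspace_vimage)
      (auto simp: subspace_times_eq_ideal \<phi>.scale intro: ideal_mult_right)
  then show ?thesis
    using frob_pow_subset_ideal_scale x by blast
qed

lemma frob_linear_frob_colon:
  assumes \<phi>: "frob_linear \<phi>" and Q: "ideal Q" "u \<notin> Q" and x: "x \<in> frob_colon q Q u"
  shows "\<phi> x \<in> m"
proof (rule ccontr)
  assume "\<phi> x \<notin> m"
  have "u ^ q * x \<in> frob_pow Q q"
    using x unfolding frob_colon_def mult.commute[of _ "u ^ q"] by simp
  then have "\<phi> (u ^ q * x) \<in> Q"
    by (rule frob_linear_frob_pow[OF \<phi> Q(1)])
  then have "\<phi> x * u \<in> Q"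
    using module_hom.scale[OF \<phi>, of u x] by (simp only: mult.commute)
  then show False
    using unit_mult_mem[OF Q(1) \<open>\<phi> x \<notin> m\<close>] Q(2) by blast
qed

definition frob_dual_system :: "nat \<Rightarrow> (nat \<Rightarrow> 'a \<Rightarrow> 'a) \<Rightarrow> (nat \<Rightarrow> 'a) \<Rightarrow> bool" where
  "frob_dual_system k \<phi> y \<longleftrightarrow> (\<forall>i<k. frob_linear (\<phi> i)) \<and> (\<forall>i<k. \<forall>j<k. \<phi> i (y j) = (if i = j then 1 else 0))"

lemma free_rank_frob_eq_Sup: "free_rank_frob q TYPE('a) = Sup {k. \<exists>\<phi> y. frob_dual_system k \<phi> y}"
  by (simp add: free_rank_frob_def frob_dual_system_def frob_linear_iff)

lemma frob_dual_system_le: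
  assumes Q: "m_primary Q" "u \<notin> Q" and dual: "frob_dual_system k \<phi> y"
  shows "k \<le> len_quot (frob_colon q Q u)"
proof -
  let ?A = "frob_colon q Q u"
  define E where "E i = ?A + frob.span (y ` {..<i})" for i
  have E: "frob.subspace (E i)" "E i \<subseteq> E (Suc i)" for i
    unfolding E_def
    by (simp_all add: frob.subspace_set_plus ideal_imp_frob_subspace set_plus_mono2 frob.span_mono image_mono)
  have y_mem: "y i \<in> E (Suc i)" for i
    unfolding E_def
    by (rule subsetD[OF frob.set_plus_upper_right[OF ideal_imp_frob_subspace[OF ideal_frob_colon]]])
      (simp add: frob.span_base)
  have y_notin: "y i \<notin> E i" if i: "i < k" for i
  proof
    interpret \<phi>: module_hom "\<lambda>r x. r ^ q * x" "(*)" "\<phi> i"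
      using dual i by (simp add: frob_dual_system_def)
    have "frob.subspace (\<phi> i -` m)"
      by (rule \<phi>.subspace_vimage) (simp add: subspace_times_eq_ideal)
    moreover have "?A \<subseteq> \<phi> i -` m"
      using frob_linear_frob_colon[OF \<phi>.module_hom_axioms m_primary_ideal[OF Q(1)] Q(2)] by blast
    moreover have "y ` {..<i} \<subseteq> \<phi> i -` m"
      using dual i R.subspace_0[OF ideal_m] by (auto simp: frob_dual_system_def)
    ultimately have "E i \<subseteq> \<phi> i -` m"
      unfolding E_def by (intro frob.set_plus_least frob.span_minimal)
    moreover assume "y i \<in> E i"
    ultimately show False
      using dual i by (auto simp: frob_dual_system_def)
  qed
  have chain: "enat (card {i. i < k \<and> E i \<noteq> E (Suc i)}) \<le> frob.len_between (E 0) (E k)" "E 0 \<subseteq> E k"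
    using frob.weak_chain_length_le[of k E] E by auto
  have "{i. i < k \<and> E i \<noteq> E (Suc i)} = {..<k}"
    using y_mem y_notin by blast
  then have "enat k \<le> frob.len_between (E 0) (E k)"
    using chain(1) by simp
  also have "\<dots> \<le> frob.len_between (E 0) UNIV"
    using chain(2) E(1) by (intro frob.len_between_mono) auto
  also have "\<dots> = enat (len_quot ?A)"
    unfolding E_def using m_primary_frob_colon[OF Q(1)] by (simp add: frob_colength_eq)
  finally show ?thesis
    by simp
qed

lemma frob_dual_system_complement:
  assumes u: "socle_generator Q u" and Q: "m_primary Q"
    and dual: "frob_dual_system k \<phi> y" and k: "k < len_quot (frob_colon q Q u)"
  shows "\<exists>v. v \<notin> frob_colon q Q u \<and> (\<forall>i<k. \<phi> i v = 0)"
proof (rule ccontr)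
  let ?A = "frob_colon q Q u"
  have A: "frob.subspace ?A"
    by (simp add: ideal_imp_frob_subspace)
  assume "\<nexists>v. v \<notin> ?A \<and> (\<forall>i<k. \<phi> i v = 0)"
  then have kernel: "v \<in> ?A" if "\<forall>i<k. \<phi> i v = 0" for v
    using that by blast
  have "v \<in> ?A + frob.span (y ` {..<k})" for v
  proof -
    let ?w = "\<Sum>j<k. \<phi> j v ^ q * y j"
    have "\<phi> i (v - ?w) = 0" if i: "i < k" for i
    proof -
      interpret \<phi>: module_hom "\<lambda>r x. r ^ q * x" "(*)" "\<phi> i"
        using dual i by (simp add: frob_dual_system_def)
      have "\<phi> i ?w = (\<Sum>j<k. if j = i then \<phi> j v else 0)"
        unfolding \<phi>.sum \<phi>.scale using dual i by (intro sum.cong) (auto simp: frob_dual_system_def)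
      then show ?thesis
        using i by (simp add: \<phi>.diff)
    qed
    then have "(v - ?w) + ?w \<in> ?A + frob.span (y ` {..<k})"
      by (intro set_plus_intro kernel frob.span_sum frob.span_scale frob.span_base) auto
    then show ?thesis
      by simp
  qed
  then have "?A + frob.span (y ` {..<k}) = UNIV"
    by blast
  moreover have "r ^ q * a \<in> ?A" if "r \<in> m" for r a
    using frob_pow_subset_frob_colon[of m u Q q] socle_generatorD(2)[OF u] power_times_mem_frob_pow[OF that]
    by blast
  then have "frob.len_between ?A (?A + frob.span (y ` {..<k})) \<le> enat (card (y ` {..<k})) * colength m"
    by (intro frob.len_between_plus_span_le A ideal_m) auto
  ultimately have "len_quot ?A \<le> card (y ` {..<k})"
    using frob_colength_eq[OF m_primary_frob_colon[OF Q], of u] by (simp add: colength_m)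
  also have "\<dots> \<le> k"
    using card_image_le[of "{..<k}" y] by simp
  finally show False
    using k by simp
qed

lemma frob_dual_system_extend:
  assumes dual: "frob_dual_system k \<phi> y" and v: "\<forall>i<k. \<phi> i v = 0" and \<psi>: "frob_linear \<psi>" "\<psi> v = 1"
  shows "\<exists>\<phi>' y'. frob_dual_system (Suc k) \<phi>' y'"
proof -
  define \<psi>' where "\<psi>' x = \<psi> x - (\<Sum>i<k. \<psi> (y i) * \<phi> i x)" for x
  have add: "\<phi> i (a + b) = \<phi> i a + \<phi> i b" and scale: "\<phi> i (r ^ q * a) = r * \<phi> i a" if "i < k" for i a b r
    using dual that unfolding frob_dual_system_def frob_linear_iff by blast+
  have "\<psi>' (a + b) = \<psi>' a + \<psi>' b" for a b
    using \<psi>(1) unfolding \<psi>'_def frob_linear_iff by (simp add: add distrib_left sum.distrib)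
  moreover have "\<psi>' (r ^ q * a) = r * \<psi>' a" for r a
    using \<psi>(1) unfolding \<psi>'_def frob_linear_iff
    by (simp add: scale right_diff_distrib sum_distrib_left mult.left_commute)
  ultimately have "frob_linear \<psi>'"
    by (simp add: frob_linear_iff)
  moreover have "\<psi>' v = 1"
    using v \<psi>(2) by (simp add: \<psi>'_def)
  moreover have "\<psi>' (y j) = 0" if j: "j < k" for j
  proof -
    have "(\<Sum>i<k. \<psi> (y i) * \<phi> i (y j)) = (\<Sum>i<k. if i = j then \<psi> (y i) else 0)"
      using dual j by (intro sum.cong) (auto simp: frob_dual_system_def)
    then show ?thesis
      using j by (simp add: \<psi>'_def)
  qed
  ultimately have "frob_dual_system (Suc k) (\<phi>(k := \<psi>')) (y(k := v))"
    using dual v by (auto simp: frob_dual_system_def less_Suc_eq)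
  then show ?thesis
    by blast
qed

end

theorem (in frobenius_finite_local) free_rank_frob_eq:
  assumes xs: "regular_sop {0} xs" and u: "socle_generator (gen_ideal (set xs)) u"
  shows "free_rank_frob q TYPE('a) = len_quot (frob_colon q (gen_ideal (set xs)) u)" (is "_ = ?l")
proof -
  have Q: "m_primary (gen_ideal (set xs))"
    by (rule regular_sop_zeroD[OF xs])
  have "\<exists>\<phi> y. frob_dual_system k \<phi> y" if "k \<le> ?l" for k
    using that
  proof (induction k)
    case 0
    show ?case
      by (simp add: frob_dual_system_def)
  next
    case (Suc k)
    then obtain \<phi> y where dual: "frob_dual_system k \<phi> y"
      by auto
    obtain v where v: "v \<notin> frob_colon q (gen_ideal (set xs)) u" "\<forall>i<k. \<phi> i v = 0"
      using frob_dual_system_complement[OF u Q dual] Suc.prems by auto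
    obtain \<psi> where \<psi>: "frob_linear \<psi>" "\<psi> v = 1"
      using frob_splitting_exists[OF xs u v(1)] by blast
    show ?case
      by (rule frob_dual_system_extend[OF dual v(2) \<psi>])
  qed
  then have "{k. \<exists>\<phi> y. frob_dual_system k \<phi> y} = {..?l}"
    using frob_dual_system_le[OF Q socle_generatorD(1)[OF u]] by blast
  then show ?thesis
    unfolding free_rank_frob_eq_Sup by (simp add: cSup_eq_maximum[of ?l])
qed

context F_finite_local
begin

lemma residue_frob_degree_eq: "residue_frob_degree p m = 1"
proof -
  have "m \<noteq> UNIV"
    using one_notin_m by blast
  then have "prime_ideal m"
    using prime_m by (simp add: prime_ideal_def)
  moreover have "a \<in> m + frob.span {1}" for a
    using residue_power_q[of a] by (simp add: frob.mem_plus_span_singleton)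
  then have "m + frob.span {1} = UNIV"
    by blast
  ultimately have "k \<le> 1" if "frob_independent p m {..<k} y" for k and y :: "nat \<Rightarrow> 'a"
    using frob_independent_card_le[OF _ that, of "{1}"] by simp
  moreover have "frob_independent p m {..<1} (\<lambda>_ :: nat. 1 :: 'a)"
    using power_mem_mD by (auto simp: frob_independent_def)
  ultimately have "Sup {k. \<exists>y :: nat \<Rightarrow> 'a. frob_independent p m {..<k} y} = 1"
    by (intro cSup_eq_maximum) blast+
  then show ?thesis
    by (simp add: residue_frob_degree_def frob_independent_def Ball_def)
qed

theorem F_signature_tendsto:
  assumes reduced: "reduced_ring TYPE('a)" and xs: "regular_sop {0} xs"
    and u: "socle_generator (gen_ideal (set xs)) u"
  shows "(\<lambda>e. real (len_quot (frob_colon (p ^ e) (gen_ideal (set xs)) u)) / real (p ^ e) ^ length xs)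
    \<longlonglongrightarrow> F_signature p m (length xs)"
proof -
  let ?Q = "gen_ideal (set xs)" and ?d = "length xs"
  let ?hk = "\<lambda>K e. real (len_quot (frob_pow K (p ^ e))) / real (p ^ e) ^ ?d"
  let ?a = "\<lambda>e. real (len_quot (frob_colon (p ^ e) ?Q u)) / real (p ^ e) ^ ?d"
  have Q: "m_primary ?Q" "m_primary (?Q + gen_ideal {u})"
    using regular_sop_zeroD(3)[OF xs] m_primary_mono[of ?Q "?Q + gen_ideal {u}"]
    by (simp_all add: R.subspace_set_plus R.set_plus_upper_left)
  have "?a e = ?hk ?Q e - ?hk (?Q + gen_ideal {u}) e" for e
  proof -
    interpret pe: frobenius_finite_local m "p ^ e"
      by (rule frobenius_finite_local_p_power)
    show ?thesis
      by (simp add: pe.len_quot_frob_colon[OF Q(1), of u, symmetric] diff_divide_distrib[symmetric])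
  qed
  then have "convergent ?a"
    using convergent_diff[OF hk_convergent[OF reduced xs Q(1)] hk_convergent[OF reduced xs Q(2)]] by simp
  moreover have "free_rank_frob (p ^ e) TYPE('a) = len_quot (frob_colon (p ^ e) ?Q u)" for e
    by (rule frobenius_finite_local.free_rank_frob_eq[OF frobenius_finite_local_p_power xs u])
  moreover have "real (p ^ e) powr (real ?d + alpha_F p m) = real (p ^ e) ^ ?d" for e
    using p_gt_1 by (simp add: alpha_F_def residue_frob_degree_eq powr_realpow)
  ultimately show ?thesis
    unfolding F_signature_def by (simp add: convergent_LIMSEQ_iff)
qed

end

section \<open>The main inequality\<close>

context frobenius_finite_local
begin

lemma simple_socle_frob_pow_parameters:
  assumes xs: "regular_sop {0} xs" and Q: "simple_socle (gen_ideal (set xs))"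
  shows "simple_socle (frob_pow (gen_ideal (set xs)) q)"
proof -
  obtain u where u: "socle_generator (gen_ideal (set xs)) u"
    using Q unfolding simple_socle_def by blast
  obtain n where n: "q = Suc n"
    using q_pos gr0_implies_Suc by blast
  have "socle_generator (gen_ideal ((\<lambda>x. x ^ q) ` set xs)) (prod_list xs ^ n * u)"
    using socle_generator_powers[OF R.subspace_single_0 regular_sop_zeroD(1,2)[OF xs], of u n] u
    unfolding n by (simp del: power_Suc)
  then show ?thesis
    unfolding simple_socle_def frob_pow_gen_ideal by blast
qed

lemma parameter_len_quot_inequality:
  assumes xs: "regular_sop {0} xs" and u: "socle_generator (gen_ideal (set xs)) u"
    and I: "ideal I" "gen_ideal (set xs) \<subseteq> I"
  defines "L \<equiv> len_quot (gen_ideal (set xs))" and "\<mu> \<equiv> mu_quot I (gen_ideal (set xs))"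
    and "h \<equiv> len_quot (frob_pow m q)" and "a \<equiv> len_quot (frob_colon q (gen_ideal (set xs)) u)"
  shows "L * q ^ length xs + \<mu> * h \<le> L * h + \<mu> * a" "a \<le> h" "\<mu> \<le> L"
proof -
  have Q: "m_primary (gen_ideal (set xs))" "simple_socle (gen_ideal (set xs))"
    using regular_sop_zeroD(3)[OF xs] u by (auto simp: simple_socle_def)
  show "L * q ^ length xs + \<mu> * h \<le> L * h + \<mu> * a" "\<mu> \<le> L"
    using frob_len_quot_inequality[OF Q(1) u simple_socle_frob_pow_parameters[OF xs Q(2)] I]
    unfolding len_quot_frob_pow_parameters[OF xs] L_def \<mu>_def h_def a_def by (simp_all add: mult.commute)
  show "a \<le> h"
    unfolding a_def h_def
    by (intro len_quot_antimono m_primary_frob_pow m_primary_m ideal_frob_colon frob_pow_subset_frob_colon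
        socle_generatorD(2)[OF u])
qed

end

context F_finite_local
begin

lemma hk_mult_inequalities:
  assumes reduced: "reduced_ring TYPE('a)" and xs: "regular_sop {0} xs"
    and Q: "simple_socle (gen_ideal (set xs))"
    and I: "ideal I" "gen_ideal (set xs) \<subseteq> I"
  defines "E \<equiv> hk_mult p m (length xs)" and "s \<equiv> F_signature p m (length xs)"
    and "L \<equiv> real (len_quot (gen_ideal (set xs)))" and "\<mu> \<equiv> real (mu_quot I (gen_ideal (set xs)))"
  shows "L + \<mu> * E \<le> L * E + \<mu> * s" "\<mu> \<le> L" "s \<le> E" "0 \<le> E" "1 \<le> L"
proof -
  let ?Q = "gen_ideal (set xs)"
  obtain u where u: "socle_generator ?Q u"
    using Q unfolding simple_socle_def by blast
  have m_primary: "m_primary ?Q"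
    by (rule regular_sop_zeroD[OF xs])
  define h a D where "h e = real (len_quot (frob_pow m (p ^ e)))"
    and "a e = real (len_quot (frob_colon (p ^ e) ?Q u))" and "D e = real (p ^ e) ^ length xs" for e
  have h: "(\<lambda>e. h e / D e) \<longlonglongrightarrow> E"
    unfolding h_def D_def E_def by (rule hk_mult_tendsto[OF reduced xs m_primary_m])
  have a: "(\<lambda>e. a e / D e) \<longlonglongrightarrow> s"
    unfolding a_def D_def s_def by (rule F_signature_tendsto[OF reduced xs u])
  have D: "0 < D e" for e
    using p_gt_1 by (simp add: D_def)
  have finite_level: "L * D e + \<mu> * h e \<le> L * h e + \<mu> * a e" "a e \<le> h e" "\<mu> \<le> L" for e
    using frobenius_finite_local.parameter_len_quot_inequality[OF frobenius_finite_local_p_power[of e] xs u I]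
    unfolding L_def D_def \<mu>_def h_def a_def of_nat_power[symmetric] of_nat_mult[symmetric]
      of_nat_add[symmetric] of_nat_le_iff .
  show "L + \<mu> * E \<le> L * E + \<mu> * s"
  proof (rule LIMSEQ_le)
    show "(\<lambda>e. L + \<mu> * (h e / D e)) \<longlonglongrightarrow> L + \<mu> * E" "(\<lambda>e. L * (h e / D e) + \<mu> * (a e / D e)) \<longlonglongrightarrow> L * E + \<mu> * s"
      by (intro tendsto_intros h a)+
    have "L + \<mu> * (h e / D e) \<le> L * (h e / D e) + \<mu> * (a e / D e)" for e
      using divide_right_mono[OF finite_level(1)[of e], of "D e"] D[of e] by (simp add: add_divide_distrib)
    then show "\<exists>N. \<forall>e\<ge>N. L + \<mu> * (h e / D e) \<le> L * (h e / D e) + \<mu> * (a e / D e)"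
      by blast
  qed
  show "s \<le> E"
    using finite_level(2) D
    by (intro LIMSEQ_le[OF a h] exI allI impI divide_right_mono) (auto intro: less_imp_le)
  show "\<mu> \<le> L"
    by (rule finite_level(3))
  show "0 \<le> E"
    by (rule LIMSEQ_le_const[OF h]) (simp add: h_def D_def)
  have "len_quot m \<le> len_quot ?Q"
    by (intro len_quot_antimono m_primary ideal_m regular_sop_zeroD[OF xs])
  then show "1 \<le> L"
    using len_quot_eq[OF m_primary_m] by (simp add: L_def colength_m one_enat_def)
qed

end

lemma regular_sequence_imp_regular_seq:
  assumes "regular_sequence d x"
  shows "regular_seq {0} (map x [0..<d])"
proof -
  have "k \<le> d \<Longrightarrow> regular_seq {0} (map x [0..<k])" for k
  proof (induction k)
    case (Suc k)
    have "nzd_mod (gen_ideal (x ` {..<k})) (x k)"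
      using assms Suc.prems unfolding regular_sequence_def by (intro nzd_modI) simp
    then show ?case
      using Suc by (simp add: regular_seq_snoc atLeast0LessThan)
  qed simp
  then show ?thesis
    by simp
qed

context noetherian_local
begin

lemma sop_imp_m_primary: "sop m d x \<Longrightarrow> m_primary (gen_ideal (x ` {..<d}))"
  using power_mem_ideal_pow unfolding sop_def m_primary_def by (meson R.subspace_span subsetD)

lemma simple_socle_if_irreducible:
  assumes Q: "m_primary Q" "Q \<noteq> UNIV" and irreducible: "irreducible_ideal Q"
  shows "simple_socle Q"
proof -
  have ideal_Q: "ideal Q"
    by (rule m_primary_ideal[OF Q(1)])
  obtain k where "colength Q = enat (Suc k)"
    using len_quot_eq[OF Q(1)] R.len_between_ge_1[OF R.subspace_UNIV ideal_Q] Q(2)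
    by (cases "len_quot Q") (auto simp: one_enat_def zero_enat_def)
  then obtain u where u: "u \<notin> Q" "\<And>r. r \<in> m \<Longrightarrow> r * u \<in> Q"
    using R.simple_extension_exists[OF R.subspace_UNIV ideal_Q subset_UNIV] by metis
  have "\<exists>s. v - s * u \<in> Q" if v: "\<And>r. r \<in> m \<Longrightarrow> r * v \<in> Q" for v
  proof (cases "v \<in> Q")
    case True
    then show ?thesis
      by (intro exI[of _ 0]) simp
  next
    case False
    let ?U = "Q + gen_ideal {u}" and ?V = "Q + gen_ideal {v}"
    have "Q \<subset> ?U" "Q \<subset> ?V"
      using R.psubset_plus_span_singleton[OF ideal_Q] u(1) False by blast+
    then have "Q \<noteq> ?U \<inter> ?V"
      using irreducible ideal_Q unfolding irreducible_ideal_def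
      by (metis R.subspace_set_plus R.subspace_span order_less_irrefl)
    then obtain w where w: "w \<in> ?U" "w \<in> ?V" "w \<notin> Q"
      using \<open>Q \<subset> ?U\<close> \<open>Q \<subset> ?V\<close> by blast
    obtain s where s: "w - s * u \<in> Q"
      using w(1) R.mem_plus_span_singleton by blast
    obtain t where t: "w - t * v \<in> Q"
      using w(2) R.mem_plus_span_singleton by blast
    have "t \<notin> m"
      using v w(3) R.subspace_diff_mem_iff[OF ideal_Q t] by blast
    then obtain t' where t': "t' * t = 1"
      by (rule unit_inverse)
    have "t' * (t * v) = v"
      using t' by (simp add: mult.assoc[symmetric])
    then have "v - (t' * s) * u = t' * (w - s * u) + (- t') * (w - t * v)"
      by (simp add: algebra_simps)
    then show ?thesis
      using R.subspace_lincomb[OF ideal_Q s t] by blast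
  qed
  then show ?thesis
    using socle_generatorI[OF u] unfolding simple_socle_def by blast
qed

end

lemma (in noetherian_local_infinite) gorenstein_parameter_ideal:
  assumes gorenstein: "gorenstein_local m d" and x: "x ` {..<d} \<subseteq> m" "m_primary (gen_ideal (x ` {..<d}))"
  obtains xs where "length xs = d" "regular_sop {0} xs" "gen_ideal (set xs) = gen_ideal (x ` {..<d})"
    "simple_socle (gen_ideal (set xs))"
proof -
  obtain z where z: "sop m d z" "regular_sequence d z" "irreducible_ideal (gen_ideal (z ` {..<d}))"
    using gorenstein unfolding gorenstein_local_def by blast
  let ?zs = "map z [0..<d]"
  have set_zs: "set ?zs = z ` {..<d}"
    by (simp add: atLeast0LessThan)
  have "regular_sop {0} ?zs"
    unfolding regular_sop_def set_zs using z(1) regular_sequence_imp_regular_seq[OF z(2)] sop_imp_m_primary[OF z(1)]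
    by (auto simp: sop_def)
  moreover have "simple_socle (gen_ideal (set ?zs))"
    unfolding set_zs using z(2,3)
    by (intro simple_socle_if_irreducible sop_imp_m_primary z(1)) (simp add: regular_sequence_def)
  ultimately have "\<exists>xs. length xs = length (map x [0..<d]) \<and> regular_sop {0} xs \<and>
      {0} + gen_ideal (set xs) = {0} + gen_ideal (set (map x [0..<d])) \<and>
      simple_socle ({0} + gen_ideal (set (map x [0..<d])))"
    using x by (intro regular_generators_of_parameter_ideal[of "{0}" ?zs])
      (simp_all add: atLeast0LessThan)
  then show thesis
    using that by (auto simp: atLeast0LessThan)
qed

(* If L = \<mu>, the quotients are junk values, but then 1 \<le> s \<le> E. *)
lemma hk_bound_arithmetic:
  fixes E s L \<mu> :: real
  assumes "L + \<mu> * E \<le> L * E + \<mu> * s" "\<mu> \<le> L" "s \<le> E" "0 \<le> E" "1 \<le> L"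
  shows "E \<ge> (L - s * \<mu>) / (L - \<mu>) \<and> E \<ge> 1 + \<mu> / (L - \<mu>) * (1 - s)"
proof (cases "L = \<mu>")
  case True
  then have "L * 1 \<le> L * s"
    using assms(1) by simp
  then have "1 \<le> s"
    using assms(5) by simp
  then show ?thesis
    using True assms(3,4) by simp
next
  case False
  then have "0 < L - \<mu>"
    using assms(2) by simp
  then have "1 + \<mu> / (L - \<mu>) * (1 - s) = (L - s * \<mu>) / (L - \<mu>)" "(L - s * \<mu>) / (L - \<mu>) \<le> E"
    using assms(1) by (simp_all add: field_simps)
  then show ?thesis
    by simp
qed

theorem theorem1p2:
  fixes m :: "'a::comm_ring_1 set" and p d :: nat and x :: "nat \<Rightarrow> 'a" and I :: "'a set"
  assumes "prime p" and "CHAR('a) = p"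
    and "local_ring m" and "noetherian_ring TYPE('a)" and "reduced_ring TYPE('a)"
    and "F_finite p TYPE('a)" and "krull_dim_eq TYPE('a) d" and "gorenstein_local m d"
    and "residue_field_infinite m" and "residue_field_perfect p m"
    and "minimal_reduction m d x"
    and "ideal I" and "gen_ideal (x ` {..<d}) \<subseteq> I"
  shows "let e = hs_mult m d; s = F_signature p m d;
             \<mu> = real (mu_quot I (gen_ideal (x ` {..<d})))
         in hk_mult p m d \<ge> (e - s * \<mu>) / (e - \<mu>)
          \<and> hk_mult p m d \<ge> 1 + \<mu> / (e - \<mu>) * (1 - s)"
proof -
  interpret F_finite_local m p
    by unfold_locales fact+
  have x: "x ` {..<d} \<subseteq> m" and integral: "\<And>a. a \<in> m \<Longrightarrow> integral_over_ideal (gen_ideal (x ` {..<d})) a"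
    using \<open>minimal_reduction m d x\<close> by (auto simp: minimal_reduction_def)
  obtain xs where xs: "length xs = d" "regular_sop {0} xs" "gen_ideal (set xs) = gen_ideal (x ` {..<d})"
    "simple_socle (gen_ideal (set xs))"
    using gorenstein_parameter_ideal[OF \<open>gorenstein_local m d\<close> x
        m_primary_reduction[OF R.subspace_span integral]] .
  have "hs_mult m d = real (len_quot (gen_ideal (x ` {..<d})))"
    using hs_mult_reduction[OF xs(2)] integral unfolding xs(1,3) .
  then show ?thesis
    using hk_bound_arithmetic[OF hk_mult_inequalities[OF \<open>reduced_ring TYPE('a)\<close> xs(2,4) \<open>ideal I\<close>]]
      \<open>gen_ideal (x ` {..<d}) \<subseteq> I\<close>
    unfolding Let_def xs(1,3) by metis
qed

end
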